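(* There is a polynomial-time algorithm which, given a cubic polynomial $p:\mathbb{R}^n\to\mathbb{R}$ with rational coefficients and a point $\bar{x}\in\mathbb{R}^n$ with rational entries, decides whether $\bar{x}$ is a strict local minimum of $p$.
   Context: A cubic polynomial is a real polynomial all of whose monomials have degree at most 3. The number of variables $n$ is part of the input. Complexity is in the Turing model; the input size is the number of bits needed to write down the coefficients of $p$ and the entries of $\bar x$, all rational. A point $\bar x$ is a strict local minimum of $p$ if there is $\epsilon>0$ such that $p(\bar x)< p(y)$ for all $y\neq \bar x$ with $\|y-\bar x\|\le\epsilon$. *)

theory Defs
  imports
    "HOL-Analysis.L2_Norm"
    "HOL-Library.Poly_Mapping"
    "HOL-Computational_Algebra.Polynomial"
    "Jordan_Normal_Form.Matrix"
begin

section \<open>Cubic polynomials and strict local minima\<close>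

text \<open>
  A polynomial in the variables with indices \<open>0, \<dots>, n - 1\<close> is a finitely supported map from
  monomials to coefficients, a monomial being a finitely supported map from variable indices to
  exponents. The dimension \<open>n\<close> varies, so points of \<open>n\<close>-space are vectors in
  \<^term>\<open>carrier_vec n\<close>.
\<close>

type_synonym monomial = "nat \<Rightarrow>\<^sub>0 nat"
type_synonym rat_mpoly = "monomial \<Rightarrow>\<^sub>0 rat"

definition monom_degree :: "monomial \<Rightarrow> nat" where
  "monom_degree m = (\<Sum>i\<in>Poly_Mapping.keys m. Poly_Mapping.lookup m i)"

definition cubic :: "nat \<Rightarrow> rat_mpoly \<Rightarrow> bool" where
  "cubic n p \<longleftrightarrow>
     (\<forall>m\<in>Poly_Mapping.keys p. Poly_Mapping.keys m \<subseteq> {..<n} \<and> monom_degree m \<le> 3)"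

definition eval_mpoly :: "rat_mpoly \<Rightarrow> real vec \<Rightarrow> real" where
  "eval_mpoly p y =
     (\<Sum>m\<in>Poly_Mapping.keys p. real_of_rat (Poly_Mapping.lookup p m) *
        (\<Prod>i\<in>Poly_Mapping.keys m. (y $ i) ^ Poly_Mapping.lookup m i))"

definition vec_norm2 :: "real vec \<Rightarrow> real" where
  "vec_norm2 v = L2_set (\<lambda>i. v $ i) {..<dim_vec v}"

definition strict_local_min :: "nat \<Rightarrow> (real vec \<Rightarrow> real) \<Rightarrow> real vec \<Rightarrow> bool" where
  "strict_local_min n f x \<longleftrightarrow>
     (\<exists>\<epsilon>>0. \<forall>y\<in>carrier_vec n. y \<noteq> x \<and> vec_norm2 (y - x) \<le> \<epsilon> \<longrightarrow> f x < f y)"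


section \<open>Deterministic multi-tape Turing machines\<close>

datatype move = Left | Stay | Right

record ('q, 'a) tm =
  tape_count :: nat
  states     :: "'q set"
  symbols    :: "'a set"
  blank      :: 'a
  start      :: 'q
  accepting  :: 'q
  rejecting  :: 'q
  trans_fun  :: "'q \<Rightarrow> 'a list \<Rightarrow> 'q \<times> ('a \<times> move) list"

text \<open>
  Given the current state and the list of symbols under the heads (one per tape), \<open>trans_fun\<close>
  yields the next state and, for each tape, the symbol to write and the head movement.
\<close>

definition wf_tm :: "('q, 'a) tm \<Rightarrow> bool" where
  "wf_tm M \<longleftrightarrow>
     tape_count M \<ge> 1 \<and> finite (states M) \<and> finite (symbols M) \<and> blank M \<in> symbols M \<and>
     start M \<in> states M \<and> accepting M \<in> states M \<and> rejecting M \<in> states M \<and>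
     accepting M \<noteq> rejecting M \<and>
     (\<forall>q\<in>states M. \<forall>as. length as = tape_count M \<and> set as \<subseteq> symbols M \<longrightarrow>
        (case trans_fun M q as of (q', acts) \<Rightarrow>
           q' \<in> states M \<and> length acts = tape_count M \<and> fst ` set acts \<subseteq> symbols M))"

text \<open>Tapes are infinite in both directions; the second component is the head position.\<close>

type_synonym 'a tape = "(int \<Rightarrow> 'a) \<times> int"
type_synonym ('q, 'a) config = "'q \<times> 'a tape list"

fun head_symbol :: "'a tape \<Rightarrow> 'a" where
  "head_symbol (t, h) = t h"

fun move_head :: "move \<Rightarrow> int \<Rightarrow> int" where
  "move_head Left h = h - 1"
| "move_head Stay h = h"
| "move_head Right h = h + 1"

fun act_on_tape :: "'a \<times> move \<Rightarrow> 'a tape \<Rightarrow> 'a tape" where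
  "act_on_tape (a, d) (t, h) = (t(h := a), move_head d h)"

fun tm_step :: "('q, 'a) tm \<Rightarrow> ('q, 'a) config \<Rightarrow> ('q, 'a) config" where
  "tm_step M (q, ts) =
     (if q = accepting M \<or> q = rejecting M then (q, ts)
      else (case trans_fun M q (map head_symbol ts) of
              (q', acts) \<Rightarrow> (q', map2 act_on_tape acts ts)))"

definition input_tape :: "('q, 'a) tm \<Rightarrow> 'a list \<Rightarrow> 'a tape" where
  "input_tape M w = ((\<lambda>z. if 0 \<le> z \<and> z < int (length w) then w ! nat z else blank M), 0)"

definition initial_config :: "('q, 'a) tm \<Rightarrow> 'a list \<Rightarrow> ('q, 'a) config" where
  "initial_config M w =
     (start M, input_tape M w # replicate (tape_count M - 1) (input_tape M []))"

definition valid_input :: "('q, 'a) tm \<Rightarrow> 'a list \<Rightarrow> bool" where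
  "valid_input M w \<longleftrightarrow> set w \<subseteq> symbols M - {blank M}"

text \<open>On input \<open>w\<close>, within \<open>T\<close> steps, \<open>M\<close> halts and accepts if \<open>b\<close>, halts and rejects otherwise.\<close>

definition answers_within :: "('q, 'a) tm \<Rightarrow> 'a list \<Rightarrow> nat \<Rightarrow> bool \<Rightarrow> bool" where
  "answers_within M w T b \<longleftrightarrow>
     (\<exists>t\<le>T. fst ((tm_step M ^^ t) (initial_config M w)) =
            (if b then accepting M else rejecting M))"


section \<open>Problem instances as words\<close>

datatype letter = Bit bool | Minus | Slash | Comma | Semicolon

text \<open>Binary digits, least significant digit first; zero is the empty word.\<close>

fun bits :: "nat \<Rightarrow> letter list" where
  "bits n = (if n = 0 then [] else Bit (odd n) # bits (n div 2))"

declare bits.simps [simp del]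

text \<open>A rational is written as a fraction in lowest terms with positive denominator.\<close>

definition encode_rat :: "rat \<Rightarrow> letter list" where
  "encode_rat r =
     (case quotient_of r of (a, b) \<Rightarrow>
        (if a < 0 then [Minus] else []) @ bits (nat \<bar>a\<bar>) @ [Slash] @ bits (nat b))"

definition encode_rats :: "rat list \<Rightarrow> letter list" where
  "encode_rats rs = concat (map (\<lambda>r. encode_rat r @ [Comma]) rs)"

definition monom_of :: "nat list \<Rightarrow> monomial" where
  "monom_of is = (\<Sum>i\<leftarrow>is. Poly_Mapping.single i 1)"

definition cubic_monomials :: "nat \<Rightarrow> monomial list" where
  "cubic_monomials n = map monom_of
     ([[]] @
      [[i]. i \<leftarrow> [0..<n]] @
      [[i, j]. i \<leftarrow> [0..<n], j \<leftarrow> [i..<n]] @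
      [[i, j, k]. i \<leftarrow> [0..<n], j \<leftarrow> [i..<n], k \<leftarrow> [j..<n]])"

text \<open>
  The entries of the point are followed by the coefficients of all monomials of degree at most
  3, zero coefficients included. There are only \<open>(n + 3) choose 3\<close> of these, so up to a
  polynomial the length of the word is the number of bits of the data. The number of variables
  \<open>n\<close> is the number of entries before the semicolon.
\<close>

definition encode_instance :: "nat \<Rightarrow> rat_mpoly \<Rightarrow> rat vec \<Rightarrow> letter list" where
  "encode_instance n p x =
     encode_rats (list_of_vec x) @ [Semicolon] @
     encode_rats (map (Poly_Mapping.lookup p) (cubic_monomials n))"

text \<open>Machines work over natural numbers as symbols, so letters are numbered.\<close>

fun letter_code :: "letter \<Rightarrow> nat" where
  "letter_code (Bit False) = 0"
| "letter_code (Bit True) = 1"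
| "letter_code Minus = 2"
| "letter_code Slash = 3"
| "letter_code Comma = 4"
| "letter_code Semicolon = 5"

definition input_word :: "nat \<Rightarrow> rat_mpoly \<Rightarrow> rat vec \<Rightarrow> nat list" where
  "input_word n p x = map letter_code (encode_instance n p x)"

lemma lookup_monom_of: "Poly_Mapping.lookup (monom_of is) i = count_list is i"
  by (induction "is") (auto simp: monom_of_def lookup_add lookup_single when_def)

lemma inj_on_monom_of: "inj_on monom_of {is. sorted is}"
proof (rule inj_onI)
  fix xs ys assume "xs \<in> {is. sorted is}" "ys \<in> {is. sorted is}"
    and eq: "monom_of xs = monom_of ys"
  then have sorted: "sorted xs" "sorted ys" by auto
  have "count_list xs i = count_list ys i" for i
    by (simp add: lookup_monom_of[symmetric] eq)
  then have "mset xs = mset ys"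
    by (intro multiset_eqI) (simp add: count_mset)
  then show "xs = ys"
    using sorted by (metis properties_for_sort)
qed

lemma distinct_cubic_monomials: "distinct (cubic_monomials n)"
  unfolding cubic_monomials_def distinct_map
proof (intro conjI)
  let ?xs = "[[]] @
      [[i]. i \<leftarrow> [0..<n]] @
      [[i, j]. i \<leftarrow> [0..<n], j \<leftarrow> [i..<n]] @
      [[i, j, k]. i \<leftarrow> [0..<n], j \<leftarrow> [i..<n], k \<leftarrow> [j..<n]]"
  have *: "distinct (concat (map f [a..<n]))"
    if "\<And>i. i \<in> {a..<n} \<Longrightarrow> distinct (f i)"
       "\<And>i j. i \<noteq> j \<Longrightarrow> set (f i) \<inter> set (f j) = {}"
    for f :: "nat \<Rightarrow> nat list list" and a
    using that by (induction n) (auto simp: disjoint_iff, metis less_irrefl)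
  show "distinct ?xs"
    by (auto simp: distinct_map inj_on_def intro!: *)
  show "inj_on monom_of (set ?xs)"
    by (rule inj_on_subset[OF inj_on_monom_of]) auto
qed

lemma keys_monom_of: "Poly_Mapping.keys (monom_of is) = set is"
  by (auto simp: in_keys_iff lookup_monom_of count_list_0_iff)

lemma monom_degree_monom_of: "monom_degree (monom_of is) = length is"
  by (simp add: monom_degree_def keys_monom_of lookup_monom_of sum_count_set)

lemma monom_of_surj:
  obtains "is" where "sorted is" "m = monom_of is"
proof -
  define M where "M = (\<Sum>i\<in>Poly_Mapping.keys m. replicate_mset (Poly_Mapping.lookup m i) i)"
  have "count M j = Poly_Mapping.lookup m j" for j
    by (auto simp: M_def count_sum in_keys_iff sum.delta)
  then have "m = monom_of (sorted_list_of_multiset M)"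
    by (intro poly_mapping_eqI) (simp add: lookup_monom_of flip: count_mset)
  then show ?thesis using that[of "sorted_list_of_multiset M"] by simp
qed

lemma set_cubic_monomials:
  "set (cubic_monomials n) =
     {m. Poly_Mapping.keys m \<subseteq> {..<n} \<and> monom_degree m \<le> 3}"
proof (intro equalityI subsetI)
  fix m assume "m \<in> set (cubic_monomials n)"
  then show "m \<in> {m. Poly_Mapping.keys m \<subseteq> {..<n} \<and> monom_degree m \<le> 3}"
    by (auto simp: cubic_monomials_def keys_monom_of monom_degree_monom_of)
next
  fix m assume m: "m \<in> {m. Poly_Mapping.keys m \<subseteq> {..<n} \<and> monom_degree m \<le> 3}"
  obtain "is" where is_: "sorted is" "m = monom_of is" by (rule monom_of_surj)
  have "set is \<subseteq> {..<n}" "length is \<le> 3"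
    using m by (auto simp: is_ keys_monom_of monom_degree_monom_of)
  then consider "is = []" | i where "is = [i]" | i j where "is = [i, j]"
    | i j k where "is = [i, j, k]"
    by (auto simp: numeral_3_eq_3 le_Suc_eq length_Suc_conv)
  then show "m \<in> set (cubic_monomials n)"
    unfolding cubic_monomials_def set_map is_(2)
    using is_(1) \<open>set is \<subseteq> {..<n}\<close>
    by cases (auto simp: image_iff intro!: imageI)
qed

lemma bits_inject: "bits a = bits b \<longleftrightarrow> a = b"
proof
  show "bits a = bits b \<Longrightarrow> a = b"
  proof (induction a arbitrary: b rule: bits.induct)
    case (1 a)
    show ?case
    proof (cases "a = 0 \<or> b = 0")
      case True
      then show ?thesis using "1.prems" by (auto simp: bits.simps[of a] bits.simps[of b] split: if_splits)
    next
      case False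
      then have *: "odd a = odd b" "bits (a div 2) = bits (b div 2)"
        using "1.prems" by (auto simp: bits.simps[of a] bits.simps[of b])
      then have "a div 2 = b div 2" using "1.IH" False by blast
      then show ?thesis using *(1)
        by (metis div_mult_mod_eq parity_cases)
    qed
  qed
qed simp

lemma set_bits: "set (bits a) \<subseteq> range Bit"
  by (induction a rule: bits.induct) (subst bits.simps, auto)

lemma append_sep_inject:
  assumes "xs @ c # ys = xs' @ c # ys'" "c \<notin> set xs" "c \<notin> set xs'"
  shows "xs = xs' \<and> ys = ys'"
  using assms by (induction xs arbitrary: xs') (auto simp: Cons_eq_append_conv append_eq_Cons_conv)

lemma set_encode_rat: "set (encode_rat r) \<subseteq> range Bit \<union> {Minus, Slash}"
  using set_bits by (auto simp: encode_rat_def split: prod.splits)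

lemma encode_rat_inject: "encode_rat r = encode_rat s \<longleftrightarrow> r = s"
proof
  assume eq: "encode_rat r = encode_rat s"
  obtain a b where r: "quotient_of r = (a, b)" by fastforce
  obtain c d where s: "quotient_of s = (c, d)" by fastforce
  have pos: "b > 0" "d > 0" using r s quotient_of_denom_pos by auto
  let ?sgn = "\<lambda>a :: int. if a < 0 then [Minus] else []"
  have notin: "Slash \<notin> set (?sgn e @ bits k)" "Minus \<notin> set (bits k)" for e k
    using set_bits[of k] by auto
  have "(?sgn a @ bits (nat \<bar>a\<bar>)) @ Slash # bits (nat b) =
        (?sgn c @ bits (nat \<bar>c\<bar>)) @ Slash # bits (nat d)"
    using eq by (simp add: encode_rat_def r s)
  from append_sep_inject[OF this notin(1) notin(1)]
  have 1: "?sgn a @ bits (nat \<bar>a\<bar>) = ?sgn c @ bits (nat \<bar>c\<bar>)" and "b = d"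
    using pos by (auto simp: bits_inject)
  have "Minus \<in> set (?sgn a @ bits (nat \<bar>a\<bar>)) \<longleftrightarrow> Minus \<in> set (?sgn c @ bits (nat \<bar>c\<bar>))"
    by (simp only: 1)
  then have "a < 0 \<longleftrightarrow> c < 0" using notin(2) by (auto split: if_splits)
  with 1 have "a = c" by (auto simp: bits_inject split: if_splits)
  with \<open>b = d\<close> r s show "r = s" by (metis quotient_of_div)
qed simp

lemma encode_rats_inject: "encode_rats rs = encode_rats ss \<longleftrightarrow> rs = ss"
proof
  show "encode_rats rs = encode_rats ss \<Longrightarrow> rs = ss"
  proof (induction rs arbitrary: ss)
    case Nil
    then show ?case by (cases ss) (auto simp: encode_rats_def)
  next
    case (Cons r rs)
    then obtain s ss' where ss: "ss = s # ss'"
      by (cases ss) (auto simp: encode_rats_def)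
    have notin: "Comma \<notin> set (encode_rat q)" for q using set_encode_rat[of q] by auto
    have "encode_rat r @ Comma # encode_rats rs = encode_rat s @ Comma # encode_rats ss'"
      using Cons.prems by (simp add: ss encode_rats_def)
    from append_sep_inject[OF this notin notin] Cons.IH show ?case
      by (auto simp: ss encode_rat_inject)
  qed
qed simp

lemma inj_letter_code: "inj letter_code"
proof (rule injI)
  fix a b show "letter_code a = letter_code b \<Longrightarrow> a = b"
    by (cases a rule: letter_code.cases; cases b rule: letter_code.cases) auto
qed

lemma input_word_inject:
  assumes "cubic n p" "x \<in> carrier_vec n" "cubic n' p'" "x' \<in> carrier_vec n'"
    and "input_word n p x = input_word n' p' x'"
  shows "n = n' \<and> p = p' \<and> x = x'"
proof -
  have notin: "Semicolon \<notin> set (encode_rats rs)" for rs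
    by (auto simp: encode_rats_def dest!: subsetD[OF set_encode_rat])
  have "encode_instance n p x = encode_instance n' p' x'"
    using assms(5) inj_letter_code by (simp add: input_word_def inj_map_eq_map)
  then have "encode_rats (list_of_vec x) @ Semicolon #
      encode_rats (map (Poly_Mapping.lookup p) (cubic_monomials n)) =
    encode_rats (list_of_vec x') @ Semicolon #
      encode_rats (map (Poly_Mapping.lookup p') (cubic_monomials n'))"
    by (simp add: encode_instance_def)
  from append_sep_inject[OF this notin notin]
  have x: "list_of_vec x = list_of_vec x'"
    and p: "map (Poly_Mapping.lookup p) (cubic_monomials n) =
      map (Poly_Mapping.lookup p') (cubic_monomials n')"
    by (auto simp: encode_rats_inject)
  from x have "x = x'" by (metis vec_list)
  then have n: "n = n'" using assms(2,4) by (metis carrier_vecD)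
  have "Poly_Mapping.lookup p m = Poly_Mapping.lookup p' m" for m
  proof (cases "m \<in> set (cubic_monomials n)")
    case True then show ?thesis using p n by auto
  next
    case False
    then have "m \<notin> Poly_Mapping.keys p" "m \<notin> Poly_Mapping.keys p'"
      using assms(1,3) by (auto simp: cubic_def set_cubic_monomials n)
    then show ?thesis by (simp add: in_keys_iff)
  qed
  then show ?thesis using n \<open>x = x'\<close> by (auto intro: poly_mapping_eqI)
qed

end

theory Submission
  imports
    Defs
    "HOL-Library.Countable"
    "HOL-Library.More_List"
    "Jordan_Normal_Form.Determinant"
begin

text \<open>
  If \<open>d\<close> lies in the kernel of the Hessian, then along the line through \<open>x\<close> in direction \<open>d\<close> a
  cubic polynomial with vanishing gradient is a constant plus \<open>t\<^sup>3\<close> times a constant, so \<open>x\<close> is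
  not a strict minimum on this line. Hence \<open>x\<close> is a strict local minimum if and only if the
  gradient vanishes and the Hessian is positive definite, that is, all trailing principal minors of
  the Hessian are positive. After clearing denominators these minors are computed by Bird's
  division-free iteration
  \<open>Y' i j = A i j * (\<Sum>l>i. Y l l) - (\<Sum>l>i. Y i l * A l j)\<close> starting from \<open>Y = A\<close>: a single run
  produces all of them, and the bit length of the entries grows only linearly with the number of
  steps.

  Polynomial time is established compositionally. Values are binary trees, written in prefix
  notation on a stack; a program for \<open>f\<close> replaces the code of \<open>x\<close> on top of the main stack by the
  code of \<open>f x\<close> and leaves everything below it, and all other stacks, unchanged. Such programs
  compose without any bookkeeping, which yields closure of the polynomial-time functions under
  pairing, case distinction, and iteration along a list with polynomially bounded
  intermediate values.
\<close>

section \<open>A stack language and its compilation to Turing machines\<close>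

text \<open>The choices below keep the arithmetic to sums and products of integers. Gaussian
  elimination would need division and control over the size of fractions; a division-free scheme
  spares the programming of long division and greatest common divisors. For the same reason
  fractions are cleared with the full product of the denominators, and a homogenizing coordinate
  carries the denominator of the point; gradient and Hessian change only by positive factors.
  Trailing rather than leading minors appear because entry \<open>(i, j)\<close> of the m-th iterate
  is a sum of minors over all m-element sets of indices above \<open>i\<close>: once m exhausts
  these indices, a single minor remains on the diagonal. Prefix codes of trees are self-delimiting,
  so a program finds the end of its argument without an end marker. In the sufficiency direction an
  explicit constant \<open>c\<close> with \<open>c |v|^2 \<le> v H v\<close> replaces compactness of
  the sphere and yields a radius within which the cubic term is dominated.\<close>

datatype com =
    Push nat nat
  | Put nat nat
  | Pop nat
  | Seq com com
  | If nat "nat list" com com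
  | While nat "nat list" com

instance com :: countable by countable_datatype

type_synonym stacks = "nat \<Rightarrow> nat list"

abbreviation (input) "num_stacks \<equiv> 5 :: nat"
abbreviation (input) "blank_sym \<equiv> 6 :: nat"

definition top_sym :: "nat list \<Rightarrow> nat" where
  "top_sym xs = (case xs of [] \<Rightarrow> blank_sym | x # _ \<Rightarrow> x)"

lemma top_sym_simps [simp]: "top_sym [] = blank_sym" "top_sym (x # xs) = x"
  by (simp_all add: top_sym_def)

text \<open>The number is an upper bound for the machine steps, with slack in every rule, so that
  running times need not be tracked exactly. \<open>Put\<close> has no rule: it occurs only as the
  control state halfway through a \<open>Push\<close>.\<close>

inductive exec :: "com \<Rightarrow> stacks \<Rightarrow> nat \<Rightarrow> stacks \<Rightarrow> bool" where
  Push: "i < num_stacks \<Longrightarrow> a < blank_sym \<Longrightarrow> 2 \<le> t \<Longrightarrow> exec (Push i a) s t (s(i := a # s i))"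
| Pop: "i < num_stacks \<Longrightarrow> s i = a # xs \<Longrightarrow> 1 \<le> t \<Longrightarrow> exec (Pop i) s t (s(i := xs))"
| Seq: "exec c s t1 s1 \<Longrightarrow> exec d s1 t2 s2 \<Longrightarrow> t1 + t2 + 1 \<le> t \<Longrightarrow> exec (Seq c d) s t s2"
| IfT: "i < num_stacks \<Longrightarrow> top_sym (s i) \<in> set A \<Longrightarrow> exec c s t1 s1 \<Longrightarrow> t1 + 1 \<le> t \<Longrightarrow> exec (If i A c d) s t s1"
| IfF: "i < num_stacks \<Longrightarrow> top_sym (s i) \<notin> set A \<Longrightarrow> exec d s t1 s1 \<Longrightarrow> t1 + 1 \<le> t \<Longrightarrow> exec (If i A c d) s t s1"
| WhileT: "i < num_stacks \<Longrightarrow> top_sym (s i) \<in> set A \<Longrightarrow> exec c s t1 s1 \<Longrightarrow> exec (While i A c) s1 t2 s2 \<Longrightarrow>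
    t1 + t2 + 1 \<le> t \<Longrightarrow> exec (While i A c) s t s2"
| WhileF: "i < num_stacks \<Longrightarrow> top_sym (s i) \<notin> set A \<Longrightarrow> 1 \<le> t \<Longrightarrow> exec (While i A c) s t s"

lemma exec_mono:
  assumes "exec c s t s'" and le: "t \<le> t'"
  shows "exec c s t' s'"
  using assms(1)
proof cases
  case Push
  then show ?thesis using le by (auto intro!: exec.Push)
next
  case Pop
  then show ?thesis using le by (auto intro!: exec.Pop)
next
  case Seq
  then show ?thesis using le exec.Seq le_trans by blast
next
  case IfT
  then show ?thesis using le exec.IfT le_trans by blast
next
  case IfF
  then show ?thesis using le exec.IfF le_trans by blast
next
  case WhileT
  then show ?thesis using le exec.WhileT le_trans by blast
next
  case WhileF
  then show ?thesis using le by (auto intro!: exec.WhileF)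
qed

text \<open>
  A stack is a tape whose head is on the top symbol, the rest of the stack lying to its right, so
  that the initial tapes are stacks already. A push takes two steps, a head movement to
  the left followed by the auxiliary command \<open>Put\<close>, which overwrites the scanned symbol.
\<close>

definition represents :: "nat tape \<Rightarrow> nat list \<Rightarrow> bool" where
  "represents T xs \<longleftrightarrow>
     (\<forall>j. fst T (snd T + int j) = (if j < length xs then xs ! j else blank_sym))"

lemma head_symbol_represents: "represents T xs \<Longrightarrow> head_symbol T = top_sym xs"
  by (cases T; cases xs) (auto simp: represents_def dest: spec[of _ 0])

text \<open>Nothing is erased: \<open>represents\<close> leaves the cells to the left of the head
  unconstrained, so a popped symbol may stay behind. This is why a push must overwrite the cell it
  moves to.\<close>

lemma represents_pop:
  assumes "represents T (x # xs)"
  shows "represents (act_on_tape (a, Right) T) xs"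
proof (cases T)
  case (Pair t h)
  show ?thesis unfolding represents_def
  proof
    fix j
    show "fst (act_on_tape (a, Right) T) (snd (act_on_tape (a, Right) T) + int j) =
        (if j < length xs then xs ! j else blank_sym)"
      using assms[unfolded represents_def, rule_format, of "Suc j"] by (simp add: Pair ac_simps)
  qed
qed

lemma represents_push:
  assumes "represents T xs"
  shows "represents (act_on_tape (a, Stay) (act_on_tape (top_sym xs, Left) T)) (a # xs)"
proof (cases T)
  case (Pair t h)
  have top: "t h = top_sym xs"
    using head_symbol_represents[OF assms] by (simp add: Pair)
  show ?thesis unfolding represents_def
  proof
    fix j
    show "fst (act_on_tape (a, Stay) (act_on_tape (top_sym xs, Left) T))
        (snd (act_on_tape (a, Stay) (act_on_tape (top_sym xs, Left) T)) + int j) =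
        (if j < length (a # xs) then (a # xs) ! j else blank_sym)"
    proof (cases j)
      case 0
      then show ?thesis by (simp add: Pair)
    next
      case (Suc k)
      then show ?thesis
        using assms[unfolded represents_def, rule_format, of k] top by (cases xs) (auto simp: Pair)
    qed
  qed
qed

lemma act_on_tape_stay [simp]: "act_on_tape (head_symbol T, Stay) T = T"
  by (cases T) auto

text \<open>The offset keeps the numbers 0 and 1 free for the accepting and the rejecting
  state.\<close>

definition state_code :: "com list \<Rightarrow> nat" where
  "state_code k = to_nat k + 2"

definition single_act :: "nat list \<Rightarrow> nat \<Rightarrow> nat \<times> move \<Rightarrow> (nat \<times> move) list" where
  "single_act as i m = map (\<lambda>j. if j = i then m else (as ! j, Stay)) [0..<num_stacks]"

definition no_act :: "nat list \<Rightarrow> (nat \<times> move) list" where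
  "no_act as = map (\<lambda>j. (as ! j, Stay)) [0..<num_stacks]"

text \<open>With no command left, the verdict is read off the top of stack 0: the code of
  \<open>True\<close> starts with 1, that of \<open>False\<close> with 0. The minimum with
  \<open>blank_sym\<close> keeps written symbols in the alphabet whatever number a command
  contains.\<close>

fun next_action :: "com list \<Rightarrow> nat list \<Rightarrow> nat \<times> (nat \<times> move) list" where
  "next_action [] as = (if as ! 0 = 1 then 0 else 1, no_act as)"
| "next_action (Push i a # k) as = (state_code (Put i a # k), single_act as i (as ! i, Left))"
| "next_action (Put i a # k) as = (state_code k, single_act as i (min a blank_sym, Stay))"
| "next_action (Pop i # k) as = (state_code k, single_act as i (as ! i, Right))"
| "next_action (Seq c d # k) as = (state_code (c # d # k), no_act as)"
| "next_action (If i A c d # k) as =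
     (state_code ((if as ! i \<in> set A then c else d) # k), no_act as)"
| "next_action (While i A c # k) as =
     (state_code (if as ! i \<in> set A then c # While i A c # k else k), no_act as)"

text \<open>
  The control states are the lists of commands that remain to be executed. Those that occur while
  \<open>c\<close> is run before \<open>k\<close> form a finite set.
\<close>

fun residuals :: "com \<Rightarrow> com list \<Rightarrow> com list set" where
  "residuals (Push i a) k = {Push i a # k, Put i a # k}"
| "residuals (Put i a) k = {Put i a # k}"
| "residuals (Pop i) k = {Pop i # k}"
| "residuals (Seq c d) k = {Seq c d # k} \<union> residuals c (d # k) \<union> residuals d k"
| "residuals (If i A c d) k = {If i A c d # k} \<union> residuals c k \<union> residuals d k"
| "residuals (While i A c) k = {While i A c # k} \<union> residuals c (While i A c # k)"

lemma finite_residuals [simp]: "finite (residuals c k)"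
  by (induction c arbitrary: k) auto

lemma residuals_self: "c # k \<in> residuals c k"
  by (cases c) auto

text \<open>Control stays within the residuals of \<open>c\<close> until the continuation
  \<open>k\<close> is reached; this makes the state set of \<open>machine c\<close> closed under
  transitions.\<close>

lemma next_action_residuals:
  "q \<in> residuals c k \<Longrightarrow> fst (next_action q as) \<in> state_code ` insert k (residuals c k)"
proof (induction c arbitrary: k)
  case (Seq c d)
  then show ?case using residuals_self[of d k] residuals_self[of c "d # k"] by fastforce
next
  case (If i A c d)
  then show ?case using residuals_self[of c k] residuals_self[of d k] by fastforce
next
  case (While i A c)
  then show ?case using residuals_self[of c "While i A c # k"] by fastforce
qed auto

lemma next_action_symbols:
  assumes "length as = num_stacks" "set as \<subseteq> {..blank_sym}"
  shows "length (snd (next_action q as)) = num_stacks" "fst ` set (snd (next_action q as)) \<subseteq> {..blank_sym}"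
proof -
  have nth: "as ! j \<le> blank_sym" if "j < num_stacks" for j
    using assms that by (metis atMost_iff nth_mem subsetD)
  show "length (snd (next_action q as)) = num_stacks"
    by (induction q as rule: next_action.induct) (auto simp: single_act_def no_act_def)
  show "fst ` set (snd (next_action q as)) \<subseteq> {..blank_sym}"
    using nth
    by (induction q as rule: next_action.induct) (auto simp: single_act_def no_act_def split: if_splits)
qed

text \<open>States 0 and 1 are final for \<open>tm_step\<close>, but \<open>wf_tm\<close> quantifies
  over all states, hence the clause for \<open>q < 2\<close>.\<close>

definition machine :: "com \<Rightarrow> (nat, nat) tm" where
  "machine c = \<lparr>tape_count = num_stacks,
     states = {0, 1} \<union> state_code ` insert [] (residuals c []),
     symbols = {..blank_sym}, blank = blank_sym, start = state_code [c],
     accepting = 0, rejecting = 1,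
     trans_fun = (\<lambda>q as. if q < 2 then (q, no_act as) else next_action (from_nat (q - 2)) as)\<rparr>"

lemma machine_simps [simp]:
  "tape_count (machine c) = num_stacks" "symbols (machine c) = {..blank_sym}"
  "blank (machine c) = blank_sym" "start (machine c) = state_code [c]"
  "accepting (machine c) = 0" "rejecting (machine c) = 1"
  "trans_fun (machine c) (state_code k) as = next_action k as"
  by (simp_all add: machine_def state_code_def)

lemma state_code_neq [simp]: "state_code k \<noteq> 0" "state_code k \<noteq> Suc 0"
  by (simp_all add: state_code_def)

lemma wf_machine: "wf_tm (machine c)"
proof -
  have "case trans_fun (machine c) q as of (q', acts) \<Rightarrow>
      q' \<in> states (machine c) \<and> length acts = num_stacks \<and> fst ` set acts \<subseteq> {..blank_sym}"
    if q: "q \<in> states (machine c)" and as: "length as = num_stacks" "set as \<subseteq> {..blank_sym}" for q as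
  proof (cases "q < 2")
    case True
    have "as ! j \<le> blank_sym" if "j < num_stacks" for j
      using as that by (metis atMost_iff nth_mem subsetD)
    then show ?thesis using q True by (auto simp: machine_def no_act_def)
  next
    case False
    then obtain k where k: "q = state_code k" "k \<in> insert [] (residuals c [])"
      using q by (auto simp: machine_def)
    have "fst (next_action k as) \<in> states (machine c)"
    proof (cases "k = []")
      case True
      then show ?thesis by (simp add: machine_def)
    next
      case False
      then show ?thesis
        using next_action_residuals[of k c "[]" as] k by (auto simp: machine_def)
    qed
    with next_action_symbols[OF as, of k] show ?thesis
      by (force simp: k split: prod.split)
  qed
  moreover have "start (machine c) \<in> states (machine c)"
    using residuals_self[of c "[]"] by (auto simp: machine_def)
  ultimately show ?thesis
    unfolding wf_tm_def by (auto simp: machine_def)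
qed

section \<open>Simulation of stack commands by machine steps\<close>

definition represents_all :: "nat tape list \<Rightarrow> stacks \<Rightarrow> bool" where
  "represents_all ts s \<longleftrightarrow> length ts = num_stacks \<and> (\<forall>i < num_stacks. represents (ts ! i) (s i))"

lemma map2_no_act:
  "length ts = num_stacks \<Longrightarrow> map2 act_on_tape (no_act (map head_symbol ts)) ts = ts"
  by (rule nth_equalityI) (auto simp: no_act_def)

lemma map2_single_act:
  "length ts = num_stacks \<Longrightarrow> i < num_stacks \<Longrightarrow>
   map2 act_on_tape (single_act (map head_symbol ts) i m) ts = ts[i := act_on_tape m (ts ! i)]"
  by (rule nth_equalityI) (auto simp: single_act_def nth_list_update)

lemma tm_step_machine:
  "tm_step (machine c) (state_code k, ts) =
     (case next_action k (map head_symbol ts) of (q', acts) \<Rightarrow> (q', map2 act_on_tape acts ts))"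
  by simp

lemma head_symbols_nth:
  "represents_all ts s \<Longrightarrow> i < num_stacks \<Longrightarrow> map head_symbol ts ! i = top_sym (s i)"
  by (simp add: represents_all_def head_symbol_represents)

lemma represents_all_update:
  "represents_all ts s \<Longrightarrow> represents T xs \<Longrightarrow> i < num_stacks \<Longrightarrow>
   represents_all (ts[i := T]) (s(i := xs))"
  by (auto simp: represents_all_def nth_list_update)

abbreviation reaches :: "com \<Rightarrow> com list \<Rightarrow> nat tape list \<Rightarrow> nat \<Rightarrow> com list \<Rightarrow> stacks \<Rightarrow> bool" where
  "reaches c0 k ts t k' s' \<equiv> \<exists>t'\<le>t. \<exists>ts'.
     (tm_step (machine c0) ^^ t') (state_code k, ts) = (state_code k', ts') \<and> represents_all ts' s'"

lemma reaches_step: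
  assumes "tm_step (machine c0) (state_code k, ts) = (state_code k1, ts1)"
    and "reaches c0 k1 ts1 t k' s'" and "t + 1 \<le> u"
  shows "reaches c0 k ts u k' s'"
proof -
  obtain t' ts' where *: "t' \<le> t"
    "(tm_step (machine c0) ^^ t') (state_code k1, ts1) = (state_code k', ts')" "represents_all ts' s'"
    using assms(2) by blast
  have "(tm_step (machine c0) ^^ Suc t') (state_code k, ts) = (state_code k', ts')"
    using assms(1) *(2) by (simp add: funpow_swap1)
  then show ?thesis using * assms(3) by (intro exI[of _ "Suc t'"]) auto
qed

lemma reaches_trans:
  assumes "reaches c0 k ts t1 k1 s1"
    and "\<And>ts1. represents_all ts1 s1 \<Longrightarrow> reaches c0 k1 ts1 t2 k2 s2" and "t1 + t2 \<le> t"
  shows "reaches c0 k ts t k2 s2"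
proof -
  obtain t' ts1 where 1: "t' \<le> t1" "represents_all ts1 s1"
    "(tm_step (machine c0) ^^ t') (state_code k, ts) = (state_code k1, ts1)"
    using assms(1) by blast
  obtain t'' ts2 where 2: "t'' \<le> t2" "represents_all ts2 s2"
    "(tm_step (machine c0) ^^ t'') (state_code k1, ts1) = (state_code k2, ts2)"
    using assms(2)[OF 1(2)] by blast
  have "(tm_step (machine c0) ^^ (t'' + t')) (state_code k, ts) = (state_code k2, ts2)"
    using 1(3) 2(3) by (simp add: funpow_add)
  then show ?thesis using 1 2 assms(3) by (intro exI[of _ "t'' + t'"]) auto
qed

lemma reaches_0: "represents_all ts s \<Longrightarrow> reaches c0 k ts t k s"
  by (intro exI[of _ 0]) auto

text \<open>The continuation \<open>k\<close> is arbitrary, so the induction hypothesis applies to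
  the first part of a sequence or to a loop body, with the rest of the program as its
  continuation.\<close>

lemma exec_reaches:
  "exec c s t s' \<Longrightarrow> represents_all ts s \<Longrightarrow> reaches c0 (c # k) ts t k s'"
proof (induction arbitrary: ts k rule: exec.induct)
  case (Push i a t s)
  have len: "length ts = num_stacks" and i: "represents (ts ! i) (s i)"
    using Push by (auto simp: represents_all_def)
  let ?ts1 = "ts[i := act_on_tape (top_sym (s i), Left) (ts ! i)]"
  have step1: "tm_step (machine c0) (state_code (Push i a # k), ts) = (state_code (Put i a # k), ?ts1)"
    using Push.hyps len head_symbols_nth[OF Push.prems(1), of i]
    by (simp add: tm_step_machine map2_single_act)
  have step2: "tm_step (machine c0) (state_code (Put i a # k), ?ts1) =
      (state_code k, ?ts1[i := act_on_tape (a, Stay) (?ts1 ! i)])"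
    using Push.hyps len by (simp add: tm_step_machine map2_single_act del: list_update_overwrite)
  have "represents_all (ts[i := act_on_tape (a, Stay) (act_on_tape (top_sym (s i), Left) (ts ! i))])
      (s(i := a # s i))"
    using Push represents_push[OF i] by (intro represents_all_update)
  then have rep: "represents_all (?ts1[i := act_on_tape (a, Stay) (?ts1 ! i)]) (s(i := a # s i))"
    using Push.hyps len by simp
  have "reaches c0 (Put i a # k) ?ts1 1 k (s(i := a # s i))"
    by (rule reaches_step[OF step2 reaches_0[OF rep, where t = 0]]) simp
  then show ?case
    by (rule reaches_step[OF step1]) (use Push.hyps(3) in simp)
next
  case (Pop i s a xs t)
  have len: "length ts = num_stacks" and i: "represents (ts ! i) (a # xs)"
    using Pop by (auto simp: represents_all_def)
  have step: "tm_step (machine c0) (state_code (Pop i # k), ts) =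
      (state_code k, ts[i := act_on_tape (a, Right) (ts ! i)])"
    using Pop.hyps len head_symbols_nth[OF Pop.prems(1), of i]
    by (simp add: tm_step_machine map2_single_act)
  have rep: "represents_all (ts[i := act_on_tape (a, Right) (ts ! i)]) (s(i := xs))"
    using Pop represents_pop[OF i] by (intro represents_all_update)
  show ?case
    by (rule reaches_step[OF step reaches_0[OF rep, where t = 0]]) (use Pop.hyps(3) in simp)
next
  case (Seq c s t1 s1 d t2 s2 t)
  have step: "tm_step (machine c0) (state_code (Seq c d # k), ts) = (state_code (c # d # k), ts)"
    using Seq.prems by (simp add: tm_step_machine map2_no_act represents_all_def)
  show ?case
    by (rule reaches_step[OF step reaches_trans[OF Seq.IH(1)[OF Seq.prems] Seq.IH(2)]])
      (use Seq.hyps in auto)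
next
  case (IfT i s A c t1 s1 t d)
  have step: "tm_step (machine c0) (state_code (If i A c d # k), ts) = (state_code (c # k), ts)"
    using IfT head_symbols_nth[OF IfT.prems(1), of i]
    by (simp add: tm_step_machine map2_no_act represents_all_def)
  show ?case by (rule reaches_step[OF step IfT.IH]) (use IfT in auto)
next
  case (IfF i s A d t1 s1 t c)
  have step: "tm_step (machine c0) (state_code (If i A c d # k), ts) = (state_code (d # k), ts)"
    using IfF head_symbols_nth[OF IfF.prems(1), of i]
    by (simp add: tm_step_machine map2_no_act represents_all_def)
  show ?case by (rule reaches_step[OF step IfF.IH]) (use IfF in auto)
next
  case (WhileT i s A c t1 s1 t2 s2 t)
  have step: "tm_step (machine c0) (state_code (While i A c # k), ts) =
      (state_code (c # While i A c # k), ts)"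
    using WhileT head_symbols_nth[OF WhileT.prems(1), of i]
    by (simp add: tm_step_machine map2_no_act represents_all_def)
  show ?case
    by (rule reaches_step[OF step reaches_trans[OF WhileT.IH(1)[OF WhileT.prems] WhileT.IH(2)]])
      (use WhileT.hyps in auto)
next
  case (WhileF i s A t c)
  have step: "tm_step (machine c0) (state_code (While i A c # k), ts) = (state_code k, ts)"
    using WhileF head_symbols_nth[OF WhileF.prems(1), of i]
    by (simp add: tm_step_machine map2_no_act represents_all_def)
  show ?case
    by (rule reaches_step[OF step reaches_0[OF WhileF.prems, where t = 0]]) (use WhileF.hyps(3) in simp)
qed

text \<open>The step added to \<open>t\<close> is the one that reads the verdict when the command
  list has become empty.\<close>

lemma machine_answers:
  assumes "exec c ((\<lambda>_. [])(0 := w)) t s'" and "top_sym (s' 0) = 1 \<longleftrightarrow> b" and "t + 1 \<le> u"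
  shows "answers_within (machine c) w u b"
proof -
  let ?ts = "input_tape (machine c) w # replicate (tape_count (machine c) - 1) (input_tape (machine c) [])"
  have "represents_all ?ts ((\<lambda>_. [])(0 := w))"
    by (auto simp: represents_all_def represents_def input_tape_def nth_Cons nth_append split: nat.split)
  from exec_reaches[OF assms(1) this, of c "[]"]
  obtain t' ts' where t': "t' \<le> t" "represents_all ts' s'"
    "(tm_step (machine c) ^^ t') (state_code [c], ?ts) = (state_code [], ts')"
    by blast
  have "fst ((tm_step (machine c) ^^ Suc t') (initial_config (machine c) w)) = (if b then 0 else 1)"
    using t'(3) assms(2) head_symbols_nth[OF t'(2), of 0]
    by (simp add: initial_config_def tm_step_machine)
  then show ?thesis
    using t'(1) assms(3) unfolding answers_within_def by (intro exI[of _ "Suc t'"]) simp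
qed

section \<open>Trees on stacks\<close>

datatype tree = Leaf | Node tree tree

fun code :: "tree \<Rightarrow> nat list" where
  "code Leaf = [0]"
| "code (Node a b) = 1 # code a @ code b"

lemma length_code_pos: "0 < length (code t)"
  by (cases t) auto

lemma set_code: "set (code t) \<subseteq> {0, 1}"
  by (induction t) auto

lemma exec_weaken: "exec c s t s1 \<Longrightarrow> t \<le> t' \<Longrightarrow> s1 = s2 \<Longrightarrow> exec c s t' s2"
  using exec_mono by blast

lemma exec_Push_exact: "i < num_stacks \<Longrightarrow> a < blank_sym \<Longrightarrow> exec (Push i a) s 2 (s(i := a # s i))"
  by (rule exec.Push) auto

lemma exec_Pop_exact: "i < num_stacks \<Longrightarrow> s i \<noteq> [] \<Longrightarrow> exec (Pop i) s 1 (s(i := tl (s i)))"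
  by (rule exec.Pop[where a = "hd (s i)"]) auto

lemma exec_Seq_exact: "exec c s t1 s1 \<Longrightarrow> exec d s1 t2 s2 \<Longrightarrow> exec (Seq c d) s (t1 + t2 + 1) s2"
  by (rule exec.Seq) auto

definition unload_body :: "nat \<Rightarrow> com" where
  "unload_body i = If i [1]
     (Seq (Push 3 1) (Seq (Pop i) (Push 1 1)))
     (Seq (Pop 3) (Seq (Pop i) (Push 1 0)))"

text \<open>
  Moves a tree code from stack \<open>i\<close> in reverse order to stack 1, on top of a separator 2. The number
  of ones on stack 3 is the number of subtrees that are still to be read.
\<close>

definition unload :: "nat \<Rightarrow> com" where
  "unload i = Seq (Push 1 2) (Seq (Push 3 0) (Seq (Push 3 1)
     (Seq (While 3 [1] (unload_body i)) (Pop 3))))"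

text \<open>Moving a reversed code once more restores its order. The separator 2 stops the loop even
  if stack 1 holds older material underneath.\<close>

definition reload :: "nat \<Rightarrow> com" where
  "reload j = Seq (While 1 [0, 1]
       (If 1 [1] (Seq (Pop 1) (Push j 1)) (Seq (Pop 1) (Push j 0))))
     (Pop 1)"

definition reload2 :: "nat \<Rightarrow> nat \<Rightarrow> com" where
  "reload2 i j = Seq (While 1 [0, 1]
       (If 1 [1] (Seq (Pop 1) (Seq (Push i 1) (Push j 1)))
                 (Seq (Pop 1) (Seq (Push i 0) (Push j 0)))))
     (Pop 1)"

definition discard :: com where
  "discard = Seq (While 1 [0, 1] (Pop 1)) (Pop 1)"

text \<open>A subtree is read in the middle of a loop that goes on afterwards, so the remaining run
  is a premise; for \<open>Node\<close> the two subtrees are chained by applying one hypothesis to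
  the result of the other. One round takes 8 steps for the body and 1 for the test, within the 10
  granted per symbol.\<close>

lemma unload_loop:
  assumes "i < num_stacks" "i \<noteq> 1" "i \<noteq> 3"
  shows "s i = code t @ r \<Longrightarrow> s 3 = 1 # n \<Longrightarrow>
    exec (While 3 [1] (unload_body i)) (s(i := r, 1 := rev (code t) @ s 1, 3 := n)) T u \<Longrightarrow>
    exec (While 3 [1] (unload_body i)) s (T + 10 * length (code t)) u"
proof (induction t arbitrary: s r n T)
  case Leaf
  have "exec (unload_body i) s 8 (s(i := r, 1 := rev (code Leaf) @ s 1, 3 := n))"
    unfolding unload_body_def using assms Leaf
    by (intro exec.IfF exec_weaken[OF exec_Seq_exact[OF exec_Pop_exact exec_Seq_exact[OF exec_Pop_exact exec_Push_exact]]])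
      (auto simp: fun_eq_iff)
  from exec.WhileT[OF _ _ this Leaf(3)] show ?case using Leaf by auto
next
  case (Node a b)
  let ?s1 = "s(i := code a @ code b @ r, 1 := 1 # s 1, 3 := 1 # 1 # n)"
  let ?s2 = "?s1(i := code b @ r, 1 := rev (code a) @ ?s1 1, 3 := 1 # n)"
  have eq: "?s2(i := r, 1 := rev (code b) @ ?s2 1, 3 := n) =
      s(i := r, 1 := rev (code (Node a b)) @ s 1, 3 := n)"
    using assms by (auto simp: fun_eq_iff)
  have pre: "exec (While 3 [1] (unload_body i)) (?s2(i := r, 1 := rev (code b) @ ?s2 1, 3 := n)) T u"
    unfolding eq by (rule Node.prems(3))
  have pre': "exec (While 3 [1] (unload_body i)) ?s2 (T + 10 * length (code b)) u"
    by (rule Node.IH(2)[OF _ _ pre]) (use assms in auto)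
  have 2: "exec (While 3 [1] (unload_body i)) ?s1
      (T + 10 * length (code b) + 10 * length (code a)) u"
    by (rule Node.IH(1)[OF _ _ pre']) (use assms in auto)
  have "exec (unload_body i) s 8 ?s1"
    unfolding unload_body_def using assms Node.prems
    by (intro exec.IfT exec_weaken[OF exec_Seq_exact[OF exec_Push_exact exec_Seq_exact[OF exec_Pop_exact exec_Push_exact]]])
      (auto simp: fun_eq_iff)
  from exec.WhileT[OF _ _ this 2] show ?case using Node.prems by auto
qed

lemma exec_unload:
  assumes "i < num_stacks" "i \<noteq> 1" "i \<noteq> 3" "s i = code t @ r"
  shows "exec (unload i) s (10 * length (code t) + 12) (s(i := r, 1 := rev (code t) @ 2 # s 1))"
proof -
  let ?s1 = "s(1 := 2 # s 1, 3 := 1 # 0 # s 3)"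
  let ?s2 = "s(i := r, 1 := rev (code t) @ 2 # s 1, 3 := 0 # s 3)"
  have eq: "?s1(i := r, 1 := rev (code t) @ ?s1 1, 3 := 0 # s 3) = ?s2"
    using assms by (auto simp: fun_eq_iff)
  have "exec (While 3 [1] (unload_body i)) ?s2 1 ?s2"
    by (rule exec.WhileF) auto
  then have "exec (While 3 [1] (unload_body i)) ?s1 (1 + 10 * length (code t)) ?s2"
    by (intro unload_loop[OF assms(1-3)]) (use assms in \<open>simp_all add: eq\<close>)
  note loop = exec_Seq_exact[OF this exec_Pop_exact]
  have 4: "exec (Seq (While 3 [1] (unload_body i)) (Pop 3)) ?s1
      (10 * length (code t) + 3) (s(i := r, 1 := rev (code t) @ 2 # s 1))"
    by (rule exec_weaken[OF loop]) (use assms in \<open>auto simp: fun_eq_iff\<close>)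
  have 1: "exec (Push 1 2) s 2 (s(1 := 2 # s 1))"
    by (rule exec.Push) auto
  have 2: "exec (Push 3 0) (s(1 := 2 # s 1)) 2 (s(1 := 2 # s 1, 3 := 0 # s 3))"
    by (rule exec_weaken[OF exec_Push_exact]) auto
  have 3: "exec (Push 3 1) (s(1 := 2 # s 1, 3 := 0 # s 3)) 2 ?s1"
    by (rule exec_weaken[OF exec_Push_exact]) auto
  show ?thesis
    unfolding unload_def
    by (rule exec_weaken[OF exec_Seq_exact[OF 1 exec_Seq_exact[OF 2 exec_Seq_exact[OF 3 4]]]]) auto
qed

lemma exec_reload:
  assumes "j < num_stacks" "j \<noteq> 1"
  shows "set ws \<subseteq> {0, 1} \<Longrightarrow> s 1 = ws @ 2 # r \<Longrightarrow>
    exec (reload j) s (6 * length ws + 3) (s(1 := r, j := rev ws @ s j))"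
proof -
  let ?W = "While 1 [0, 1] (If 1 [1] (Seq (Pop 1) (Push j 1)) (Seq (Pop 1) (Push j 0)))"
  have loop: "exec ?W s (6 * length ws + 1) (s(1 := 2 # r, j := rev ws @ s j))"
    if "set ws \<subseteq> {0, 1}" "s 1 = ws @ 2 # r" for ws s
    using that
  proof (induction ws arbitrary: s)
    case Nil
    show ?case by (rule exec_weaken[OF exec.WhileF]) (use Nil assms in \<open>auto simp: fun_eq_iff\<close>)
  next
    case (Cons w ws)
    let ?s1 = "s(1 := ws @ 2 # r, j := w # s j)"
    have "exec (If 1 [1] (Seq (Pop 1) (Push j 1)) (Seq (Pop 1) (Push j 0))) s 5 ?s1"
    proof (cases "w = 1")
      case True
      then show ?thesis using Cons.prems assms
        by (intro exec.IfT exec_weaken[OF exec_Seq_exact[OF exec_Pop_exact exec_Push_exact]])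
          (auto simp: fun_eq_iff)
    next
      case False
      then show ?thesis using Cons.prems assms
        by (intro exec.IfF exec_weaken[OF exec_Seq_exact[OF exec_Pop_exact exec_Push_exact]])
          (auto simp: fun_eq_iff)
    qed
    moreover have "exec ?W ?s1 (6 * length ws + 1) (?s1(1 := 2 # r, j := rev ws @ ?s1 j))"
      by (rule Cons.IH) (use Cons.prems assms in auto)
    ultimately have "exec ?W s (6 * length (w # ws) + 1) (?s1(1 := 2 # r, j := rev ws @ ?s1 j))"
      by (rule exec.WhileT[rotated 2]) (use Cons.prems in auto)
    then show ?case
      by (rule exec_weaken) (use assms in \<open>auto simp: fun_eq_iff\<close>)
  qed
  assume *: "set ws \<subseteq> {0, 1}" "s 1 = ws @ 2 # r"
  show ?thesis
    unfolding reload_def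
    by (rule exec_weaken[OF exec_Seq_exact[OF loop[of ws s, OF *] exec_Pop_exact]])
      (use assms in \<open>auto simp: fun_eq_iff\<close>)
qed

lemma exec_reload2:
  assumes "i < num_stacks" "j < num_stacks" "i \<noteq> 1" "j \<noteq> 1" "i \<noteq> j"
  shows "set ws \<subseteq> {0, 1} \<Longrightarrow> s 1 = ws @ 2 # r \<Longrightarrow>
    exec (reload2 i j) s (9 * length ws + 3) (s(1 := r, i := rev ws @ s i, j := rev ws @ s j))"
proof -
  let ?B = "If 1 [1] (Seq (Pop 1) (Seq (Push i 1) (Push j 1)))
                 (Seq (Pop 1) (Seq (Push i 0) (Push j 0)))"
  let ?W = "While 1 [0, 1] ?B"
  have loop: "exec ?W s (9 * length ws + 1) (s(1 := 2 # r, i := rev ws @ s i, j := rev ws @ s j))"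
    if "set ws \<subseteq> {0, 1}" "s 1 = ws @ 2 # r" for ws s
    using that
  proof (induction ws arbitrary: s)
    case Nil
    show ?case by (rule exec_weaken[OF exec.WhileF]) (use Nil assms in \<open>auto simp: fun_eq_iff\<close>)
  next
    case (Cons w ws)
    let ?s1 = "s(1 := ws @ 2 # r, i := w # s i, j := w # s j)"
    have "exec ?B s 8 ?s1"
    proof (cases "w = 1")
      case True
      then show ?thesis using Cons.prems assms
        by (intro exec.IfT exec_weaken[OF exec_Seq_exact[OF exec_Pop_exact exec_Seq_exact[OF exec_Push_exact exec_Push_exact]]])
          (auto simp: fun_eq_iff)
    next
      case False
      then show ?thesis using Cons.prems assms
        by (intro exec.IfF exec_weaken[OF exec_Seq_exact[OF exec_Pop_exact exec_Seq_exact[OF exec_Push_exact exec_Push_exact]]])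
          (auto simp: fun_eq_iff)
    qed
    moreover have "exec ?W ?s1 (9 * length ws + 1)
        (?s1(1 := 2 # r, i := rev ws @ ?s1 i, j := rev ws @ ?s1 j))"
      by (rule Cons.IH) (use Cons.prems assms in auto)
    ultimately have "exec ?W s (9 * length (w # ws) + 1)
        (?s1(1 := 2 # r, i := rev ws @ ?s1 i, j := rev ws @ ?s1 j))"
      by (rule exec.WhileT[rotated 2]) (use Cons.prems in auto)
    then show ?case
      by (rule exec_weaken) (use assms in \<open>auto simp: fun_eq_iff\<close>)
  qed
  assume *: "set ws \<subseteq> {0, 1}" "s 1 = ws @ 2 # r"
  show ?thesis
    unfolding reload2_def
    by (rule exec_weaken[OF exec_Seq_exact[OF loop[of ws s, OF *] exec_Pop_exact]])
      (use assms in \<open>auto simp: fun_eq_iff\<close>)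
qed

lemma exec_discard:
  "set ws \<subseteq> {0, 1} \<Longrightarrow> s 1 = ws @ 2 # r \<Longrightarrow> exec discard s (2 * length ws + 3) (s(1 := r))"
proof -
  have loop: "exec (While 1 [0, 1] (Pop 1)) s (2 * length ws + 1) (s(1 := 2 # r))"
    if "set ws \<subseteq> {0, 1}" "s 1 = ws @ 2 # r" for ws s
    using that
  proof (induction ws arbitrary: s)
    case Nil
    show ?case by (rule exec_weaken[OF exec.WhileF]) (use Nil in \<open>auto simp: fun_eq_iff\<close>)
  next
    case (Cons w ws)
    have "exec (Pop 1) s 1 (s(1 := ws @ 2 # r))"
      by (rule exec_weaken[OF exec_Pop_exact]) (use Cons.prems in auto)
    moreover have "exec (While 1 [0, 1] (Pop 1)) (s(1 := ws @ 2 # r)) (2 * length ws + 1)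
        (s(1 := ws @ 2 # r, 1 := 2 # r))"
      by (rule Cons.IH) (use Cons.prems in auto)
    ultimately have "exec (While 1 [0, 1] (Pop 1)) s (2 * length (w # ws) + 1)
        (s(1 := ws @ 2 # r, 1 := 2 # r))"
      by (rule exec.WhileT[rotated 2]) (use Cons.prems in auto)
    then show ?case by (rule exec_weaken) auto
  qed
  assume *: "set ws \<subseteq> {0, 1}" "s 1 = ws @ 2 # r"
  show ?thesis
    unfolding discard_def
    by (rule exec_weaken[OF exec_Seq_exact[OF loop[of ws s, OF *] exec_Pop_exact]]) auto
qed

definition transfer :: "nat \<Rightarrow> nat \<Rightarrow> com" where
  "transfer i j = Seq (unload i) (reload j)"

lemma exec_transfer:
  assumes "i < num_stacks" "i \<notin> {1, 3}" "j < num_stacks" "j \<notin> {1, 3}" "i \<noteq> j" "s i = code t @ r"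
  shows "exec (transfer i j) s (16 * length (code t) + 16) (s(i := r, j := code t @ s j))"
  unfolding transfer_def using assms set_code[of t]
  by (intro exec_weaken[OF exec_Seq_exact[OF exec_unload exec_reload[of _ "rev (code t)"]]])
    (auto simp: fun_eq_iff)

definition drop_top :: com where
  "drop_top = Seq (unload 0) discard"

lemma exec_drop_top:
  assumes "s 0 = code t @ r"
  shows "exec drop_top s (12 * length (code t) + 16) (s(0 := r))"
  unfolding drop_top_def using assms set_code[of t]
  by (intro exec_weaken[OF exec_Seq_exact[OF exec_unload exec_discard[of "rev (code t)"]]])
    (auto simp: fun_eq_iff)

definition dup_top :: com where
  "dup_top = Seq (unload 0) (Seq (reload2 0 2) (transfer 2 0))"

lemma exec_dup_top:
  assumes "s 0 = code t @ r"
  shows "exec dup_top s (35 * length (code t) + 33) (s(0 := code t @ code t @ r))"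
proof -
  let ?s1 = "s(0 := r, 1 := rev (code t) @ 2 # s 1)"
  let ?s2 = "s(0 := code t @ r, 2 := code t @ s 2)"
  have 1: "exec (unload 0) s (10 * length (code t) + 12) ?s1"
    by (rule exec_unload) (use assms in auto)
  have 2: "exec (reload2 0 2) ?s1 (9 * length (code t) + 3) ?s2"
    using set_code[of t]
    by (intro exec_weaken[OF exec_reload2[of _ _ "rev (code t)" _ "s 1"]]) (auto simp: fun_eq_iff)
  have 3: "exec (transfer 2 0) ?s2 (16 * length (code t) + 16) (s(0 := code t @ code t @ r))"
    by (rule exec_weaken[OF exec_transfer[of _ _ _ t "s 2"]]) (auto simp: fun_eq_iff)
  show ?thesis unfolding dup_top_def
    by (rule exec_weaken[OF exec_Seq_exact[OF 1 exec_Seq_exact[OF 2 3]]]) auto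
qed

text \<open>Stacks 1 and 3 are the working space of \<open>unload\<close>, so two trees are parked
  on stacks 2 and 4; this is why five stacks are provided.\<close>

definition swap_top :: com where
  "swap_top = Seq (transfer 0 2) (Seq (transfer 0 4) (Seq (transfer 2 0) (transfer 4 0)))"

lemma exec_swap_top:
  assumes "s 0 = code a @ code b @ r"
  shows "exec swap_top s (32 * length (code a) + 32 * length (code b) + 67) (s(0 := code b @ code a @ r))"
proof -
  let ?s1 = "s(0 := code b @ r, 2 := code a @ s 2)"
  let ?s2 = "s(0 := r, 2 := code a @ s 2, 4 := code b @ s 4)"
  let ?s3 = "s(0 := code a @ r, 4 := code b @ s 4)"
  have 1: "exec (transfer 0 2) s (16 * length (code a) + 16) ?s1"
    by (rule exec_transfer) (use assms in auto)
  have 2: "exec (transfer 0 4) ?s1 (16 * length (code b) + 16) ?s2"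
    by (rule exec_weaken[OF exec_transfer[of _ _ _ b r]]) (auto simp: fun_eq_iff)
  have 3: "exec (transfer 2 0) ?s2 (16 * length (code a) + 16) ?s3"
    by (rule exec_weaken[OF exec_transfer[of _ _ _ a "s 2"]]) (auto simp: fun_eq_iff)
  have 4: "exec (transfer 4 0) ?s3 (16 * length (code b) + 16) (s(0 := code b @ code a @ r))"
    by (rule exec_weaken[OF exec_transfer[of _ _ _ b "s 4"]]) (auto simp: fun_eq_iff)
  show ?thesis unfolding swap_top_def
    by (rule exec_weaken[OF exec_Seq_exact[OF 1 exec_Seq_exact[OF 2 exec_Seq_exact[OF 3 4]]]]) auto
qed

text \<open>A push is charged at least one step, so stacks grow no faster than the clock. This is
  the source of the output size bound in \<open>pb_FP\<close>.\<close>

lemma exec_length: "exec c s t s' \<Longrightarrow> length (s' i) \<le> length (s i) + t"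
  by (induction rule: exec.induct) auto

section \<open>Polynomial time on encodable types\<close>

class encodable =
  fixes to_tree :: "'a \<Rightarrow> tree"

definition cd :: "'a::encodable \<Rightarrow> nat list" where
  "cd x = code (to_tree x)"

definition sz :: "'a::encodable \<Rightarrow> nat" where
  "sz x = length (cd x)"

lemma sz_pos [simp]: "0 < sz x" "sz x \<noteq> 0" "Suc 0 \<le> sz x"
  using length_code_pos[of "to_tree x"] by (auto simp: sz_def cd_def Suc_le_eq)

instantiation bool :: encodable
begin
definition "to_tree b = (if b then Node Leaf Leaf else Leaf)"
instance ..
end

instantiation prod :: (encodable, encodable) encodable
begin
fun to_tree_prod where "to_tree_prod (a, b) = Node (to_tree a) (to_tree b)"
instance ..
end

instantiation list :: (encodable) encodable
begin
fun to_tree_list where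
  "to_tree_list [] = Leaf"
| "to_tree_list (x # xs) = Node (to_tree x) (to_tree_list xs)"
instance ..
end

fun nbits :: "nat \<Rightarrow> bool list" where
  "nbits n = (if n = 0 then [] else odd n # nbits (n div 2))"

declare nbits.simps [simp del]

lemma nbits_0 [simp]: "nbits 0 = []"
  by (subst nbits.simps) simp

lemma nbits_pos: "0 < n \<Longrightarrow> nbits n = odd n # nbits (n div 2)"
  by (subst nbits.simps) simp

lemma nbits_eq_Nil [simp]: "nbits n = [] \<longleftrightarrow> n = 0"
  by (subst nbits.simps) simp

instantiation nat :: encodable
begin
definition "to_tree n = to_tree (nbits n)"
instance ..
end

text \<open>Storing positive and negative part, one of which is 0, reduces integer arithmetic to
  truncated subtraction of naturals without a sign bit.\<close>

instantiation int :: encodable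
begin
definition "to_tree z = to_tree (nat z, nat (- z))"
instance ..
end

lemma cd_Pair: "cd (a, b) = 1 # cd a @ cd b"
  by (simp add: cd_def)

lemma cd_Nil: "cd [] = [0]"
  by (simp add: cd_def)

lemma cd_Cons: "cd (x # xs) = 1 # cd x @ cd xs"
  by (simp add: cd_def)

lemma cd_bool: "cd b = (if b then [1, 0, 0] else [0])"
  by (simp add: cd_def to_tree_bool_def)

lemma sz_Pair [simp]: "sz (a, b) = 1 + sz a + sz b"
  by (simp add: sz_def cd_Pair)

lemma sz_Nil [simp]: "sz ([] :: 'a::encodable list) = 1"
  by (simp add: sz_def cd_Nil)

lemma sz_Cons [simp]: "sz (x # xs) = 1 + sz x + sz xs"
  by (simp add: sz_def cd_Cons)

lemma sz_bool: "sz (b :: bool) = (if b then 3 else 1)"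
  by (simp add: sz_def cd_bool)

lemma sz_bool_le: "sz (b :: bool) \<le> 3"
  by (simp add: sz_bool)

lemma sz_nat: "sz (n :: nat) = sz (nbits n)"
  by (simp add: sz_def cd_def to_tree_nat_def)

lemma sz_int: "sz (z :: int) = sz (nat z, nat (- z))"
  by (simp add: sz_def cd_def to_tree_int_def)

lemma length_le_sz: "length xs \<le> sz xs"
  by (induction xs) auto

lemma sz_mem: "x \<in> set xs \<Longrightarrow> sz x \<le> sz xs"
  by (induction xs) auto

lemma sz_le_uniform: "(\<And>x. x \<in> set xs \<Longrightarrow> sz x \<le> B) \<Longrightarrow> sz xs \<le> 1 + length xs * (B + 1)"
proof (induction xs)
  case (Cons x xs)
  have "sz x \<le> B" "sz xs \<le> 1 + length xs * (B + 1)"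
    using Cons by auto
  then show ?case by simp
qed simp


subsection \<open>Polynomially bounded quantities\<close>

text \<open>As \<open>sz x\<close> is positive, the base is at least 2. Constants and factors of 2
  are therefore absorbed by a larger exponent, and a single \<open>k\<close> describes a polynomial
  bound.\<close>

definition pb :: "('a::encodable \<Rightarrow> nat) \<Rightarrow> bool" where
  "pb f \<longleftrightarrow> (\<exists>k. \<forall>x. f x \<le> (sz x + 1) ^ k)"

named_theorems pb_intros

lemma pb_const [pb_intros]: "pb (\<lambda>_. c)"
proof -
  have "c \<le> (sz x + 1) ^ c" for x :: 'a
    using less_exp[of c] power_mono[of 2 "sz x + 1" c] by simp
  then show ?thesis unfolding pb_def by blast
qed

lemma pb_mono:
  assumes "pb g" "\<And>x. f x \<le> g x"
  shows "pb f"
  using assms le_trans unfolding pb_def by blast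

lemma pb_add [pb_intros]:
  assumes "pb f" "pb g"
  shows "pb (\<lambda>x. f x + g x)"
proof -
  obtain a b where *: "\<And>x. f x \<le> (sz x + 1) ^ a" "\<And>x. g x \<le> (sz x + 1) ^ b"
    using assms unfolding pb_def by blast
  have "f x + g x \<le> (sz x + 1) ^ (Suc (max a b))" for x
  proof -
    have "f x \<le> (sz x + 1) ^ max a b" "g x \<le> (sz x + 1) ^ max a b"
      using *[of x] power_increasing[of _ "max a b" "sz x + 1"]
      by (meson le_add2 le_trans max.cobounded1 max.cobounded2)+
    moreover have "2 * (sz x + 1) ^ max a b \<le> (sz x + 1) * (sz x + 1) ^ max a b"
      by (rule mult_right_mono) (simp_all add: Suc_le_eq)
    ultimately show ?thesis unfolding power_Suc by linarith
  qed
  then show ?thesis unfolding pb_def by blast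
qed

lemma pb_mult [pb_intros]:
  assumes "pb f" "pb g"
  shows "pb (\<lambda>x. f x * g x)"
proof -
  obtain a b where *: "\<And>x. f x \<le> (sz x + 1) ^ a" "\<And>x. g x \<le> (sz x + 1) ^ b"
    using assms unfolding pb_def by blast
  have "f x * g x \<le> (sz x + 1) ^ (a + b)" for x
    unfolding power_add by (intro mult_mono *) auto
  then show ?thesis unfolding pb_def by blast
qed

lemma pb_Suc [pb_intros]: "pb f \<Longrightarrow> pb (\<lambda>x. Suc (f x))"
  using pb_add[of f "\<lambda>_. 1"] pb_const[of 1] by simp

lemma pb_power [pb_intros]: "pb f \<Longrightarrow> pb (\<lambda>x. f x ^ k)"
  by (induction k) (auto intro: pb_intros)

lemma pb_sz [pb_intros]: "pb sz"
  unfolding pb_def by (rule exI[of _ 1]) auto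

lemma pb_comp:
  assumes "pb g" "pb (\<lambda>x. sz (f x))"
  shows "pb (\<lambda>x. g (f x))"
proof -
  obtain k where k: "\<And>y. g y \<le> (sz y + 1) ^ k"
    using assms(1) unfolding pb_def by blast
  show ?thesis
    by (rule pb_mono[of "\<lambda>x. (sz (f x) + 1) ^ k"]) (use k assms(2) in \<open>auto intro!: pb_intros\<close>)
qed


subsection \<open>Functions computable in polynomial time\<close>

definition computes :: "com \<Rightarrow> ('a::encodable \<Rightarrow> 'b::encodable) \<Rightarrow> ('a \<Rightarrow> nat) \<Rightarrow> bool" where
  "computes c f T \<longleftrightarrow> (\<forall>x s r. s 0 = cd x @ r \<longrightarrow> exec c s (T x) (s(0 := cd (f x) @ r)))"

definition FP :: "('a::encodable \<Rightarrow> 'b::encodable) \<Rightarrow> bool" where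
  "FP f \<longleftrightarrow> (\<exists>c T. computes c f T \<and> pb T)"

named_theorems FP_intros

lemma computesD: "computes c f T \<Longrightarrow> s 0 = cd x @ r \<Longrightarrow> exec c s (T x) (s(0 := cd (f x) @ r))"
  by (simp add: computes_def)

lemma computesD': "computes c f T \<Longrightarrow> exec c (s(0 := cd x @ r)) (T x) (s(0 := cd (f x) @ r))"
  using computesD[of c f T "s(0 := cd x @ r)" x r] by simp

lemma FP_I: "computes c f T \<Longrightarrow> pb T \<Longrightarrow> FP f"
  by (auto simp: FP_def)

lemma pb_FP [pb_intros]:
  assumes "FP f"
  shows "pb (\<lambda>x. sz (f x))"
proof -
  obtain c T where c: "computes c f T" "pb T"
    using assms by (auto simp: FP_def)
  have "sz (f x) \<le> sz x + T x" for x
    using exec_length[OF computesD[OF c(1), of "\<lambda>_. cd x" x "[]"], of 0]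
    by (simp add: sz_def)
  then show ?thesis
    by (rule pb_mono[rotated]) (intro pb_intros c)
qed

text \<open>Programs see only trees, so the result may be reinterpreted at another type at no cost:
  a cons cell is a pair, a natural number its digit list, an integer a pair of naturals.\<close>

lemma FP_cast:
  assumes "FP f" "\<And>x. to_tree (f x) = to_tree (g x)"
  shows "FP g"
proof -
  have "cd (f x) = cd (g x)" for x
    using assms(2) by (simp add: cd_def)
  then show ?thesis using assms(1) by (simp add: FP_def computes_def)
qed

lemma FP_id [FP_intros]: "FP (\<lambda>x. x)"
proof (rule FP_I)
  \<comment> \<open>A loop with an empty set of continuation symbols is a no-op.\<close>
  show "computes (While 0 [] (Pop 0)) (\<lambda>x. x) (\<lambda>_. 1)"
    unfolding computes_def by (auto intro!: exec_weaken[OF exec.WhileF])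
qed (intro pb_intros)

lemma FP_comp:
  assumes "FP g" "FP f"
  shows "FP (\<lambda>x. g (f x))"
proof -
  obtain c T d U where *: "computes c f T" "pb T" "computes d g U" "pb U"
    using assms by (auto simp: FP_def)
  have "computes (Seq c d) (\<lambda>x. g (f x)) (\<lambda>x. T x + U (f x) + 1)"
    unfolding computes_def
    by (auto intro!: exec_weaken[OF exec_Seq_exact[OF computesD[OF *(1)] computesD'[OF *(3)]]])
  then show ?thesis
    by (rule FP_I) (intro pb_intros * pb_comp[OF *(4)] assms)
qed

lemma FP_Pair [FP_intros]:
  assumes "FP f" "FP g"
  shows "FP (\<lambda>x. (f x, g x))"
proof -
  obtain c T d U where *: "computes c f T" "pb T" "computes d g U" "pb U"
    using assms by (auto simp: FP_def)
  \<comment> \<open>The top of the stack is the front of the prefix code, so the second component is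
    computed first and ends up underneath; the final push adds the \<open>Node\<close>
    symbol.\<close>
  let ?c = "Seq dup_top (Seq d (Seq swap_top (Seq c (Push 0 1))))"
  let ?T = "\<lambda>x. T x + U x + 67 * sz x + 32 * sz (g x) + 106"
  have "exec ?c s (?T x) (s(0 := cd (f x, g x) @ r))" if s: "s 0 = cd x @ r" for x s r
  proof -
    have 1: "exec dup_top s (35 * sz x + 33) (s(0 := cd x @ cd x @ r))"
      using exec_dup_top[of s "to_tree x" r] s by (simp add: cd_def sz_def)
    have 2: "exec d (s(0 := cd x @ cd x @ r)) (U x) (s(0 := cd (g x) @ cd x @ r))"
      by (rule computesD'[OF *(3)])
    have 3: "exec swap_top (s(0 := cd (g x) @ cd x @ r)) (32 * sz (g x) + 32 * sz x + 67)
        (s(0 := cd x @ cd (g x) @ r))"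
      by (rule exec_weaken[OF exec_swap_top[of _ "to_tree (g x)" "to_tree x" r]])
        (auto simp: cd_def sz_def)
    have 4: "exec c (s(0 := cd x @ cd (g x) @ r)) (T x) (s(0 := cd (f x) @ cd (g x) @ r))"
      by (rule computesD'[OF *(1)])
    have 5: "exec (Push 0 1) (s(0 := cd (f x) @ cd (g x) @ r)) 2 (s(0 := cd (f x, g x) @ r))"
      by (rule exec_weaken[OF exec_Push_exact]) (auto simp: cd_Pair)
    show ?thesis
      by (rule exec_weaken[OF exec_Seq_exact[OF 1 exec_Seq_exact[OF 2 exec_Seq_exact[OF 3
                exec_Seq_exact[OF 4 5]]]]]) auto
  qed
  then have "computes ?c (\<lambda>x. (f x, g x)) ?T"
    by (simp add: computes_def)
  then show ?thesis
    by (rule FP_I) (intro pb_intros * assms)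
qed

lemma FP_fst_prim: "FP fst"
proof (rule FP_I)
  let ?c = "Seq (Pop 0) (Seq swap_top drop_top)"
  have "exec ?c s (45 * sz x + 100) (s(0 := cd (fst x) @ r))"
    if s: "s 0 = cd x @ r" for x :: "'a \<times> 'b" and s r
  proof -
    obtain a b where x: "x = (a, b)" by fastforce
    have 1: "exec (Pop 0) s 1 (s(0 := cd a @ cd b @ r))"
      by (rule exec_weaken[OF exec_Pop_exact]) (use s in \<open>auto simp: x cd_Pair\<close>)
    have 2: "exec swap_top (s(0 := cd a @ cd b @ r)) (32 * sz a + 32 * sz b + 67) (s(0 := cd b @ cd a @ r))"
      by (rule exec_weaken[OF exec_swap_top[of _ "to_tree a" "to_tree b" r]]) (auto simp: cd_def sz_def)
    have 3: "exec drop_top (s(0 := cd b @ cd a @ r)) (12 * sz b + 16) (s(0 := cd a @ r))"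
      by (rule exec_weaken[OF exec_drop_top[of _ "to_tree b" "cd a @ r"]]) (auto simp: cd_def sz_def)
    show ?thesis
      by (rule exec_weaken[OF exec_Seq_exact[OF 1 exec_Seq_exact[OF 2 3]]]) (auto simp: x)
  qed
  then show "computes ?c fst (\<lambda>x :: 'a \<times> 'b. 45 * sz x + 100)"
    by (simp add: computes_def)
qed (intro pb_intros)

lemma FP_snd_prim: "FP snd"
proof (rule FP_I)
  let ?c = "Seq (Pop 0) drop_top"
  have "exec ?c s (12 * sz x + 100) (s(0 := cd (snd x) @ r))"
    if s: "s 0 = cd x @ r" for x :: "'a \<times> 'b" and s r
  proof -
    obtain a b where x: "x = (a, b)" by fastforce
    have 1: "exec (Pop 0) s 1 (s(0 := cd a @ cd b @ r))"
      by (rule exec_weaken[OF exec_Pop_exact]) (use s in \<open>auto simp: x cd_Pair\<close>)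
    have 3: "exec drop_top (s(0 := cd a @ cd b @ r)) (12 * sz a + 16) (s(0 := cd b @ r))"
      by (rule exec_weaken[OF exec_drop_top[of _ "to_tree a" "cd b @ r"]]) (auto simp: cd_def sz_def)
    show ?thesis
      by (rule exec_weaken[OF exec_Seq_exact[OF 1 3]]) (auto simp: x)
  qed
  then show "computes ?c snd (\<lambda>x :: 'a \<times> 'b. 12 * sz x + 100)"
    by (simp add: computes_def)
qed (intro pb_intros)

lemmas FP_fst [FP_intros] = FP_comp[OF FP_fst_prim]
lemmas FP_snd [FP_intros] = FP_comp[OF FP_snd_prim]

fun push_word :: "nat \<Rightarrow> nat list \<Rightarrow> com" where
  "push_word i [] = While i [] (Pop i)"
| "push_word i (a # w) = Seq (push_word i w) (Push i a)"

lemma exec_push_word: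
  assumes "i < num_stacks"
  shows "set w \<subseteq> {..<blank_sym} \<Longrightarrow> exec (push_word i w) s (3 * length w + 1) (s(i := w @ s i))"
proof (induction w)
  case Nil
  show ?case using assms by (auto intro!: exec_weaken[OF exec.WhileF])
next
  case (Cons a w)
  have "exec (push_word i w) s (3 * length w + 1) (s(i := w @ s i))"
    by (rule Cons.IH) (use Cons.prems in auto)
  note 1 = exec_Seq_exact[OF this exec_Push_exact[OF assms, of a]]
  show ?case unfolding push_word.simps
    by (rule exec_weaken[OF 1]) (use Cons.prems in auto)
qed

lemma set_cd: "set (cd x) \<subseteq> {..<blank_sym}"
  using set_code[of "to_tree x"] by (auto simp: cd_def)

lemma FP_const [FP_intros]: "FP (\<lambda>_. k)"
proof (rule FP_I)
  let ?c = "Seq drop_top (push_word 0 (cd k))"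
  have "exec ?c s (12 * sz x + 3 * sz k + 100) (s(0 := cd k @ r))"
    if s: "s 0 = cd x @ r" for x :: 'a and s r
  proof -
    have 1: "exec drop_top s (12 * sz x + 16) (s(0 := r))"
      using exec_drop_top[of s "to_tree x" r] s by (simp add: cd_def sz_def)
    have 2: "exec (push_word 0 (cd k)) (s(0 := r)) (3 * sz k + 1) (s(0 := cd k @ r))"
      by (rule exec_weaken[OF exec_push_word]) (use set_cd[of k] in \<open>auto simp: sz_def\<close>)
    show ?thesis by (rule exec_weaken[OF exec_Seq_exact[OF 1 2]]) auto
  qed
  then show "computes ?c (\<lambda>_. k) (\<lambda>x :: 'a. 12 * sz x + 3 * sz k + 100)"
    by (simp add: computes_def)
qed (intro pb_intros)

lemma FP_if [FP_intros]:
  assumes "FP b" "FP f" "FP g"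
  shows "FP (\<lambda>x. if b x then f x else g x)"
proof -
  obtain cb B cf F cg G where *: "computes cb b B" "pb B" "computes cf f F" "pb F"
    "computes cg g G" "pb G"
    using assms by (auto simp: FP_def)
  \<comment> \<open>The Boolean is removed before branching: \<open>True\<close> has the three
    symbols 1, 0, 0 and \<open>False\<close> the single symbol 0.\<close>
  let ?d = "If 0 [1] (Seq (Seq (Pop 0) (Seq (Pop 0) (Pop 0))) cf) (Seq (Pop 0) cg)"
  let ?c = "Seq dup_top (Seq cb ?d)"
  let ?T = "\<lambda>x. B x + F x + G x + 35 * sz x + 50"
  have "exec ?c s (?T x) (s(0 := cd (if b x then f x else g x) @ r))"
    if s: "s 0 = cd x @ r" for x s r
  proof -
    have 1: "exec dup_top s (35 * sz x + 33) (s(0 := cd x @ cd x @ r))"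
      using exec_dup_top[of s "to_tree x" r] s by (simp add: cd_def sz_def)
    have 2: "exec cb (s(0 := cd x @ cd x @ r)) (B x) (s(0 := cd (b x) @ cd x @ r))"
      by (rule computesD'[OF *(1)])
    have 3: "exec ?d (s(0 := cd (b x) @ cd x @ r)) (F x + G x + 10)
        (s(0 := cd (if b x then f x else g x) @ r))"
    proof (cases "b x")
      case True
      have "exec (Seq (Pop 0) (Seq (Pop 0) (Pop 0))) (s(0 := cd (b x) @ cd x @ r)) 5 (s(0 := cd x @ r))"
        by (rule exec_weaken[OF exec_Seq_exact[OF exec_Pop_exact exec_Seq_exact[OF exec_Pop_exact exec_Pop_exact]]])
          (auto simp: True cd_bool)
      from exec_Seq_exact[OF this computesD'[OF *(3)]] show ?thesis
        by (intro exec.IfT) (auto simp: True cd_bool intro: exec_weaken)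
    next
      case False
      have "exec (Pop 0) (s(0 := cd (b x) @ cd x @ r)) 1 (s(0 := cd x @ r))"
        by (rule exec_weaken[OF exec_Pop_exact]) (auto simp: False cd_bool)
      from exec_Seq_exact[OF this computesD'[OF *(5)]] show ?thesis
        by (intro exec.IfF) (auto simp: False cd_bool intro: exec_weaken)
    qed
    show ?thesis
      by (rule exec_weaken[OF exec_Seq_exact[OF 1 exec_Seq_exact[OF 2 3]]]) auto
  qed
  then have "computes ?c (\<lambda>x. if b x then f x else g x) ?T"
    by (simp add: computes_def)
  then show ?thesis
    by (rule FP_I) (intro pb_intros * assms)
qed

lemma FP_case_list [FP_intros]:
  assumes "FP xs" "FP f" "FP (\<lambda>z. g (fst z) (fst (snd z)) (snd (snd z)))"
  shows "FP (\<lambda>x. case xs x of [] \<Rightarrow> f x | y # ys \<Rightarrow> g x y ys)"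
proof -
  let ?g = "\<lambda>z. g (fst z) (fst (snd z)) (snd (snd z))"
  let ?h = "\<lambda>x. case xs x of [] \<Rightarrow> f x | y # ys \<Rightarrow> g x y ys"
  obtain cb B cf F cg G where *: "computes cb xs B" "pb B" "computes cf f F" "pb F"
    "computes cg ?g G" "pb G"
    using assms by (auto simp: FP_def)
  obtain k where k: "\<And>z. G z \<le> (sz z + 1) ^ k"
    using *(6) unfolding pb_def by blast
  \<comment> \<open>A nonempty list has the same code as the pair of its head and tail. After the
    swap, one pushed \<open>Node\<close> symbol turns argument and list into the code of the triple
    expected by \<open>cg\<close>.\<close>
  let ?d = "If 0 [1] (Seq swap_top (Seq (Push 0 1) cg)) (Seq (Pop 0) cf)"
  let ?c = "Seq dup_top (Seq cb ?d)"
  let ?D = "\<lambda>x. F x + (sz x + sz (xs x) + 3) ^ k + 32 * sz x + 32 * sz (xs x) + 80"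
  let ?T = "\<lambda>x. B x + ?D x + 35 * sz x + 50"
  have "exec ?c s (?T x) (s(0 := cd (?h x) @ r))"
    if s: "s 0 = cd x @ r" for x s r
  proof -
    have 1: "exec dup_top s (35 * sz x + 33) (s(0 := cd x @ cd x @ r))"
      using exec_dup_top[of s "to_tree x" r] s by (simp add: cd_def sz_def)
    have 2: "exec cb (s(0 := cd x @ cd x @ r)) (B x) (s(0 := cd (xs x) @ cd x @ r))"
      by (rule computesD'[OF *(1)])
    have 3: "exec ?d (s(0 := cd (xs x) @ cd x @ r)) (?D x) (s(0 := cd (?h x) @ r))"
    proof (cases "xs x")
      case Nil
      have "exec (Pop 0) (s(0 := cd (xs x) @ cd x @ r)) 1 (s(0 := cd x @ r))"
        by (rule exec_weaken[OF exec_Pop_exact]) (auto simp: Nil cd_Nil)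
      from exec_Seq_exact[OF this computesD'[OF *(3)]] show ?thesis
        by (intro exec.IfF) (auto simp: Nil cd_Nil intro: exec_weaken)
    next
      case (Cons y ys)
      let ?z = "(x, y, ys)"
      have a: "exec swap_top (s(0 := cd (xs x) @ cd x @ r)) (32 * sz (xs x) + 32 * sz x + 67)
          (s(0 := cd x @ cd (xs x) @ r))"
        by (rule exec_weaken[OF exec_swap_top[of _ "to_tree (xs x)" "to_tree x" r]])
          (auto simp: cd_def sz_def)
      have b: "exec (Push 0 1) (s(0 := cd x @ cd (xs x) @ r)) 2 (s(0 := cd ?z @ r))"
        by (rule exec_weaken[OF exec_Push_exact]) (auto simp: cd_Pair Cons cd_Cons)
      have c: "exec cg (s(0 := cd ?z @ r)) (G ?z) (s(0 := cd (?h x) @ r))"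
        using computesD'[OF *(5), of s ?z r] by (simp add: Cons)
      have "G ?z \<le> (sz x + sz (xs x) + 3) ^ k"
        by (rule order.trans[OF k power_mono]) (auto simp: Cons)
      then show ?thesis
        by (intro exec.IfT[OF _ _ exec_Seq_exact[OF a exec_Seq_exact[OF b c]]])
          (auto simp: Cons cd_Cons)
    qed
    show ?thesis
      by (rule exec_weaken[OF exec_Seq_exact[OF 1 exec_Seq_exact[OF 2 3]]]) auto
  qed
  then have "computes ?c ?h ?T"
    by (simp add: computes_def)
  then show ?thesis
    by (rule FP_I) (intro pb_intros * assms)
qed

text \<open>The list is its own loop counter: its code starts with 1 exactly as long as it is
  nonempty. The tail waits on stack 2 while \<open>c\<close> acts on the pair of the current element
  and the state.\<close>

definition fold_body :: "com \<Rightarrow> com" where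
  "fold_body c = Seq (Pop 0) (Seq swap_top (Seq (transfer 0 2) (Seq (Push 0 1) (Seq c (transfer 2 0)))))"

text \<open>\<open>L\<close> bounds every remaining list and \<open>B\<close> every state, so all
  rounds have the same cost bound. The 0 left on top is the code of the exhausted list.\<close>

lemma exec_fold_loop:
  fixes step :: "'s::encodable \<Rightarrow> 'a::encodable \<Rightarrow> 's"
  assumes c: "computes c (\<lambda>z. step (snd z) (fst z)) T" and k: "\<And>z. T z \<le> (sz z + 1) ^ k"
  shows "s 0 = cd ys @ cd st @ r \<Longrightarrow> sz ys \<le> L \<Longrightarrow>
    (\<And>j. j \<le> length ys \<Longrightarrow> sz (foldl step st (take j ys)) \<le> B) \<Longrightarrow>
    exec (While 0 [1] (fold_body c)) s (1 + length ys * (64 * L + 120 + (L + B + 2) ^ k))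
      (s(0 := 0 # cd (foldl step st ys) @ r))"
proof (induction ys arbitrary: s st)
  case Nil
  show ?case by (rule exec_weaken[OF exec.WhileF[where t = 1]]) (use Nil in \<open>auto simp: cd_Nil\<close>)
next
  case (Cons y ys)
  let ?st = "step st y"
  have 1: "exec (Pop 0) s 1 (s(0 := cd y @ cd ys @ cd st @ r))"
    by (rule exec_weaken[OF exec_Pop_exact]) (use Cons.prems in \<open>auto simp: cd_Cons\<close>)
  have 2: "exec swap_top (s(0 := cd y @ cd ys @ cd st @ r)) (32 * sz y + 32 * sz ys + 67)
      (s(0 := cd ys @ cd y @ cd st @ r))"
    by (rule exec_weaken[OF exec_swap_top[of _ "to_tree y" "to_tree ys" "cd st @ r"]])
      (auto simp: cd_def sz_def)
  have 3: "exec (transfer 0 2) (s(0 := cd ys @ cd y @ cd st @ r)) (16 * sz ys + 16)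
      (s(0 := cd y @ cd st @ r, 2 := cd ys @ s 2))"
    by (rule exec_weaken[OF exec_transfer[of _ _ _ "to_tree ys" "cd y @ cd st @ r"]])
      (auto simp: cd_def sz_def)
  have 4: "exec (Push 0 1) (s(0 := cd y @ cd st @ r, 2 := cd ys @ s 2)) 2
      (s(0 := cd (y, st) @ r, 2 := cd ys @ s 2))"
    by (rule exec_weaken[OF exec_Push_exact]) (auto simp: cd_Pair fun_upd_twist)
  have 5: "exec c (s(0 := cd (y, st) @ r, 2 := cd ys @ s 2)) (T (y, st))
      (s(0 := cd ?st @ r, 2 := cd ys @ s 2))"
    by (rule exec_weaken[OF computesD[OF c, of _ "(y, st)" r]]) (auto simp: fun_upd_twist)
  have 6: "exec (transfer 2 0) (s(0 := cd ?st @ r, 2 := cd ys @ s 2)) (16 * sz ys + 16)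
      (s(0 := cd ys @ cd ?st @ r))"
    by (rule exec_weaken[OF exec_transfer[of _ _ _ "to_tree ys" "s 2"]])
      (auto simp: cd_def sz_def fun_eq_iff)
  have 7: "exec (While 0 [1] (fold_body c)) (s(0 := cd ys @ cd ?st @ r))
      (1 + length ys * (64 * L + 120 + (L + B + 2) ^ k))
      (s(0 := 0 # cd (foldl step st (y # ys)) @ r))"
  proof (rule exec_weaken[OF Cons.IH])
    show "sz (foldl step ?st (take j ys)) \<le> B" if "j \<le> length ys" for j
      using Cons.prems(3)[of "Suc j"] that by simp
  qed (use Cons.prems in auto)
  have "T (y, st) \<le> (L + B + 2) ^ k"
    using Cons.prems(2) Cons.prems(3)[of 0]
    by (intro order.trans[OF k power_mono]) auto
  moreover have "32 * sz y + 64 * sz ys \<le> 64 * L"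
    using Cons.prems(2) by simp
  ultimately have "exec (fold_body c) s (64 * L + 119 + (L + B + 2) ^ k) (s(0 := cd ys @ cd ?st @ r))"
    unfolding fold_body_def
    by (intro exec_weaken[OF exec_Seq_exact[OF 1 exec_Seq_exact[OF 2 exec_Seq_exact[OF 3
                exec_Seq_exact[OF 4 exec_Seq_exact[OF 5 6]]]]]]) auto
  then show ?case
    by (intro exec.WhileT[OF _ _ _ 7]) (use Cons.prems in \<open>auto simp: cd_Cons\<close>)
qed

text \<open>A polynomial-time step may double the size of the state, and then iteration is
  exponential. The bound \<open>B\<close> on all intermediate states therefore has to be
  supplied.\<close>

lemma FP_foldl:
  assumes step: "FP (\<lambda>z. step (fst z) (fst (snd z)) (snd (snd z)))"
    and init: "FP init" and xs: "FP xs" and "pb B"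
    and B: "\<And>x j. j \<le> length (xs x) \<Longrightarrow> sz (foldl (step x) (init x) (take j (xs x))) \<le> B x"
  shows "FP (\<lambda>x. foldl (step x) (init x) (xs x))"
proof -
  \<comment> \<open>The parameter \<open>x\<close> travels inside the state, since the program for a
    step sees only the tree on top of the stack.\<close>
  let ?step = "\<lambda>z y. (fst z, step (fst z) (snd z) y)"
  have foldl: "foldl ?step (x, st) ys = (x, foldl (step x) st ys)" for x st ys
    by (induction ys arbitrary: st) auto
  let ?proj = "\<lambda>z. (fst (snd z), (snd (snd z), fst z))"
  have "FP ?proj" by (intro FP_intros)
  from FP_comp[OF step this] have "FP (\<lambda>z. ?step (snd z) (fst z))"
    by (intro FP_intros) auto
  then obtain c T where c: "computes c (\<lambda>z. ?step (snd z) (fst z)) T" and "pb T"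
    by (auto simp: FP_def)
  then obtain k where k: "\<And>z. T z \<le> (sz z + 1) ^ k"
    unfolding pb_def by blast
  have "FP (\<lambda>x. (xs x, (x, init x)))" by (intro FP_intros init xs)
  then obtain d U where d: "computes d (\<lambda>x. (xs x, (x, init x))) U" "pb U"
    by (auto simp: FP_def)
  let ?c = "Seq d (Seq (Pop 0) (Seq (While 0 [1] (fold_body c)) (Pop 0)))"
  let ?L = "\<lambda>x. 1 + sz (xs x) * (64 * sz (xs x) + 120 + (sz (xs x) + (1 + sz x + B x) + 2) ^ k)"
  let ?T = "\<lambda>x. U x + ?L x + 10"
  have "exec ?c s (?T x) (s(0 := cd (x, foldl (step x) (init x) (xs x)) @ r))"
    if s: "s 0 = cd x @ r" for x s r
  proof -
    have 1: "exec d s (U x) (s(0 := cd (xs x, (x, init x)) @ r))"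
      by (rule computesD[OF d(1)]) (rule s)
    have 2: "exec (Pop 0) (s(0 := cd (xs x, (x, init x)) @ r)) 1 (s(0 := cd (xs x) @ cd (x, init x) @ r))"
      by (rule exec_weaken[OF exec_Pop_exact]) (auto simp: cd_Pair)
    have 3: "exec (While 0 [1] (fold_body c)) (s(0 := cd (xs x) @ cd (x, init x) @ r)) (?L x)
        (s(0 := 0 # cd (x, foldl (step x) (init x) (xs x)) @ r))"
      by (rule exec_weaken[OF exec_fold_loop[OF c k, of _ "xs x" "(x, init x)" r "sz (xs x)" "1 + sz x + B x"]])
        (use B length_le_sz[of "xs x"] in \<open>auto simp: foldl intro!: mult_right_mono\<close>)
    have 4: "exec (Pop 0) (s(0 := 0 # cd (x, foldl (step x) (init x) (xs x)) @ r)) 1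
        (s(0 := cd (x, foldl (step x) (init x) (xs x)) @ r))"
      by (rule exec_weaken[OF exec_Pop_exact]) auto
    show ?thesis
      by (rule exec_weaken[OF exec_Seq_exact[OF 1 exec_Seq_exact[OF 2 exec_Seq_exact[OF 3 4]]]]) auto
  qed
  then have "computes ?c (\<lambda>x. (x, foldl (step x) (init x) (xs x))) ?T"
    by (simp add: computes_def)
  then have "FP (\<lambda>x. (x, foldl (step x) (init x) (xs x)))"
    by (rule FP_I) (intro pb_intros d xs \<open>pb B\<close>)
  from FP_snd[OF this] show ?thesis by simp
qed

lemma foldl_measure_bound:
  "(\<And>s y. y \<in> set ys \<Longrightarrow> m (step s y) \<le> m s + G) \<Longrightarrow> m (foldl step st ys) \<le> m st + length ys * (G :: nat)"
proof (induction ys arbitrary: st)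
  case (Cons y ys)
  have "m (foldl step (step st y) ys) \<le> m (step st y) + length ys * G"
    by (rule Cons.IH) (use Cons.prems in auto)
  also have "m (step st y) \<le> m st + G" using Cons.prems by auto
  finally show ?case by simp
qed simp

text \<open>For numbers \<open>sz\<close> is an awkward measure, because a digit 1 has a longer code
  than a digit 0. Additive growth is shown for a smoother quantity such as the number of digits, and
  a linear inequality transfers it to \<open>sz\<close>.\<close>

lemma FP_foldl_measure:
  assumes step: "FP (\<lambda>z. step (fst z) (fst (snd z)) (snd (snd z)))"
    and init: "FP init" and xs: "FP xs" and "pb G" and "pb (\<lambda>x. m (init x))"
    and sz: "\<And>s. sz s \<le> c * m s + d"
    and G: "\<And>x s y. y \<in> set (xs x) \<Longrightarrow> m (step x s y) \<le> m s + G x"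
  shows "FP (\<lambda>x. foldl (step x) (init x) (xs x))"
proof (rule FP_foldl[OF step init xs])
  show "pb (\<lambda>x. c * (m (init x) + sz (xs x) * G x) + d)"
    by (intro pb_intros assms)
  fix x j assume j: "j \<le> length (xs x)"
  have "m (foldl (step x) (init x) (take j (xs x))) \<le> m (init x) + length (take j (xs x)) * G x"
    by (rule foldl_measure_bound) (auto dest: in_set_takeD intro!: G)
  also have "\<dots> \<le> m (init x) + sz (xs x) * G x"
    using j length_le_sz[of "xs x"] by (intro add_left_mono mult_right_mono) auto
  finally have "c * m (foldl (step x) (init x) (take j (xs x))) + d \<le> c * (m (init x) + sz (xs x) * G x) + d"
    by simp
  with sz show "sz (foldl (step x) (init x) (take j (xs x))) \<le> c * (m (init x) + sz (xs x) * G x) + d"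
    by (rule order_trans)
qed

lemma FP_foldl_add:
  assumes "FP (\<lambda>z. step (fst z) (fst (snd z)) (snd (snd z)))" "FP init" "FP xs" "pb G"
    and "\<And>x s y. y \<in> set (xs x) \<Longrightarrow> sz (step x s y) \<le> sz s + G x"
  shows "FP (\<lambda>x. foldl (step x) (init x) (xs x))"
  by (rule FP_foldl_measure[where m = sz and c = 1 and d = 0 and G = G])
    (use assms pb_FP[OF assms(2)] in auto)


subsection \<open>Booleans and lists\<close>

lemma FP_conj [FP_intros]:
  assumes "FP P" "FP Q"
  shows "FP (\<lambda>x. P x \<and> Q x)"
proof -
  have "(\<lambda>x. P x \<and> Q x) = (\<lambda>x. if P x then Q x else False)" by auto
  then show ?thesis by (simp only:) (intro FP_intros assms)
qed

lemma FP_disj [FP_intros]: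
  assumes "FP P" "FP Q"
  shows "FP (\<lambda>x. P x \<or> Q x)"
proof -
  have "(\<lambda>x. P x \<or> Q x) = (\<lambda>x. if P x then True else Q x)" by auto
  then show ?thesis by (simp only:) (intro FP_intros assms)
qed

lemma FP_not [FP_intros]:
  assumes "FP P"
  shows "FP (\<lambda>x. \<not> P x)"
proof -
  have "(\<lambda>x. \<not> P x) = (\<lambda>x. if P x then False else True)" by auto
  then show ?thesis by (simp only:) (intro FP_intros assms)
qed

lemma FP_bool_eq [FP_intros]:
  assumes "FP P" "FP Q"
  shows "FP (\<lambda>x. P x = (Q x :: bool))"
proof -
  have "(\<lambda>x. P x = Q x) = (\<lambda>x. if P x then Q x else \<not> Q x)" by auto
  then show ?thesis by (simp only:) (intro FP_intros assms)
qed

lemma FP_Cons [FP_intros]: "FP f \<Longrightarrow> FP g \<Longrightarrow> FP (\<lambda>x. f x # g x)"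
  by (rule FP_cast[OF FP_Pair]) auto

lemma FP_eq_Nil [FP_intros]:
  assumes "FP xs"
  shows "FP (\<lambda>x. xs x = [])"
proof -
  have "(\<lambda>x. xs x = []) = (\<lambda>x. case xs x of [] \<Rightarrow> True | y # ys \<Rightarrow> False)"
  proof
    fix x show "(xs x = []) = (case xs x of [] \<Rightarrow> True | y # ys \<Rightarrow> False)"
      by (cases "xs x") auto
  qed
  then show ?thesis by (simp only:) (intro FP_intros assms)
qed

lemma FP_tl [FP_intros]:
  assumes "FP xs"
  shows "FP (\<lambda>x. tl (xs x))"
proof -
  have "(\<lambda>x. tl (xs x)) = (\<lambda>x. case xs x of [] \<Rightarrow> [] | y # ys \<Rightarrow> ys)"
    by (auto split: list.split)
  then show ?thesis by (simp only:) (intro FP_intros assms)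
qed

lemma FP_rev [FP_intros]:
  assumes "FP xs"
  shows "FP (\<lambda>x. rev (xs x))"
proof -
  have "FP (\<lambda>x. foldl (\<lambda>s y. y # s) [] (xs x))"
    by (rule FP_foldl_add[where G = "\<lambda>x. 1 + sz (xs x)"])
      (auto intro!: FP_intros assms pb_intros simp: sz_mem)
  moreover have "foldl (\<lambda>s y. y # s) b a = rev a @ b" for a b :: "'b list"
    by (induction a arbitrary: b) auto
  ultimately show ?thesis by simp
qed

lemma sz_append: "sz (xs @ ys) + 1 = sz xs + sz ys"
  by (induction xs) auto

lemma sz_rev [simp]: "sz (rev xs) = sz xs"
proof (induction xs)
  case (Cons x xs)
  then show ?case using sz_append[of "rev xs" "[x]"] by simp
qed simp

lemma FP_append [FP_intros]:
  assumes "FP xs" "FP ys"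
  shows "FP (\<lambda>x. xs x @ ys x)"
proof -
  have "FP (\<lambda>x. foldl (\<lambda>s y. y # s) (ys x) (rev (xs x)))"
    by (rule FP_foldl_add[where G = "\<lambda>x. 1 + sz (xs x)"])
      (auto intro!: FP_intros assms pb_intros simp: sz_mem)
  moreover have "foldl (\<lambda>s y. y # s) b (rev a) = a @ b" for a b :: "'b list"
    by (induction a) auto
  ultimately show ?thesis by simp
qed

lemma FP_uncurry_snd:
  assumes "FP (\<lambda>z. g (fst z) (snd z))"
  shows "FP (\<lambda>z. g (fst z) (snd (snd z)))"
proof -
  have "FP (\<lambda>z. (fst z, snd (snd z)))" by (intro FP_intros)
  from FP_comp[OF assms this] show ?thesis by simp
qed

lemma FP_map [FP_intros]:
  assumes g: "FP (\<lambda>z. g (fst z) (snd z))" and xs: "FP xs"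
  shows "FP (\<lambda>x. map (g x) (xs x))"
proof -
  obtain k where k: "\<And>z. sz (g (fst z) (snd z)) \<le> (sz z + 1) ^ k"
    using pb_FP[OF g] unfolding pb_def by blast
  have "FP (\<lambda>x. foldl (\<lambda>s y. g x y # s) [] (xs x))"
  proof (rule FP_foldl_add[where G = "\<lambda>x. 1 + (sz x + sz (xs x) + 2) ^ k"])
    show "FP (\<lambda>z. g (fst z) (snd (snd z)) # fst (snd z))"
      by (intro FP_intros FP_uncurry_snd[OF g])
    fix x s y assume "y \<in> set (xs x)"
    then have "sz (g x y) \<le> (sz x + sz (xs x) + 2) ^ k"
      using sz_mem[of y "xs x"] k[of "(x, y)"] power_mono[of "sz (x, y) + 1" "sz x + sz (xs x) + 2" k]
      by simp
    then show "sz (g x y # s) \<le> sz s + (1 + (sz x + sz (xs x) + 2) ^ k)" by simp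
  qed (auto intro!: FP_intros xs pb_intros)
  moreover have "foldl (\<lambda>s y. g x y # s) b ys = rev (map (g x) ys) @ b" for x b ys
    by (induction ys arbitrary: b) auto
  ultimately have "FP (\<lambda>x. rev (map (g x) (xs x)))" by simp
  from FP_rev[OF this] show ?thesis by simp
qed

lemma FP_filter [FP_intros]:
  assumes P: "FP (\<lambda>z. P (fst z) (snd z))" and xs: "FP xs"
  shows "FP (\<lambda>x. filter (P x) (xs x))"
proof -
  have "FP (\<lambda>x. foldl (\<lambda>s y. if P x y then y # s else s) [] (xs x))"
  proof (rule FP_foldl_add[where G = "\<lambda>x. 1 + sz (xs x)"])
    show "FP (\<lambda>z. if P (fst z) (snd (snd z)) then snd (snd z) # fst (snd z) else fst (snd z))"
      by (intro FP_intros FP_uncurry_snd[OF P])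
  qed (auto intro!: FP_intros xs pb_intros simp: sz_mem)
  moreover have "foldl (\<lambda>s y. if P x y then y # s else s) b ys = rev (filter (P x) ys) @ b" for x b ys
    by (induction ys arbitrary: b) auto
  ultimately have "FP (\<lambda>x. rev (filter (P x) (xs x)))" by simp
  from FP_rev[OF this] show ?thesis by simp
qed

lemma FP_list_all [FP_intros]:
  assumes P: "FP (\<lambda>z. P (fst z) (snd z))" and xs: "FP xs"
  shows "FP (\<lambda>x. list_all (P x) (xs x))"
proof -
  have "(\<lambda>x. list_all (P x) (xs x)) = (\<lambda>x. filter (\<lambda>y. \<not> P x y) (xs x) = [])"
    by (auto simp: filter_empty_conv list_all_iff)
  then show ?thesis by (simp only:) (intro FP_intros assms)
qed

lemma FP_concat [FP_intros]:
  assumes "FP xs"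
  shows "FP (\<lambda>x. concat (xs x))"
proof -
  have "sz (s @ y) \<le> sz s + sz (xs x)" if "y \<in> set (xs x)" for x y s
    using sz_append[of s y] sz_mem[OF that] by simp
  then have "FP (\<lambda>x. foldl (\<lambda>s y. s @ y) [] (xs x))"
    by (intro FP_foldl_add[where G = "\<lambda>x. sz (xs x)"]) (auto intro!: FP_intros assms pb_intros)
  moreover have "foldl (\<lambda>s y. s @ y) b a = b @ concat a" for a and b :: "'b list"
    by (induction a arbitrary: b) auto
  ultimately show ?thesis by simp
qed


subsection \<open>Natural numbers\<close>

definition nlen :: "nat \<Rightarrow> nat" where
  "nlen n = length (nbits n)"

lemma nlen_le_iff: "nlen n \<le> k \<longleftrightarrow> n < 2 ^ k"
proof (induction k arbitrary: n)
  case 0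
  then show ?case by (simp add: nlen_def)
next
  case (Suc k)
  show ?case
  proof (cases "n = 0")
    case False
    then have "nlen n \<le> Suc k \<longleftrightarrow> n div 2 < 2 ^ k"
      using Suc.IH[of "n div 2"] by (simp add: nlen_def nbits_pos)
    then show ?thesis by (simp add: div_less_iff_less_mult ac_simps)
  qed (simp add: nlen_def)
qed

lemma less_power_nlen: "n < 2 ^ nlen n"
  using nlen_le_iff[of n "nlen n"] by simp

lemma nlen_le_self: "nlen n \<le> n"
  using nlen_le_iff[of n n] less_exp[of n] by simp

lemma nlen_mono: "a \<le> b \<Longrightarrow> nlen a \<le> nlen b"
  using nlen_le_iff[of a "nlen b"] less_power_nlen[of b] by simp

lemma nlen_add: "nlen (a + b) \<le> nlen a + nlen b + 1"
proof -
  have "a + b < 2 ^ nlen a + 2 ^ nlen b" using less_power_nlen[of a] less_power_nlen[of b] by (rule add_strict_mono)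
  also have "\<dots> \<le> 2 ^ (nlen a + nlen b) + 2 ^ (nlen a + nlen b)"
    by (intro add_mono power_increasing) auto
  finally show ?thesis unfolding nlen_le_iff by simp
qed

lemma nlen_mult: "nlen (a * b) \<le> nlen a + nlen b"
  unfolding nlen_le_iff power_add
  using less_power_nlen[of a] less_power_nlen[of b] by (intro mult_strict_mono) auto

lemma nlen_le_sz: "nlen n \<le> sz n"
  unfolding nlen_def sz_nat by (rule length_le_sz)

lemma sz_nat_le: "sz n \<le> 4 * nlen n + 1"
proof -
  have "sz bs \<le> 4 * length bs + 1" for bs :: "bool list"
    by (induction bs) (use sz_bool_le in \<open>auto simp: sz_bool\<close>)
  then show ?thesis by (simp add: nlen_def sz_nat)
qed

lemma FP_nbits [FP_intros]: "FP f \<Longrightarrow> FP (\<lambda>x. nbits (f x))"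
  by (erule FP_cast) (simp add: to_tree_nat_def)

lemma FP_div2 [FP_intros]:
  assumes "FP f"
  shows "FP (\<lambda>x. f x div 2 :: nat)"
proof -
  have "FP (\<lambda>x. tl (nbits (f x)))" by (intro FP_intros assms)
  moreover have "tl (nbits n) = nbits (n div 2)" for n
    by (cases "n = 0") (auto simp: nbits_pos)
  ultimately show ?thesis by (auto elim!: FP_cast simp: to_tree_nat_def)
qed

lemma FP_odd [FP_intros]:
  assumes "FP f"
  shows "FP (\<lambda>x. odd (f x :: nat))"
proof -
  have "(\<lambda>x. odd (f x)) = (\<lambda>x. case nbits (f x) of [] \<Rightarrow> False | b # bs \<Rightarrow> b)"
    by (rule ext) (use nbits_pos in \<open>force split: list.split simp: nbits.simps\<close>)
  then show ?thesis by (simp only:) (intro FP_intros assms)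
qed

definition append_bit :: "nat \<Rightarrow> bool \<Rightarrow> nat" where
  "append_bit n b = 2 * n + of_bool b"

lemma FP_append_bit [FP_intros]:
  assumes "FP f" "FP b"
  shows "FP (\<lambda>x. append_bit (f x) (b x))"
proof (rule FP_cast)
  show "FP (\<lambda>x. if b x \<or> nbits (f x) \<noteq> [] then b x # nbits (f x) else [])"
    by (intro FP_intros assms)
  show "to_tree (if b x \<or> nbits (f x) \<noteq> [] then b x # nbits (f x) else []) =
      to_tree (append_bit (f x) (b x))" for x
    by (auto simp: to_tree_nat_def append_bit_def nbits_pos)
qed

lemma sz_append_bit: "sz (append_bit n b) \<le> sz n + 4"
  by (cases "b \<or> n \<noteq> 0") (auto simp: sz_nat append_bit_def nbits_pos sz_bool)

text \<open>Horner's rule, most significant digit first. The start value leaves room for a final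
  carry as leading digit.\<close>

definition bits_value :: "nat \<Rightarrow> bool list \<Rightarrow> nat" where
  "bits_value = foldl append_bit"

lemma FP_bits_value [FP_intros]:
  assumes "FP c" "FP bs"
  shows "FP (\<lambda>x. bits_value (c x) (bs x))"
  unfolding bits_value_def
  by (rule FP_foldl_add[where G = "\<lambda>_. 4"])
    (auto intro!: FP_intros assms pb_intros simp: sz_append_bit)

lemma bits_value_Nil [simp]: "bits_value c [] = c"
  by (simp add: bits_value_def)

lemma bits_value_start: "bits_value c bs = c * 2 ^ length bs + bits_value 0 bs"
proof (induction bs arbitrary: c)
  case (Cons b bs)
  have "bits_value c (b # bs) = append_bit c b * 2 ^ length bs + bits_value 0 bs"
    using Cons[of "append_bit c b"] by (simp add: bits_value_def)
  moreover have "bits_value 0 (b # bs) = append_bit 0 b * 2 ^ length bs + bits_value 0 bs"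
    using Cons[of "append_bit 0 b"] by (simp add: bits_value_def)
  ultimately show ?case by (simp add: append_bit_def algebra_simps)
qed (simp add: bits_value_def)

lemma bits_value_Cons: "bits_value 0 (b # bs) = of_bool b * 2 ^ length bs + bits_value 0 bs"
  using bits_value_start[of "append_bit 0 b" bs] by (simp add: bits_value_def append_bit_def)

lemma bits_value_less: "bits_value 0 bs < 2 ^ length bs"
  by (induction bs) (auto simp: bits_value_Cons)

lemma bits_value_rev_nbits: "bits_value 0 (rev (nbits n)) = n"
proof (induction n rule: less_induct)
  case (less n)
  show ?case
  proof (cases "n = 0")
    case True
    then show ?thesis by (simp add: bits_value_def)
  next
    case False
    have "bits_value 0 (rev (nbits n)) = append_bit (bits_value 0 (rev (nbits (n div 2)))) (odd n)"
      using False by (simp add: nbits_pos bits_value_def)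
    also have "\<dots> = n"
      using less[of "n div 2"] False by (simp add: append_bit_def)
    finally show ?thesis .
  qed
qed

text \<open>
  One digit of a ripple-carry addition, or of a subtraction with borrow if \<open>sub\<close> holds. The state
  consists of the remaining operands, the carry and the digits found so far, the last one first.
\<close>

definition ripple_step :: "bool \<Rightarrow> nat \<times> nat \<times> bool \<times> bool list \<Rightarrow> bool \<Rightarrow> nat \<times> nat \<times> bool \<times> bool list" where
  "ripple_step sub s u =
     (fst s div 2, fst (snd s) div 2,
      if odd (fst s) = sub then odd (fst (snd s)) \<and> fst (snd (snd s))
        else odd (fst (snd s)) \<or> fst (snd (snd s)),
      (odd (fst s) = (odd (fst (snd s)) = fst (snd (snd s)))) # snd (snd (snd s)))"

text \<open>The list \<open>nbits x @ nbits y\<close> is the clock: it provides enough rounds for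
  both operands to be shifted down to 0.\<close>

definition ripple :: "bool \<Rightarrow> nat \<Rightarrow> nat \<Rightarrow> bool \<times> bool list" where
  "ripple sub x y = snd (snd (foldl (ripple_step sub) (x, y, False, []) (nbits x @ nbits y)))"

lemma sz_div2: "sz (n div 2 :: nat) \<le> sz n"
  by (cases "n = 0") (auto simp: sz_nat nbits_pos)

lemma FP_ripple [FP_intros]:
  assumes "FP f" "FP g"
  shows "FP (\<lambda>x. ripple sub (f x) (g x))"
  unfolding ripple_def
proof (intro FP_snd FP_foldl_add[where G = "\<lambda>_. 10"])
  show "FP (\<lambda>z. ripple_step sub (fst (snd z)) (snd (snd z)))"
    unfolding ripple_step_def by (intro FP_intros)
  fix s :: "nat \<times> nat \<times> bool \<times> bool list" and u :: bool
  obtain x y c out where s: "s = (x, y, c, out)" by (metis prod_cases4)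
  show "sz (ripple_step sub s u) \<le> sz s + 10"
    using sz_div2[of x] sz_div2[of y] by (auto simp: s ripple_step_def sz_bool)
qed (intro FP_intros pb_intros assms)+

text \<open>The conserved quantity is the value of the digits found so far plus the shifted value of
  what remains. A borrow has the sign of the second operand, so one sign \<open>\<sigma>\<close>
  covers addition and subtraction.\<close>

lemma ripple_invariant:
  fixes sub defines "\<sigma> \<equiv> (if sub then -1 else 1 :: int)"
  shows "foldl (ripple_step sub) (x, y, c, out) us = (x', y', c', out') \<Longrightarrow>
    int (bits_value 0 out') + 2 ^ length out' * (int x' + \<sigma> * (int y' + of_bool c')) =
    int (bits_value 0 out) + 2 ^ length out * (int x + \<sigma> * (int y + of_bool c)) \<and>
    length out' = length out + length us \<and> x' = x div 2 ^ length us \<and> y' = y div 2 ^ length us"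
proof (induction us arbitrary: x y c out)
  case (Cons u us)
  define c1 where "c1 = (if odd x = sub then odd y \<and> c else odd y \<or> c)"
  define o1 where "o1 = (odd x = (odd y = c))"
  have step: "ripple_step sub (x, y, c, out) u = (x div 2, y div 2, c1, o1 # out)"
    by (simp add: ripple_step_def c1_def o1_def)
  have IH: "int (bits_value 0 out') + 2 ^ length out' * (int x' + \<sigma> * (int y' + of_bool c')) =
     int (bits_value 0 (o1 # out)) + 2 ^ length (o1 # out) *
       (int (x div 2) + \<sigma> * (int (y div 2) + of_bool c1)) \<and>
     length out' = length (o1 # out) + length us \<and> x' = x div 2 div 2 ^ length us \<and>
     y' = y div 2 div 2 ^ length us"
    by (rule Cons.IH) (use Cons.prems step in simp)
  have halves: "int n = 2 * int (n div 2) + of_bool (odd n)" for n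
    by (simp add: of_bool_odd_eq_mod_2 zdiv_int zmod_int flip: of_bool_odd_eq_mod_2[of "int n"])
  \<comment> \<open>The one-digit identity
    \<open>x0 + \<sigma> * (y0 + c) = o1 + 2 * \<sigma> * c1\<close>, where \<open>x0\<close> and
    \<open>y0\<close> are the lowest digits.\<close>
  have "int x + \<sigma> * (int y + of_bool c) =
      of_bool o1 + 2 * (int (x div 2) + \<sigma> * (int (y div 2) + of_bool c1))"
    by (subst halves[of x], subst halves[of y]) (auto simp: \<sigma>_def o1_def c1_def)
  then have "int (bits_value 0 (o1 # out)) + 2 ^ length (o1 # out) *
       (int (x div 2) + \<sigma> * (int (y div 2) + of_bool c1)) =
     int (bits_value 0 out) + 2 ^ length out * (int x + \<sigma> * (int y + of_bool c))"
    by (simp add: bits_value_Cons algebra_simps)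
  note eq = this
  from IH have "int (bits_value 0 out') + 2 ^ length out' * (int x' + \<sigma> * (int y' + of_bool c')) =
      int (bits_value 0 out) + 2 ^ length out * (int x + \<sigma> * (int y + of_bool c))"
    using eq by (elim conjE) (simp only:)
  moreover have "length out' = length out + length (u # us) \<and> x' = x div 2 ^ length (u # us) \<and>
      y' = y div 2 ^ length (u # us)"
    using IH by (simp add: div_mult2_eq)
  ultimately show ?case by (rule conjI)
qed simp

lemma ripple_correct:
  assumes "ripple sub x y = (c, out)"
  shows "int (bits_value 0 out) + 2 ^ length out * ((if sub then -1 else 1) * of_bool c) =
    int x + (if sub then -1 else 1) * int y"
proof -
  obtain x' y' where *: "foldl (ripple_step sub) (x, y, False, []) (nbits x @ nbits y) = (x', y', c, out)"
    using assms unfolding ripple_def by (metis prod.collapse)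
  have "x < 2 ^ (nlen x + nlen y)" "y < 2 ^ (nlen x + nlen y)"
    using nlen_le_iff by (metis le_add1 le_add2)+
  then have "x' = 0" "y' = 0"
    using ripple_invariant[OF *] by (auto simp: nlen_def)
  then show ?thesis using conjunct1[OF ripple_invariant[OF *]] by (simp split: if_splits)
qed

lemma add_eq_ripple: "x + y = bits_value (of_bool (fst (ripple False x y))) (snd (ripple False x y))"
proof -
  obtain c out where r: "ripple False x y = (c, out)" by fastforce
  have "int (x + y) = int (bits_value (of_bool c) out)"
    using ripple_correct[OF r] bits_value_start[of "of_bool c" out] by (cases c) auto
  then show ?thesis by (simp add: r)
qed

text \<open>The digits denote a number between 0 and \<open>2 ^ length out\<close>, so the final
  borrow is set exactly if the difference is negative.\<close>

lemma less_eq_ripple: "x < y \<longleftrightarrow> fst (ripple True x y)"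
  and diff_eq_ripple: "x - y = (if x < y then 0 else bits_value 0 (snd (ripple True x y)))"
proof -
  obtain c out where r: "ripple True x y = (c, out)" by fastforce
  define P :: int where "P = 2 ^ length out"
  define B where "B = bits_value 0 out"
  have "int B < P"
    using bits_value_less[of out] by (simp add: P_def B_def)
  moreover have "int B - P * of_bool c = int x - int y"
    using ripple_correct[OF r] by (simp add: P_def B_def)
  ultimately show "x < y \<longleftrightarrow> fst (ripple True x y)"
    and "x - y = (if x < y then 0 else bits_value 0 (snd (ripple True x y)))"
    by (cases c; auto simp: r B_def[symmetric])+
qed

lemma FP_of_bool_nat [FP_intros]:
  assumes "FP b"
  shows "FP (\<lambda>x. of_bool (b x) :: nat)"
  unfolding of_bool_def by (intro FP_intros assms)

lemma FP_add_nat [FP_intros]: "FP f \<Longrightarrow> FP g \<Longrightarrow> FP (\<lambda>x. f x + g x :: nat)"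
  unfolding add_eq_ripple by (intro FP_intros)

lemma FP_less_nat [FP_intros]: "FP f \<Longrightarrow> FP g \<Longrightarrow> FP (\<lambda>x. f x < (g x :: nat))"
  unfolding less_eq_ripple by (intro FP_intros)

lemma FP_diff_nat [FP_intros]: "FP f \<Longrightarrow> FP g \<Longrightarrow> FP (\<lambda>x. f x - g x :: nat)"
  unfolding diff_eq_ripple by (intro FP_intros)

lemma FP_eq_nat [FP_intros]: "FP f \<Longrightarrow> FP g \<Longrightarrow> FP (\<lambda>x. f x = (g x :: nat))"
  unfolding eq_iff not_less[symmetric] by (intro FP_intros)

lemma FP_le_nat [FP_intros]: "FP f \<Longrightarrow> FP g \<Longrightarrow> FP (\<lambda>x. f x \<le> (g x :: nat))"
  unfolding not_less[symmetric] by (intro FP_intros)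

text \<open>Double-and-add from the most significant digit, which keeps every intermediate value a
  product of \<open>y\<close> with a prefix of \<open>x\<close>.\<close>

lemma mult_eq_foldl: "x * y = foldl (\<lambda>a b. a + a + (if b then y else 0)) 0 (rev (nbits x))"
proof -
  have "foldl (\<lambda>a b. a + a + (if b then y else 0)) (c * y) bs = bits_value c bs * y" for c bs
  proof (induction bs arbitrary: c)
    case (Cons b bs)
    have "c * y + c * y + (if b then y else 0) = append_bit c b * y"
      by (simp add: append_bit_def algebra_simps)
    then show ?case using Cons[of "append_bit c b"] by (simp add: bits_value_def)
  qed (simp add: bits_value_def)
  from this[of 0] show ?thesis by (simp add: bits_value_rev_nbits)
qed

lemma FP_mult_nat [FP_intros]:
  assumes "FP f" "FP g"
  shows "FP (\<lambda>x. f x * g x :: nat)"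
  unfolding mult_eq_foldl
proof (rule FP_foldl_measure[where m = nlen and c = 4 and d = 1 and G = "\<lambda>x. nlen (g x) + 3"])
  have "FP (\<lambda>z. g (fst z))" by (intro FP_comp[OF assms(2)] FP_intros)
  then show "FP (\<lambda>z. fst (snd z) + fst (snd z) + (if snd (snd z) then g (fst z) else 0))"
    by (intro FP_intros)
  show "pb (\<lambda>x. nlen (g x) + 3)"
    by (rule pb_mono[of "\<lambda>x. sz (g x) + 3"]) (auto intro!: pb_intros assms simp: nlen_le_sz)
  fix x s y
  have "nlen (s + s) \<le> nlen s + 1"
    using less_power_nlen[of s] by (simp add: nlen_le_iff)
  moreover have "nlen (if y then g x else 0) \<le> nlen (g x)" by (simp add: nlen_def)
  ultimately show "nlen (s + s + (if y then g x else 0)) \<le> nlen s + (nlen (g x) + 3)"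
    using nlen_add[of "s + s" "if y then g x else 0"] by linarith
qed (intro FP_intros pb_intros assms sz_nat_le)+

lemma FP_Let [FP_intros]:
  assumes "FP f" "FP (\<lambda>z. g (fst z) (snd z))"
  shows "FP (\<lambda>x. let y = f x in g x y)"
  using FP_comp[OF assms(2) FP_Pair[OF FP_id assms(1)]] by (simp add: Let_def)

lemma FP_case_prod [FP_intros]:
  assumes "FP f" "FP (\<lambda>z. g (fst z) (fst (snd z)) (snd (snd z)))"
  shows "FP (\<lambda>x. case f x of (a, b) \<Rightarrow> g x a b)"
  using FP_comp[OF assms(2) FP_Pair[OF FP_id assms(1)]] by (simp add: case_prod_beta)


subsection \<open>Integers\<close>

definition ilen :: "int \<Rightarrow> nat" where
  "ilen z = nlen (nat \<bar>z\<bar>)"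

lemma ilen_le_iff: "ilen z \<le> k \<longleftrightarrow> \<bar>z\<bar> < 2 ^ k"
  by (simp add: ilen_def nlen_le_iff nat_less_iff)

lemma sz_int_le: "sz z \<le> 4 * ilen z + 3"
proof -
  have 0: "sz (0 :: nat) = 1" by (simp add: sz_nat)
  show ?thesis
    using sz_nat_le[of "nat z"] sz_nat_le[of "nat (- z)"]
    by (cases "0 \<le> z") (auto simp: sz_int ilen_def 0 nlen_def)
qed

lemma ilen_le_sz: "ilen z \<le> sz z"
  using nlen_le_sz[of "nat z"] nlen_le_sz[of "nat (- z)"]
  by (cases "0 \<le> z") (auto simp: sz_int ilen_def)

lemma ilen_add: "ilen (a + b) \<le> ilen a + ilen b + 1"
proof -
  have "nlen (nat \<bar>a + b\<bar>) \<le> nlen (nat \<bar>a\<bar> + nat \<bar>b\<bar>)"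
    by (rule nlen_mono) linarith
  then show ?thesis using nlen_add[of "nat \<bar>a\<bar>" "nat \<bar>b\<bar>"] by (simp add: ilen_def)
qed

lemma ilen_mult: "ilen (a * b) \<le> ilen a + ilen b"
  using nlen_mult[of "nat \<bar>a\<bar>" "nat \<bar>b\<bar>"] by (simp add: ilen_def abs_mult nat_mult_distrib)

lemma FP_nat_parts:
  assumes "FP f"
  shows "FP (\<lambda>x. (nat (f x), nat (- f x)))"
  using assms by (rule FP_cast) (simp add: to_tree_int_def)

lemma FP_nat [FP_intros]: "FP f \<Longrightarrow> FP (\<lambda>x. nat (f x))"
  using FP_fst[OF FP_nat_parts] by simp

lemma FP_nat_uminus [FP_intros]: "FP f \<Longrightarrow> FP (\<lambda>x. nat (- f x))"
  using FP_snd[OF FP_nat_parts] by simp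

text \<open>The two truncated differences are the components of the stored pair, so an integer
  operation is programmable once its result is a difference of two computable naturals.\<close>

definition int_diff :: "nat \<Rightarrow> nat \<Rightarrow> int" where
  "int_diff a b = int a - int b"

lemma FP_int_diff [FP_intros]:
  assumes "FP f" "FP g"
  shows "FP (\<lambda>x. int_diff (f x) (g x))"
proof (rule FP_cast)
  show "FP (\<lambda>x. (f x - g x, g x - f x))" by (intro FP_intros assms)
  show "to_tree (f x - g x, g x - f x) = to_tree (int_diff (f x) (g x))" for x
    by (auto simp: to_tree_int_def int_diff_def nat_diff_distrib' intro!: arg_cong[of _ _ to_tree])
qed

lemma FP_int [FP_intros]:
  assumes "FP f"
  shows "FP (\<lambda>x. int (f x))"
proof -
  have "int n = int_diff n 0" for n by (simp add: int_diff_def)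
  then show ?thesis by (simp only:) (intro FP_intros assms)
qed

lemma FP_uminus_int [FP_intros]:
  assumes "FP f"
  shows "FP (\<lambda>x. - f x :: int)"
proof -
  have "- z = int_diff (nat (- z)) (nat z)" for z by (simp add: int_diff_def)
  then have "(\<lambda>x. - f x) = (\<lambda>x. int_diff (nat (- f x)) (nat (f x)))" by blast
  then show ?thesis by (simp only:) (intro FP_intros assms)
qed

lemma FP_add_int [FP_intros]:
  assumes "FP f" "FP g"
  shows "FP (\<lambda>x. f x + g x :: int)"
proof -
  have "a + b = int_diff (nat a + nat b) (nat (- a) + nat (- b))" for a b
    by (simp add: int_diff_def)
  then show ?thesis by (simp only:) (intro FP_intros assms)
qed

lemma FP_minus_int [FP_intros]:
  assumes "FP f" "FP g"
  shows "FP (\<lambda>x. f x - g x :: int)"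
proof -
  have "a - b = a + (- b)" for a b :: int by simp
  then show ?thesis by (simp only:) (intro FP_intros assms)
qed

lemma FP_mult_int [FP_intros]:
  assumes "FP f" "FP g"
  shows "FP (\<lambda>x. f x * g x :: int)"
proof -
  have eq: "a * b = int_diff (nat a * nat b + nat (- a) * nat (- b)) (nat a * nat (- b) + nat (- a) * nat b)"
    for a b
  proof -
    have "a * b = (int (nat a) - int (nat (- a))) * (int (nat b) - int (nat (- b)))"
      by simp
    also have "\<dots> = int_diff (nat a * nat b + nat (- a) * nat (- b)) (nat a * nat (- b) + nat (- a) * nat b)"
      unfolding int_diff_def of_nat_add of_nat_mult by (simp only: algebra_simps)
    finally show ?thesis .
  qed
  have "(\<lambda>x. f x * g x) = (\<lambda>x. int_diff (nat (f x) * nat (g x) + nat (- f x) * nat (- g x))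
      (nat (f x) * nat (- g x) + nat (- f x) * nat (g x)))"
    by (rule ext) (rule eq)
  then show ?thesis by (simp only:) (intro FP_intros assms)
qed

lemma FP_int_pos [FP_intros]:
  assumes "FP f"
  shows "FP (\<lambda>x. 0 < (f x :: int))"
proof -
  have "(\<lambda>x. 0 < f x) = (\<lambda>x. 0 < nat (f x))" by auto
  then show ?thesis by (simp only:) (intro FP_intros assms)
qed

lemma FP_int_eq_0 [FP_intros]:
  assumes "FP f"
  shows "FP (\<lambda>x. f x = (0 :: int))"
proof -
  have "(\<lambda>x. f x = 0) = (\<lambda>x. nat (f x) = 0 \<and> nat (- f x) = 0)" by auto
  then show ?thesis by (simp only:) (intro FP_intros assms)
qed

lemma FP_sum_list [FP_intros]:
  assumes "FP f"
  shows "FP (\<lambda>x. sum_list (f x) :: int)"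
proof -
  have "FP (\<lambda>x. foldl (\<lambda>s y. s + y) (0 :: int) (f x))"
  proof (rule FP_foldl_measure[where m = ilen and c = 4 and d = 3 and G = "\<lambda>x. sz (f x) + 1"])
    fix x s y assume "y \<in> set (f x)"
    then show "ilen (s + y) \<le> ilen s + (sz (f x) + 1)"
      using ilen_add[of s y] ilen_le_sz[of y] sz_mem[of y "f x"] by linarith
  qed (intro FP_intros pb_intros assms sz_int_le)+
  moreover have "foldl (+) a ys = a + sum_list ys" for a and ys :: "int list"
    by (induction ys arbitrary: a) (auto simp: ac_simps)
  ultimately show ?thesis by simp
qed

lemma FP_prod_list [FP_intros]:
  assumes "FP f"
  shows "FP (\<lambda>x. prod_list (f x) :: int)"
proof -
  have "FP (\<lambda>x. foldl (\<lambda>s y. s * y) (1 :: int) (f x))"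
  proof (rule FP_foldl_measure[where m = ilen and c = 4 and d = 3 and G = "\<lambda>x. sz (f x)"])
    fix x s y assume "y \<in> set (f x)"
    then show "ilen (s * y) \<le> ilen s + sz (f x)"
      using ilen_mult[of s y] ilen_le_sz[of y] sz_mem[of y "f x"] by linarith
  qed (intro FP_intros pb_intros assms sz_int_le)+
  moreover have "foldl (*) a ys = a * prod_list ys" for a and ys :: "int list"
    by (induction ys arbitrary: a) (auto simp: ac_simps)
  ultimately show ?thesis by simp
qed


subsection \<open>Indexing\<close>

lemma sz_nat_le_self: "sz n \<le> 4 * n + 1"
  using sz_nat_le[of n] nlen_le_self[of n] by simp

lemma FP_length [FP_intros]:
  assumes "FP xs"
  shows "FP (\<lambda>x. length (xs x))"
proof -
  have eq: "foldl (\<lambda>s y. s + 1) a ys = a + length ys" for a :: nat and ys :: "'b list"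
    by (induction ys arbitrary: a) auto
  have "FP (\<lambda>x. foldl (\<lambda>s y. s + 1) (0 :: nat) (xs x))"
  proof (rule FP_foldl[where B = "\<lambda>x. 4 * sz (xs x) + 1"])
    fix x j assume "j \<le> length (xs x)"
    then show "sz (foldl (\<lambda>s y. s + 1) (0 :: nat) (take j (xs x))) \<le> 4 * sz (xs x) + 1"
      unfolding eq using sz_nat_le_self[of j] length_le_sz[of "xs x"] by simp
  qed (intro FP_intros pb_intros assms)+
  then show ?thesis unfolding eq by simp
qed

text \<open>For a number \<open>n\<close> in binary the list \<open>[0..<n]\<close> is exponentially
  long in the size of \<open>n\<close>. Ranges are therefore taken only up to the length of a given
  list, and the algorithm passes index lists around instead of dimensions.\<close>

lemma FP_upt [FP_intros]:
  assumes "FP xs"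
  shows "FP (\<lambda>x. [0..<length (xs x)])"
proof -
  have eq: "foldl (\<lambda>s y. length s # s) (rev [0..<a]) ys = rev [0..<a + length ys]"
    for a and ys :: "'b list"
  proof (induction ys arbitrary: a)
    case (Cons y ys)
    then show ?case using Cons[of "Suc a"] by simp
  qed simp
  have "FP (\<lambda>x. foldl (\<lambda>s y. length s # s) [] (xs x))"
  proof (rule FP_foldl[where B = "\<lambda>x. 1 + sz (xs x) * (4 * sz (xs x) + 2)"])
    fix x j assume j: "j \<le> length (xs x)"
    have "sz (rev [0..<j]) \<le> 1 + length (rev [0..<j]) * (4 * sz (xs x) + 1 + 1)"
      by (rule sz_le_uniform)
        (use j length_le_sz[of "xs x"] in \<open>auto intro!: order.trans[OF sz_nat_le_self]\<close>)
    also have "\<dots> \<le> 1 + sz (xs x) * (4 * sz (xs x) + 2)"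
      using j length_le_sz[of "xs x"] by (intro add_left_mono mult_mono) auto
    finally show "sz (foldl (\<lambda>s y. length s # s) [] (take j (xs x))) \<le> 1 + sz (xs x) * (4 * sz (xs x) + 2)"
      using eq[of 0 "take j (xs x)"] j by simp
  qed (intro FP_intros pb_intros assms)+
  then have "FP (\<lambda>x. rev [0..<length (xs x)])"
    using eq[of 0] by simp
  from FP_rev[OF this] show ?thesis by simp
qed

lemma FP_nth_default [FP_intros]:
  assumes "FP xs" "FP i"
  shows "FP (\<lambda>x. nth_default d (xs x) (i x))"
proof -
  let ?step = "\<lambda>x s y. (fst s + 1, if fst s = i x then y else snd s)"
  have eq: "foldl (?step x) (0, d) ys = (length ys, nth_default d ys (i x))" for x ys
    by (induction ys rule: rev_induct) (auto simp: nth_default_def nth_append)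
  have i: "FP (\<lambda>z. i (fst z))" by (intro FP_comp[OF assms(2)] FP_intros)
  have "FP (\<lambda>x. foldl (?step x) (0, d) (xs x))"
  proof (rule FP_foldl[where B = "\<lambda>x. 4 * sz (xs x) + 1 + (sz d + sz (xs x)) + 1"])
    show "FP (\<lambda>z. (fst (fst (snd z)) + 1, if fst (fst (snd z)) = i (fst z) then snd (snd z) else snd (fst (snd z))))"
      by (intro FP_intros i)
    fix x j assume j: "j \<le> length (xs x)"
    have "sz (nth_default d (take j (xs x)) (i x)) \<le> sz d + sz (xs x)"
      using sz_mem[of _ "xs x"] by (auto simp: nth_default_def trans_le_add2)
    moreover have "sz j \<le> 4 * sz (xs x) + 1"
      using sz_nat_le_self[of j] j length_le_sz[of "xs x"] by simp
    moreover have len: "length (take j (xs x)) = j" using j by simp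
    ultimately show "sz (foldl (?step x) (0, d) (take j (xs x))) \<le> 4 * sz (xs x) + 1 + (sz d + sz (xs x)) + 1"
      unfolding eq len sz_Pair by linarith
  qed (intro FP_intros pb_intros assms)+
  from FP_snd[OF this] show ?thesis unfolding eq by simp
qed


subsection \<open>Reading the input\<close>

text \<open>
  Symbols are letter codes. The state consists of the sign and the digits (last one first) of the
  number being read, the numerator of the current fraction, and the lists of the fractions read
  since and before the semicolon.
\<close>

definition read_symbol ::
  "bool \<times> bool list \<times> int \<times> (int \<times> int) list \<times> (int \<times> int) list \<Rightarrow> nat \<Rightarrow>
   bool \<times> bool list \<times> int \<times> (int \<times> int) list \<times> (int \<times> int) list" where
  "read_symbol s a = (case s of (neg, ds, num, qs, ps) \<Rightarrow>
     if a < 2 then (neg, (a = 1) # ds, num, qs, ps)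
     else if a = 2 then (True, ds, num, qs, ps)
     else if a = 3 then
       (neg, [], if neg then - int (bits_value 0 ds) else int (bits_value 0 ds), qs, ps)
     else if a = 4 then (False, [], 0, qs @ [(num, int (bits_value 0 ds))], ps)
     else (neg, ds, num, [], qs))"

definition read_word :: "nat list \<Rightarrow> (int \<times> int) list \<times> (int \<times> int) list" where
  "read_word w = (case foldl read_symbol (False, [], 0, [], []) w of (neg, ds, num, qs, ps) \<Rightarrow> (ps, qs))"

lemma FP_read_symbol: "FP (\<lambda>z. read_symbol (fst (snd z)) (snd (snd z)))"
  unfolding read_symbol_def by (intro FP_intros)

lemma ilen_int_bits_value: "ilen (int (bits_value 0 ds)) \<le> length ds"
  using bits_value_less[of ds] by (simp add: ilen_def nlen_le_iff)

lemma FP_read_word: "FP read_word"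
proof -
  \<comment> \<open>A digit list of length \<open>l\<close> becomes a number of size at most
    \<open>4 * l + 3\<close>. With weight 4 on digits, this conversion raises the measure only by a
    constant.\<close>
  let ?m = "\<lambda>(neg :: bool, ds :: bool list, num :: int, qs :: (int \<times> int) list, ps :: (int \<times> int) list).
    4 * length ds + sz num + sz qs + sz ps"
  have "FP (\<lambda>w. foldl read_symbol (False, [], 0, [], []) w)"
  proof (rule FP_foldl_measure[where m = ?m and c = 1 and d = 10 and G = "\<lambda>_. 20"])
    fix s :: "bool \<times> bool list \<times> int \<times> (int \<times> int) list \<times> (int \<times> int) list"
    obtain neg ds num qs ps where s: "s = (neg, ds, num, qs, ps)" by (metis prod_cases5)
    have "sz ds \<le> 4 * length ds + 1"
      by (induction ds) (auto simp: sz_bool)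
    then show "sz s \<le> 1 * ?m s + 10"
      by (simp add: s sz_bool)
  next
    fix w :: "nat list" and s :: "bool \<times> bool list \<times> int \<times> (int \<times> int) list \<times> (int \<times> int) list" and a
    obtain neg ds num qs ps where s: "s = (neg, ds, num, qs, ps)" by (metis prod_cases5)
    let ?v = "int (bits_value 0 ds)"
    have v: "sz ?v \<le> 4 * length ds + 3" "sz (- ?v) \<le> 4 * length ds + 3"
      using sz_int_le[of ?v] sz_int_le[of "- ?v"] ilen_int_bits_value[of ds] by (auto simp: ilen_def)
    have 0: "sz (0 :: int) \<le> 3" using sz_int_le[of 0] by (simp add: ilen_def nlen_def)
    have "sz (qs @ [(num, ?v)]) \<le> sz qs + sz num + sz ?v + 10"
      using sz_append[of qs "[(num, ?v)]"] by simp
    then show "?m (read_symbol s a) \<le> ?m s + 20"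
      using v 0 by (auto simp: s read_symbol_def)
  qed (simp_all add: FP_read_symbol FP_const FP_id pb_const)
  then show ?thesis
    unfolding read_word_def by (intro FP_intros)
qed


subsection \<open>The algorithm\<close>

text \<open>Each fraction is expanded by the product of all other denominators. No least common
  multiple is formed, and bit lengths merely add up.\<close>

definition numerators :: "(int \<times> int) list \<Rightarrow> int list" where
  "numerators qs = (let I = [0..<length qs] in
     map (\<lambda>i. fst (nth_default (0, 1) qs i) *
       prod_list (map (\<lambda>k. if k = i then 1 else snd (nth_default (0, 1) qs k)) I)) I)"

definition denominator :: "(int \<times> int) list \<Rightarrow> int" where
  "denominator qs = prod_list (map snd qs)"

text \<open>
  The index \<open>n\<close> is a homogenizing coordinate, with which monomials of degree less than 3 are padded.
  Its value is the common denominator of the entries of the point.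
\<close>

definition index_triples :: "nat list \<Rightarrow> nat \<Rightarrow> (nat \<times> nat \<times> nat) list" where
  "index_triples I n =
     [(n, n, n)] @ map (\<lambda>i. (i, n, n)) I @
     concat (map (\<lambda>i. map (\<lambda>j. (i, j, n)) (filter (\<lambda>j. i \<le> j) I)) I) @
     concat (map (\<lambda>i. concat (map (\<lambda>j.
       map (\<lambda>k. (i, j, k)) (filter (\<lambda>k. j \<le> k) I)) (filter (\<lambda>j. i \<le> j) I))) I)"

type_synonym cubic_form = "(int \<times> nat \<times> nat \<times> nat) list"

definition form_terms :: "int list \<Rightarrow> (nat \<times> nat \<times> nat) list \<Rightarrow> cubic_form" where
  "form_terms cs ts = map (\<lambda>t. (nth_default 0 cs t, nth_default (0, 0, 0) ts t)) [0..<length cs]"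

text \<open>Differentiation here, and likewise in the Hessian, goes by position of the factor and
  not by variable: repeated indices get their multiplicity because several conditions hold at
  once.\<close>

definition form_gradient :: "cubic_form \<Rightarrow> int list \<Rightarrow> nat \<Rightarrow> int" where
  "form_gradient F v a = sum_list (map (\<lambda>(c, i, j, k).
     c * ((if i = a then nth_default 0 v j * nth_default 0 v k else 0) +
          (if j = a then nth_default 0 v i * nth_default 0 v k else 0) +
          (if k = a then nth_default 0 v i * nth_default 0 v j else 0))) F)"

definition form_hessian :: "cubic_form \<Rightarrow> int list \<Rightarrow> nat \<Rightarrow> nat \<Rightarrow> int" where
  "form_hessian F v a b = sum_list (map (\<lambda>(c, i, j, k).
     c * ((if i = a \<and> j = b then nth_default 0 v k else 0) +
          (if j = a \<and> i = b then nth_default 0 v k else 0) +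
          (if i = a \<and> k = b then nth_default 0 v j else 0) +
          (if k = a \<and> i = b then nth_default 0 v j else 0) +
          (if j = a \<and> k = b then nth_default 0 v i else 0) +
          (if k = a \<and> j = b then nth_default 0 v i else 0))) F)"

definition entry :: "int list list \<Rightarrow> nat \<Rightarrow> nat \<Rightarrow> int" where
  "entry A i j = nth_default 0 (nth_default [] A i) j"

definition bird_step :: "nat list \<Rightarrow> int list list \<Rightarrow> int list list \<Rightarrow> int list list" where
  "bird_step I A Y = map (\<lambda>i. map (\<lambda>j.
     entry A i j * sum_list (map (\<lambda>l. entry Y l l) (filter (\<lambda>l. i < l) I)) -
     sum_list (map (\<lambda>l. entry Y i l * entry A l j) (filter (\<lambda>l. i < l) I))) I) I"

text \<open>
  When the fold arrives at \<open>i\<close>, the number of indices after \<open>i\<close> equals the number of steps made, and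
  then the \<open>i\<close>-th diagonal entry is the trailing minor that starts at \<open>i\<close>.
\<close>

definition trailing_minors_positive :: "nat list \<Rightarrow> int list list \<Rightarrow> bool" where
  "trailing_minors_positive I A = snd (foldl (\<lambda>s i.
     (bird_step I A (fst s), snd s \<and> 0 < entry (fst s) i i)) (A, True) (rev I))"

text \<open>For an encoded instance, \<open>v\<close> is the vector \<open>(x, 1)\<close> multiplied
  by the common denominator of \<open>x\<close>, and \<open>F\<close> has the coefficients
  multiplied by theirs. Neither affects the vanishing of the gradient or the signs of the
  minors.\<close>

definition decide :: "nat list \<Rightarrow> bool" where
  "decide w = (case read_word w of (ps, qs) \<Rightarrow>
     let I = [0..<length ps];
         v = numerators ps @ [denominator ps];
         F = form_terms (numerators qs) (index_triples I (length ps))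
     in list_all (\<lambda>a. form_gradient F v a = 0) I \<and>
        trailing_minors_positive I (map (\<lambda>a. map (\<lambda>b. form_hessian F v a b) I) I))"

lemma FP_entry [FP_intros]: "FP A \<Longrightarrow> FP i \<Longrightarrow> FP j \<Longrightarrow> FP (\<lambda>x. entry (A x) (i x) (j x))"
  unfolding entry_def by (intro FP_intros)

lemma FP_numerators [FP_intros]:
  assumes "FP f"
  shows "FP (\<lambda>x. numerators (f x))"
proof -
  have "FP numerators" unfolding numerators_def by (intro FP_intros)
  from FP_comp[OF this assms] show ?thesis .
qed

lemma FP_denominator [FP_intros]:
  assumes "FP f"
  shows "FP (\<lambda>x. denominator (f x))"
proof -
  have "FP denominator" unfolding denominator_def by (intro FP_intros)
  from FP_comp[OF this assms] show ?thesis .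
qed

lemma FP_index_triples [FP_intros]:
  assumes "FP f" "FP g"
  shows "FP (\<lambda>x. index_triples (f x) (g x))"
proof -
  have "FP (\<lambda>z. index_triples (fst z) (snd z))" unfolding index_triples_def by (intro FP_intros)
  from FP_comp[OF this FP_Pair[OF assms]] show ?thesis by simp
qed

lemma FP_form_terms [FP_intros]:
  assumes "FP f" "FP g"
  shows "FP (\<lambda>x. form_terms (f x) (g x))"
proof -
  have "FP (\<lambda>z. form_terms (fst z) (snd z))" unfolding form_terms_def by (intro FP_intros)
  from FP_comp[OF this FP_Pair[OF assms]] show ?thesis by simp
qed

lemma FP_form_gradient [FP_intros]:
  assumes "FP F" "FP v" "FP a"
  shows "FP (\<lambda>x. form_gradient (F x) (v x) (a x))"
proof -
  have "FP (\<lambda>z. form_gradient (fst z) (fst (snd z)) (snd (snd z)))"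
    unfolding form_gradient_def by (intro FP_intros)
  from FP_comp[OF this FP_Pair[OF assms(1) FP_Pair[OF assms(2,3)]]] show ?thesis by simp
qed

lemma FP_form_hessian [FP_intros]:
  assumes "FP F" "FP v" "FP a" "FP b"
  shows "FP (\<lambda>x. form_hessian (F x) (v x) (a x) (b x))"
proof -
  have "FP (\<lambda>z. form_hessian (fst z) (fst (snd z)) (fst (snd (snd z))) (snd (snd (snd z))))"
    unfolding form_hessian_def by (intro FP_intros)
  from FP_comp[OF this FP_Pair[OF assms(1) FP_Pair[OF assms(2) FP_Pair[OF assms(3,4)]]]]
  show ?thesis by simp
qed

lemma FP_bird_step [FP_intros]:
  assumes "FP I" "FP A" "FP Y"
  shows "FP (\<lambda>x. bird_step (I x) (A x) (Y x))"
proof -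
  have "FP (\<lambda>z. bird_step (fst z) (fst (snd z)) (snd (snd z)))"
    unfolding bird_step_def by (intro FP_intros)
  from FP_comp[OF this FP_Pair[OF assms(1) FP_Pair[OF assms(2,3)]]] show ?thesis by simp
qed


section \<open>Bit lengths in the determinant iteration\<close>

lemma abs_sum_list_le:
  "(\<And>x. x \<in> set xs \<Longrightarrow> \<bar>f x\<bar> \<le> (B :: int)) \<Longrightarrow> \<bar>sum_list (map f xs)\<bar> \<le> int (length xs) * B"
proof (induction xs)
  case (Cons x xs)
  have "\<bar>f x\<bar> \<le> B" "\<bar>sum_list (map f xs)\<bar> \<le> int (length xs) * B"
    using Cons by auto
  then show ?case by (simp add: algebra_simps)
qed simp

lemma entry_map:
  "entry (map (\<lambda>i. map (g i) I) J) a b = (if a < length J \<and> b < length I then g (J ! a) (I ! b) else 0)"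
  by (simp add: entry_def nth_default_def)

definition mat_bounded :: "nat \<Rightarrow> nat \<Rightarrow> int list list \<Rightarrow> bool" where
  "mat_bounded L m Y \<longleftrightarrow> length Y \<le> L \<and> (\<forall>row\<in>set Y. length row \<le> L) \<and> (\<forall>i j. ilen (entry Y i j) \<le> m)"

lemma sz_mat_bounded:
  assumes "mat_bounded L m Y"
  shows "sz Y \<le> 1 + L * (1 + L * (4 * m + 4) + 1)"
proof -
  have row: "sz row \<le> 1 + L * (4 * m + 4)" if "row \<in> set Y" for row
  proof -
    obtain i where i: "i < length Y" "row = Y ! i"
      using \<open>row \<in> set Y\<close> by (metis in_set_conv_nth)
    have "sz z \<le> 4 * m + 3" if z: "z \<in> set row" for z
    proof -
      obtain j where "j < length row" "z = row ! j"
        using z by (auto simp: in_set_conv_nth)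
      then have "z = entry Y i j"
        using i by (simp add: entry_def nth_default_def)
      then have "ilen z \<le> m" using assms by (auto simp: mat_bounded_def)
      then show ?thesis using sz_int_le[of z] by simp
    qed
    then have "sz row \<le> 1 + length row * (4 * m + 3 + 1)"
      by (rule sz_le_uniform)
    also have "\<dots> \<le> 1 + L * (4 * m + 4)"
      using assms that by (intro add_left_mono mult_mono) (auto simp: mat_bounded_def)
    finally show ?thesis .
  qed
  then have "sz Y \<le> 1 + length Y * (1 + L * (4 * m + 4) + 1)"
    by (rule sz_le_uniform)
  also have "\<dots> \<le> 1 + L * (1 + L * (4 * m + 4) + 1)"
    using assms by (intro add_left_mono mult_right_mono) (auto simp: mat_bounded_def)
  finally show ?thesis .
qed

text \<open>A new entry is at most \<open>2 * (L * 2 ^ m * 2 ^ L)\<close> in absolute value, and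
  \<open>L < 2 ^ L\<close>: hence \<open>2 * L + 1\<close> additional bits.\<close>

lemma mat_bounded_bird_step:
  assumes I: "length I \<le> L" and A: "\<And>i j. ilen (entry A i j) \<le> L" and Y: "mat_bounded L m Y"
  shows "mat_bounded L (m + 2 * L + 1) (bird_step I A Y)"
proof -
  have Aabs: "\<bar>entry A i j\<bar> \<le> 2 ^ L" and Yabs: "\<bar>entry Y i j\<bar> \<le> 2 ^ m" for i j
    using A Y by (auto simp: ilen_le_iff mat_bounded_def intro: less_imp_le)
  have "ilen (entry (bird_step I A Y) a b) \<le> m + 2 * L + 1" for a b
  proof (cases "a < length I \<and> b < length I")
    case True
    let ?i = "I ! a" and ?j = "I ! b"
    let ?K = "filter (\<lambda>l. ?i < l) I"
    let ?S1 = "sum_list (map (\<lambda>l. entry Y l l) ?K)"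
    let ?S2 = "sum_list (map (\<lambda>l. entry Y ?i l * entry A l ?j) ?K)"
    have len: "int (length ?K) \<le> int L"
      using I length_filter_le[of "\<lambda>l. ?i < l" I] by linarith
    have "\<bar>?S1\<bar> \<le> int (length ?K) * 2 ^ m"
      by (rule abs_sum_list_le) (rule Yabs)
    also have "\<dots> \<le> int L * 2 ^ m" by (rule mult_right_mono[OF len]) simp
    finally have "\<bar>entry A ?i ?j * ?S1\<bar> \<le> 2 ^ L * (int L * 2 ^ m)"
      unfolding abs_mult by (intro mult_mono Aabs) auto
    moreover have "\<bar>?S2\<bar> \<le> int (length ?K) * (2 ^ m * 2 ^ L)"
      by (rule abs_sum_list_le) (unfold abs_mult, intro mult_mono Aabs Yabs, auto)
    moreover have "int (length ?K) * (2 ^ m * 2 ^ L) \<le> int L * (2 ^ m * 2 ^ L)"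
      by (rule mult_right_mono[OF len]) simp
    ultimately have "\<bar>entry A ?i ?j * ?S1 - ?S2\<bar> \<le> 2 ^ L * (int L * 2 ^ m) + int L * (2 ^ m * 2 ^ L)"
      by linarith
    also have "\<dots> = 2 * (int L * 2 ^ m * 2 ^ L)"
      by (simp add: ac_simps)
    also have "\<dots> < 2 * (2 ^ L * 2 ^ m * 2 ^ L)"
      by (intro mult_strict_left_mono mult_strict_right_mono of_nat_less_two_power) auto
    also have "\<dots> = 2 ^ (m + 2 * L + 1)" by (simp add: power_add power_even_eq power2_eq_square)
    finally show ?thesis
      using True by (simp add: bird_step_def entry_map ilen_le_iff)
  next
    case False
    then show ?thesis by (auto simp: bird_step_def entry_map ilen_def nlen_def)
  qed
  then show ?thesis
    using I by (auto simp: mat_bounded_def bird_step_def)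
qed

lemma FP_trailing_minors_positive [FP_intros]:
  assumes "FP I" "FP A"
  shows "FP (\<lambda>x. trailing_minors_positive (I x) (A x))"
proof -
  let ?step = "\<lambda>z :: nat list \<times> int list list. \<lambda>s i.
    (bird_step (fst z) (snd z) (fst s), snd s \<and> 0 < entry (fst s) i i)"
  have A: "ilen (entry (snd z) i j) \<le> sz z" for z :: "nat list \<times> int list list" and i j
  proof (cases "i < length (snd z) \<and> j < length (snd z ! i)")
    case True
    then have "snd z ! i \<in> set (snd z)" "snd z ! i ! j \<in> set (snd z ! i)" by auto
    from sz_mem[OF this(1)] sz_mem[OF this(2)] have "sz (entry (snd z) i j) \<le> sz (snd z)"
      using True by (simp add: entry_def nth_default_def)
    also have "\<dots> \<le> sz z" by (cases z) simp
    finally show ?thesis using ilen_le_sz le_trans by blast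
  qed (auto simp: entry_def nth_default_def ilen_def nlen_def)
  \<comment> \<open>The input size bounds the dimension as well as the bit length of the matrix
    \<open>A\<close>. Each round adds \<open>2 * sz z + 1\<close> bits, so the growth over a full
    run is at most quadratic in \<open>sz z\<close>.\<close>
  have bounded: "mat_bounded (sz z) (sz z + length ys * (2 * sz z + 1)) (fst (foldl (?step z) (snd z, True) ys))"
    for z ys
  proof (induction ys rule: rev_induct)
    case Nil
    have "length row \<le> sz z" if "row \<in> set (snd z)" for row
      using length_le_sz[of row] sz_mem[OF that] by (cases z) simp
    moreover have "length (snd z) \<le> sz z"
      using length_le_sz[of "snd z"] by (cases z) simp
    ultimately show ?case by (simp add: mat_bounded_def A)
  next
    case (snoc y ys)
    have "length (fst z) \<le> sz z"
      using length_le_sz[of "fst z"] by (cases z) simp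
    from mat_bounded_bird_step[OF this A snoc] show ?case
      by (simp add: algebra_simps)
  qed
  have "FP (\<lambda>z. foldl (?step z) (snd z, True) (rev (fst z)))"
  proof (rule FP_foldl)
    let ?M = "\<lambda>z. sz z + sz z * (2 * sz z + 1)"
    let ?B = "\<lambda>z. 1 + sz z * (1 + sz z * (4 * ?M z + 4) + 1) + 4"
    show "pb ?B" by (intro pb_intros)
    fix z :: "nat list \<times> int list list" and j
    assume "j \<le> length (rev (fst z))"
    let ?s = "foldl (?step z) (snd z, True) (take j (rev (fst z)))"
    have "length (take j (rev (fst z))) \<le> sz z"
      using length_le_sz[of "fst z"] by (cases z) simp
    then have "sz z + length (take j (rev (fst z))) * (2 * sz z + 1) \<le> ?M z"
      by (intro add_left_mono mult_right_mono) auto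
    then have "mat_bounded (sz z) (?M z) (fst ?s)"
      using bounded[of z "take j (rev (fst z))"] le_trans unfolding mat_bounded_def by blast
    from sz_mat_bounded[OF this] show "sz ?s \<le> ?B z"
      using sz_bool_le[of "snd ?s"] sz_Pair[of "fst ?s" "snd ?s"] by simp
  qed (intro FP_intros)+
  then have "FP (\<lambda>z. trailing_minors_positive (fst z) (snd z))"
    unfolding trailing_minors_positive_def by (rule FP_snd)
  from FP_comp[OF this FP_Pair[OF assms]] show ?thesis by simp
qed

lemma FP_decide: "FP decide"
  unfolding decide_def by (intro FP_intros FP_comp[OF FP_read_word])

section \<open>Loading the input word and passing to a Turing machine\<close>

fun symbol_case :: "nat \<Rightarrow> (nat \<Rightarrow> com) \<Rightarrow> nat list \<Rightarrow> com" where
  "symbol_case i f [] = Pop i"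
| "symbol_case i f (a # A) = If i [a] (Seq (Pop i) (f a)) (symbol_case i f A)"

lemma exec_symbol_case:
  assumes "i < num_stacks" "s i = x # xs" "exec (f x) (s(i := xs)) t s'"
  shows "x \<in> set A \<Longrightarrow> exec (symbol_case i f A) s (t + 2 + length A) s'"
proof (induction A)
  case (Cons a A)
  show ?case
  proof (cases "x = a")
    case True
    have "exec (Pop i) s 1 (s(i := xs))"
      by (rule exec_weaken[OF exec_Pop_exact]) (use assms in auto)
    from exec_Seq_exact[OF this assms(3)[unfolded True]] show ?thesis
      unfolding symbol_case.simps by (rule exec.IfT[rotated 2]) (use assms True in auto)
  next
    case False
    then have "exec (symbol_case i f A) s (t + 2 + length A) s'"
      using Cons by auto
    then show ?thesis
      unfolding symbol_case.simps by (rule exec.IfF[rotated 2]) (use assms False in auto)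
  qed
qed simp

abbreviation "letters \<equiv> [0..<blank_sym]"

text \<open>A command writes only symbols fixed in its text, hence the branching over the alphabet
  by \<open>symbol_case\<close>. The word is reversed first because the code of a list is built up
  from its last element, starting with the 0 of the empty list.\<close>

definition load_input :: com where
  "load_input = Seq (While 0 letters (symbol_case 0 (\<lambda>a. Push 1 a) letters))
     (Seq (Push 0 0)
       (While 1 letters (Seq (symbol_case 1 (\<lambda>a. push_word 0 (cd a)) letters) (Push 0 1))))"

lemma exec_reverse_input:
  "s 0 = w \<Longrightarrow> set w \<subseteq> set letters \<Longrightarrow>
   exec (While 0 letters (symbol_case 0 (\<lambda>a. Push 1 a) letters)) s (11 * length w + 1)
     (s(0 := [], 1 := rev w @ s 1))"
proof (induction w arbitrary: s)
  case Nil
  show ?case by (rule exec_weaken[OF exec.WhileF[where t = 1]]) (use Nil in \<open>auto simp: fun_eq_iff\<close>)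
next
  case (Cons a w)
  have "exec (Push 1 a) (s(0 := w)) 2 (s(0 := w, 1 := a # s 1))"
    by (rule exec_weaken[OF exec_Push_exact]) (use Cons.prems in auto)
  from exec_symbol_case[where i = 0 and s = s and x = a and xs = w and f = "\<lambda>a. Push 1 a" and A = letters, OF _ _ this]
  have 1: "exec (symbol_case 0 (\<lambda>a. Push 1 a) letters) s 10 (s(0 := w, 1 := a # s 1))"
    using Cons.prems by simp
  have 2: "exec (While 0 letters (symbol_case 0 (\<lambda>a. Push 1 a) letters)) (s(0 := w, 1 := a # s 1))
      (11 * length w + 1) (s(0 := [], 1 := rev (a # w) @ s 1))"
    by (rule exec_weaken[OF Cons.IH]) (use Cons.prems in \<open>auto simp: fun_eq_iff\<close>)
  show ?case by (rule exec.WhileT[OF _ _ 1 2]) (use Cons.prems in auto)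
qed

lemma exec_encode_input:
  "s 1 = w \<Longrightarrow> s 0 = cd ys \<Longrightarrow> set w \<subseteq> set letters \<Longrightarrow>
   exec (While 1 letters (Seq (symbol_case 1 (\<lambda>a. push_word 0 (cd a)) letters) (Push 0 1))) s
     (80 * length w + 1) (s(0 := cd (rev w @ ys), 1 := []))"
proof (induction w arbitrary: s ys)
  case Nil
  show ?case by (rule exec_weaken[OF exec.WhileF[where t = 1]]) (use Nil in \<open>auto simp: fun_eq_iff\<close>)
next
  case (Cons a w)
  let ?s1 = "s(0 := cd a @ cd ys, 1 := w)"
  \<comment> \<open>Letters are at most 5, and \<open>4 * 5 + 1 = 21\<close>.\<close>
  have sz: "sz a \<le> 21"
    using Cons.prems sz_nat_le_self[of a] by simp
  have "exec (push_word 0 (cd a)) (s(1 := w)) (3 * length (cd a) + 1) ?s1"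
    by (rule exec_weaken[OF exec_push_word]) (use Cons.prems set_cd[of a] in \<open>auto simp: fun_eq_iff\<close>)
  then have "exec (push_word 0 (cd a)) (s(1 := w)) 64 ?s1"
    by (rule exec_mono) (use sz in \<open>simp add: sz_def\<close>)
  from exec_symbol_case[where i = 1 and s = s and x = a and xs = w and f = "\<lambda>a. push_word 0 (cd a)" and A = letters, OF _ _ this]
  have 1: "exec (symbol_case 1 (\<lambda>a. push_word 0 (cd a)) letters) s 72 ?s1"
    using Cons.prems by simp
  have 2: "exec (Push 0 1) ?s1 2 (s(0 := cd (a # ys), 1 := w))"
    by (rule exec_weaken[OF exec_Push_exact]) (auto simp: cd_Cons fun_eq_iff)
  have 3: "exec (While 1 letters (Seq (symbol_case 1 (\<lambda>a. push_word 0 (cd a)) letters) (Push 0 1)))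
      (s(0 := cd (a # ys), 1 := w)) (80 * length w + 1) (s(0 := cd (rev (a # w) @ ys), 1 := []))"
    by (rule exec_weaken[OF Cons.IH[of _ "a # ys"]]) (use Cons.prems in \<open>auto simp: fun_eq_iff\<close>)
  show ?case by (rule exec.WhileT[OF _ _ exec_Seq_exact[OF 1 2] 3]) (use Cons.prems in auto)
qed

lemma exec_load_input:
  assumes "set w \<subseteq> set letters"
  shows "exec load_input ((\<lambda>_. [])(0 := w)) (91 * length w + 6) ((\<lambda>_. [])(0 := cd w))"
proof -
  let ?s = "\<lambda>_. [] :: nat list"
  have 1: "exec (While 0 letters (symbol_case 0 (\<lambda>a. Push 1 a) letters)) (?s(0 := w))
      (11 * length w + 1) (?s(1 := rev w))"
    by (rule exec_weaken[OF exec_reverse_input]) (use assms in \<open>auto simp: fun_eq_iff\<close>)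
  have 2: "exec (Push 0 0) (?s(1 := rev w)) 2 (?s(0 := cd ([] :: nat list), 1 := rev w))"
    by (rule exec_weaken[OF exec_Push_exact]) (auto simp: cd_Nil fun_eq_iff)
  have 3: "exec (While 1 letters (Seq (symbol_case 1 (\<lambda>a. push_word 0 (cd a)) letters) (Push 0 1)))
      (?s(0 := cd ([] :: nat list), 1 := rev w)) (80 * length w + 1) (?s(0 := cd w))"
    by (rule exec_weaken[OF exec_encode_input[of _ "rev w" "[]"]])
      (use assms in \<open>auto simp: fun_eq_iff\<close>)
  show ?thesis unfolding load_input_def
    by (rule exec_weaken[OF exec_Seq_exact[OF 1 exec_Seq_exact[OF 2 3]]]) auto
qed

lemma FP_decides_in_polynomial_time:
  fixes f :: "nat list \<Rightarrow> bool"
  assumes "FP f"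
  obtains M :: "(nat, nat) tm" and T :: "nat poly" where
    "wf_tm M" "symbols M = {..blank_sym}" "blank M = blank_sym"
    "\<And>w. set w \<subseteq> {..<blank_sym} \<Longrightarrow> answers_within M w (poly T (length w)) (f w)"
proof -
  obtain c U where c: "computes c f U" "pb U"
    using assms by (auto simp: FP_def)
  obtain k where k: "\<And>w. U w \<le> (sz w + 1) ^ k"
    using c(2) unfolding pb_def by blast
  let ?M = "machine (Seq load_input c)"
  \<comment> \<open>The linear part pays for loading, the sequencing step and the verdict step; the
    power comes from \<open>(sz w + 1) ^ k\<close> with
    \<open>sz w \<le> 1 + 22 * length w\<close>.\<close>
  let ?T = "[:8, 91:] + [:2, 22:] ^ k"
  show thesis
  proof (rule that)
    fix w :: "nat list" assume w: "set w \<subseteq> {..<blank_sym}"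
    then have 1: "exec load_input ((\<lambda>_. [])(0 := w)) (91 * length w + 6) ((\<lambda>_. [])(0 := cd w))"
      by (intro exec_load_input) auto
    have 2: "exec c ((\<lambda>_. [])(0 := cd w)) (U w) ((\<lambda>_. [])(0 := cd (f w)))"
      using computesD'[OF c(1), of "\<lambda>_. []" w "[]"] by simp
    have "sz w \<le> 1 + length w * (21 + 1)"
      by (rule sz_le_uniform) (use w in \<open>auto intro!: order.trans[OF sz_nat_le_self]\<close>)
    then have "U w \<le> (2 + 22 * length w) ^ k"
      using k[of w] power_mono[of "sz w + 1" "2 + 22 * length w" k] by (simp add: ac_simps)
    then show "answers_within ?M w (poly ?T (length w)) (f w)"
      by (intro machine_answers[OF exec_Seq_exact[OF 1 2]]) (auto simp: cd_bool ac_simps)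
  qed (simp_all add: wf_machine)
qed

section \<open>Minors and the division-free determinant iteration\<close>

text \<open>Lists rather than sets of indices: the order of rows and columns fixes the sign, and
  repeated columns must be expressible because the minors with a repetition, being 0, complete the
  sums below.\<close>

definition minor :: "(nat \<Rightarrow> nat \<Rightarrow> 'a::comm_ring_1) \<Rightarrow> nat list \<Rightarrow> nat list \<Rightarrow> 'a" where
  "minor A R C = det (mat (length R) (length R) (\<lambda>(a, b). A (R ! a) (C ! b)))"

lemma minor_Nil [simp]: "minor A [] C = 1"
  by (simp add: minor_def)

lemma remove1_nth_distinct:
  assumes "distinct L" "q < length L"
  shows "remove1 (L ! q) L = take q L @ drop (Suc q) L"
proof -
  have "L ! q \<notin> set (take q L)"
    using assms by (auto simp: in_set_conv_nth nth_eq_iff_index_eq)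
  moreover have "remove1 (L ! q) L = remove1 (L ! q) (take q L @ L ! q # drop (Suc q) L)"
    using id_take_nth_drop[OF assms(2)] by simp
  ultimately show ?thesis by (simp add: remove1_append)
qed

lemma nth_remove1_nth:
  assumes "distinct L" "q < length L" "a < length L - 1"
  shows "remove1 (L ! q) L ! a = (if a < q then L ! a else L ! Suc a)"
  using assms by (auto simp: remove1_nth_distinct nth_append min_def)

text \<open>Laplace expansion along the first column. Moving column \<open>L ! q\<close> to the
  front of the remaining matrix costs the sign \<open>(- 1) ^ q\<close>, which cancels against the
  cofactor sign \<open>(- 1) ^ Suc q\<close> and leaves a uniform minus.\<close>

lemma minor_expand:
  fixes A :: "nat \<Rightarrow> nat \<Rightarrow> 'a::comm_ring_1"
  assumes L: "distinct L"
  shows "minor A (i # L) (j # L) = A i j * minor A L L -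
    (\<Sum>q<length L. A (L ! q) j *
       minor A (i # remove1 (L ! q) L) (L ! q # remove1 (L ! q) L))"
proof -
  let ?m = "length L"
  define X where "X = mat (Suc ?m) (Suc ?m) (\<lambda>(a, b). A ((i # L) ! a) ((j # L) ! b))"
  have X: "X \<in> carrier_mat (Suc ?m) (Suc ?m)" by (simp add: X_def)
  have "mat_delete X 0 0 = mat ?m ?m (\<lambda>(a, b). A (L ! a) (L ! b))"
    by (rule eq_matI) (auto simp: X_def mat_delete_def)
  then have 0: "cofactor X 0 0 = minor A L L"
    by (simp add: cofactor_def minor_def)
  have Suc: "cofactor X (Suc q) 0 = - minor A (i # remove1 (L ! q) L) (L ! q # remove1 (L ! q) L)"
    if q: "q < ?m" for q
  proof -
    define B where "B = mat_delete X (Suc q) 0"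
    have B: "B \<in> carrier_mat ?m ?m" by (simp add: B_def X_def mat_delete_def)
    have len: "length (i # remove1 (L ! q) L) = ?m"
      using q by (simp add: length_remove1)
    have "swap_col_to_front B q =
        mat ?m ?m (\<lambda>(a, b). A ((i # remove1 (L ! q) L) ! a) ((L ! q # remove1 (L ! q) L) ! b))"
      unfolding swap_col_to_front_result[OF B q]
    proof (rule cong_mat)
      fix a b assume ab: "a < ?m" "b < ?m"
      show "(case (a, b) of (i, j) \<Rightarrow>
            if j = 0 then B $$ (i, q) else if j \<le> q then B $$ (i, j - 1) else B $$ (i, j)) =
          (case (a, b) of (a, b) \<Rightarrow> A ((i # remove1 (L ! q) L) ! a) ((L ! q # remove1 (L ! q) L) ! b))"
        using q ab by (cases a; cases b) (auto simp: B_def X_def mat_delete_def nth_remove1_nth[OF L q])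
    qed simp_all
    then have "minor A (i # remove1 (L ! q) L) (L ! q # remove1 (L ! q) L) = (- 1) ^ q * det B"
      using swap_col_to_front_det[OF B q] unfolding minor_def len by simp
    then have "(- 1) ^ Suc q * det B = - minor A (i # remove1 (L ! q) L) (L ! q # remove1 (L ! q) L)"
      by simp
    then show ?thesis by (simp add: cofactor_def B_def)
  qed
  have "minor A (i # L) (j # L) = (\<Sum>p<Suc ?m. X $$ (p, 0) * cofactor X p 0)"
    using laplace_expansion_column[OF X, of 0] by (simp add: minor_def X_def)
  also have "\<dots> = X $$ (0, 0) * cofactor X 0 0 + (\<Sum>q<?m. X $$ (Suc q, 0) * cofactor X (Suc q) 0)"
    by (rule sum.lessThan_Suc_shift)
  also have "(\<Sum>q<?m. X $$ (Suc q, 0) * cofactor X (Suc q) 0) =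
      (\<Sum>q<?m. - (A (L ! q) j * minor A (i # remove1 (L ! q) L) (L ! q # remove1 (L ! q) L)))"
    by (rule sum.cong) (auto simp: Suc, simp add: X_def)
  finally show ?thesis
    by (simp add: 0 sum_negf) (simp add: X_def)
qed

abbreviation sl :: "nat set \<Rightarrow> nat list" where
  "sl \<equiv> sorted_list_of_set"

lemma minor_expand_set:
  fixes A :: "nat \<Rightarrow> nat \<Rightarrow> 'a::comm_ring_1"
  assumes "finite T"
  shows "minor A (i # sl T) (j # sl T) = A i j * minor A (sl T) (sl T) -
    (\<Sum>l\<in>T. A l j * minor A (i # sl (T - {l})) (l # sl (T - {l})))"
proof -
  let ?g = "\<lambda>l. A l j * minor A (i # remove1 l (sl T)) (l # remove1 l (sl T))"
  have "(\<Sum>q<length (sl T). ?g (sl T ! q)) = sum_list (map ?g (sl T))"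
    by (simp add: sum_list_sum_nth atLeast0LessThan)
  also have "\<dots> = (\<Sum>l\<in>T. ?g l)"
    using assms by (simp add: sum_list_distinct_conv_sum_set)
  finally show ?thesis
    using minor_expand[of "sl T" A i j] assms by (simp add: sorted_list_of_set_remove)
qed

lemma minor_eq_0_column:
  assumes "length R = length C" "a < b" "b < length C" "C ! a = C ! b"
  shows "minor A R C = 0"
  unfolding minor_def
  by (rule det_identical_columns[of _ "length R" a b]) (use assms in \<open>auto simp: col_def intro!: eq_vecI\<close>)

lemma minor_duplicate_column:
  assumes "finite T" "l \<in> T"
  shows "minor A (i # sl T) (l # sl T) = 0"
proof -
  obtain q where "q < length (sl T)" "sl T ! q = l"
    using assms by (metis in_set_conv_nth set_sorted_list_of_set)
  then show ?thesis by (intro minor_eq_0_column[of _ _ 0 "Suc q"]) auto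
qed

text \<open>Closed form of entry \<open>(i, j)\<close> after \<open>m\<close> rounds of Bird's
  iteration.\<close>

definition bird_sum :: "(nat \<Rightarrow> nat \<Rightarrow> 'a::comm_ring_1) \<Rightarrow> nat \<Rightarrow> nat \<Rightarrow> nat \<Rightarrow> nat \<Rightarrow> 'a" where
  "bird_sum A n m i j =
     (\<Sum>S | S \<subseteq> {Suc i..<n} \<and> card S = m. minor A (i # sl S) (j # sl S))"

lemma bird_sum_0: "bird_sum A n 0 i j = A i j"
proof -
  have "{S. S \<subseteq> {Suc i..<n} \<and> card S = 0} = {{}}"
    by (auto dest: finite_subset)
  then show ?thesis
    by (simp add: bird_sum_def) (simp add: minor_def det_single)
qed

lemma bird_sum_last:
  assumes "Suc (i + m) = n"
  shows "bird_sum A n m i i = minor A [i..<n] [i..<n]"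
proof -
  have "{S. S \<subseteq> {Suc i..<n} \<and> card S = m} = {{Suc i..<n}}"
  proof (intro equalityI subsetI)
    fix S assume "S \<in> {S. S \<subseteq> {Suc i..<n} \<and> card S = m}"
    then have "S = {Suc i..<n}"
      using assms by (intro card_subset_eq) auto
    then show "S \<in> {{Suc i..<n}}" by simp
  qed (use assms in auto)
  then show ?thesis
    using assms by (simp add: bird_sum_def upt_conv_Cons)
qed

text \<open>Splitting off the least element of \<open>T\<close> shows that the diagonal sum in
  Bird's step collects all principal minors of size \<open>Suc m\<close> above
  \<open>i\<close>.\<close>

lemma sum_minors_by_Min:
  "(\<Sum>T | T \<subseteq> {Suc i..<n} \<and> card T = Suc m. minor A (sl T) (sl T)) =
   (\<Sum>l\<in>{Suc i..<n}. bird_sum A n m l l)"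
proof -
  let ?Sig = "SIGMA l:{Suc i..<n}. {S. S \<subseteq> {Suc l..<n} \<and> card S = m}"
  have fin: "finite {S. S \<subseteq> {Suc l..<n} \<and> card S = m}" for l
    by (rule finite_subset[of _ "Pow {Suc l..<n}"]) auto
  have "(\<Sum>l\<in>{Suc i..<n}. bird_sum A n m l l) =
      (\<Sum>(l, S)\<in>?Sig. minor A (l # sl S) (l # sl S))"
    unfolding bird_sum_def by (rule sum.Sigma) (auto simp: fin)
  also have "\<dots> = (\<Sum>T | T \<subseteq> {Suc i..<n} \<and> card T = Suc m. minor A (sl T) (sl T))"
  proof (rule sum.reindex_bij_witness[where i = "\<lambda>T. (Min T, T - {Min T})" and j = "\<lambda>(l, S). insert l S"])
    fix p assume "p \<in> ?Sig"
    then obtain l S where p: "p = (l, S)" "l \<in> {Suc i..<n}" "S \<subseteq> {Suc l..<n}" "card S = m"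
      by auto
    have finS: "finite S" using p(3) finite_subset by blast
    have notin: "l \<notin> S" using p(3) by auto
    have Min: "Min (insert l S) = l"
      by (rule Min_eqI) (use finS p(3) in auto)
    show "(Min (case p of (l, S) \<Rightarrow> insert l S), (case p of (l, S) \<Rightarrow> insert l S) - {Min (case p of (l, S) \<Rightarrow> insert l S)}) = p"
      using Min notin by (simp add: p(1))
    show "(case p of (l, S) \<Rightarrow> insert l S) \<in> {T. T \<subseteq> {Suc i..<n} \<and> card T = Suc m}"
      using p finS notin by auto
    have "sl (insert l S) = l # sl S"
      using sorted_list_of_set_nonempty[of "insert l S"] finS Min notin by simp
    then show "minor A (sl (case p of (l, S) \<Rightarrow> insert l S)) (sl (case p of (l, S) \<Rightarrow> insert l S)) =
        (case p of (l, S) \<Rightarrow> minor A (l # sl S) (l # sl S))"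
      by (simp add: p(1))
  next
    fix T assume "T \<in> {T. T \<subseteq> {Suc i..<n} \<and> card T = Suc m}"
    then have T: "T \<subseteq> {Suc i..<n}" "card T = Suc m" by auto
    have fin: "finite T" and ne: "T \<noteq> {}" using T card.infinite by fastforce+
    have Min: "Min T \<in> T" using fin ne by simp
    show "(case (Min T, T - {Min T}) of (l, S) \<Rightarrow> insert l S) = T" using Min by auto
    have "T - {Min T} \<subseteq> {Suc (Min T)..<n}"
    proof
      fix t assume t: "t \<in> T - {Min T}"
      then have "Min T \<le> t" using fin by simp
      then show "t \<in> {Suc (Min T)..<n}" using t T by (auto simp: Suc_le_eq)
    qed
    then show "(Min T, T - {Min T}) \<in> ?Sig"
      using Min T fin by auto
  qed
  finally show ?thesis by simp
qed

lemma sum_minors_by_column: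
  assumes "finite R"
  shows "(\<Sum>T | T \<subseteq> R \<and> card T = Suc m. \<Sum>l\<in>T. A l j * minor A (i # sl (T - {l})) (l # sl (T - {l}))) =
   (\<Sum>l\<in>R. A l j * (\<Sum>S | S \<subseteq> R \<and> card S = m. minor A (i # sl S) (l # sl S)))"
proof -
  let ?h = "\<lambda>l S. A l j * minor A (i # sl S) (l # sl S)"
  let ?P = "\<lambda>m. {T. T \<subseteq> R \<and> card T = m}"
  have fin: "finite (?P m)" for m
    by (rule finite_subset[of _ "Pow R"]) (use assms in auto)
  have "(\<Sum>T\<in>?P (Suc m). \<Sum>l\<in>T. ?h l (T - {l})) = (\<Sum>(T, l)\<in>(SIGMA T:?P (Suc m). T). ?h l (T - {l}))"
    using fin assms by (intro sum.Sigma) (auto intro: finite_subset)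
  also have "\<dots> = (\<Sum>(l, S)\<in>(SIGMA l:R. {S \<in> ?P m. l \<notin> S}). ?h l S)"
  proof (rule sum.reindex_bij_witness[where j = "\<lambda>(T, l). (l, T - {l})" and i = "\<lambda>(l, S). (insert l S, l)"])
    fix p assume p: "p \<in> (SIGMA l:R. {S \<in> ?P m. l \<notin> S})"
    obtain l S where lS: "p = (l, S)" by fastforce
    have "finite S" using p assms by (auto simp: lS intro: finite_subset)
    then show "(case p of (l, S) \<Rightarrow> (insert l S, l)) \<in> (SIGMA T:?P (Suc m). T)"
      using p by (auto simp: lS)
    show "(case case p of (l, S) \<Rightarrow> (insert l S, l) of (T, l) \<Rightarrow> (l, T - {l})) = p"
      using p by (auto simp: lS)
  qed (use assms in \<open>auto intro: finite_subset\<close>)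
  also have "\<dots> = (\<Sum>l\<in>R. \<Sum>S\<in>{S \<in> ?P m. l \<notin> S}. ?h l S)"
    using fin assms by (intro sum.Sigma[symmetric]) auto
  also have "\<dots> = (\<Sum>l\<in>R. \<Sum>S\<in>?P m. ?h l S)"
  proof (rule sum.cong[OF refl])
    fix l
    show "(\<Sum>S\<in>{S \<in> ?P m. l \<notin> S}. ?h l S) = (\<Sum>S\<in>?P m. ?h l S)"
    proof (rule sum.mono_neutral_left)
      show "\<forall>S\<in>?P m - {S \<in> ?P m. l \<notin> S}. ?h l S = 0"
      proof
        fix S assume S: "S \<in> ?P m - {S \<in> ?P m. l \<notin> S}"
        then have "finite S" using assms finite_subset by auto
        then show "?h l S = 0" using S by (simp add: minor_duplicate_column)
      qed
    qed (use fin in auto)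
  qed
  finally show ?thesis by (simp add: sum_distrib_left)
qed

lemma bird_sum_Suc:
  "bird_sum A n (Suc m) i j =
     A i j * (\<Sum>l\<in>{Suc i..<n}. bird_sum A n m l l) - (\<Sum>l\<in>{Suc i..<n}. bird_sum A n m i l * A l j)"
proof -
  let ?R = "{Suc i..<n}"
  have "bird_sum A n (Suc m) i j =
      (\<Sum>T | T \<subseteq> ?R \<and> card T = Suc m. A i j * minor A (sl T) (sl T) -
        (\<Sum>l\<in>T. A l j * minor A (i # sl (T - {l})) (l # sl (T - {l}))))"
    unfolding bird_sum_def by (intro sum.cong refl minor_expand_set) (auto intro: finite_subset)
  also have "\<dots> = A i j * (\<Sum>T | T \<subseteq> ?R \<and> card T = Suc m. minor A (sl T) (sl T)) -
      (\<Sum>l\<in>?R. A l j * bird_sum A n m i l)"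
    unfolding sum_subtractf sum_distrib_left[symmetric] sum_minors_by_column[OF finite_atLeastLessThan]
      bird_sum_def by simp
  finally show ?thesis
    by (simp add: sum_minors_by_Min mult.commute)
qed


subsection \<open>Sylvester's criterion\<close>

definition trailing_form :: "(nat \<Rightarrow> nat \<Rightarrow> real) \<Rightarrow> nat \<Rightarrow> nat \<Rightarrow> (nat \<Rightarrow> real) \<Rightarrow> real" where
  "trailing_form A n k v = (\<Sum>i\<in>{k..<n}. \<Sum>j\<in>{k..<n}. A i j * v i * v j)"

text \<open>Cramer's rule out of one expansion. For a column \<open>j\<close> of the trailing block
  the bordered minor vanishes by repetition, which gives the linear system for the quotients
  \<open>w\<close>; for column \<open>k\<close> it is the next larger minor.\<close>

lemma schur_complement:
  fixes A :: "nat \<Rightarrow> nat \<Rightarrow> real"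
  assumes k: "k < n" and ne: "minor A [Suc k..<n] [Suc k..<n] \<noteq> 0"
  obtains w where "\<And>j. j \<in> {Suc k..<n} \<Longrightarrow> (\<Sum>l\<in>{Suc k..<n}. A l j * w l) = A k j"
    and "minor A [k..<n] [k..<n] =
      minor A [Suc k..<n] [Suc k..<n] * (A k k - (\<Sum>l\<in>{Suc k..<n}. A l k * w l))"
proof -
  let ?R = "{Suc k..<n}"
  let ?M = "minor A [Suc k..<n] [Suc k..<n]"
  define c where "c l = minor A (k # sl (?R - {l})) (l # sl (?R - {l}))" for l
  have expand: "minor A (k # sl ?R) (j # sl ?R) = A k j * ?M - (\<Sum>l\<in>?R. A l j * c l)" for j
    unfolding c_def by (subst minor_expand_set) simp_all
  have div: "(\<Sum>l\<in>?R. A l j * (c l / ?M)) = (\<Sum>l\<in>?R. A l j * c l) / ?M" for j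
    by (simp add: sum_divide_distrib)
  show ?thesis
  proof (rule that[of "\<lambda>l. c l / ?M"])
    fix j assume "j \<in> ?R"
    then have "A k j * ?M - (\<Sum>l\<in>?R. A l j * c l) = 0"
      using expand[of j] minor_duplicate_column[of ?R j A k] by simp
    then show "(\<Sum>l\<in>?R. A l j * (c l / ?M)) = A k j"
      using ne unfolding div by (simp add: field_simps)
  next
    have "minor A [k..<n] [k..<n] = A k k * ?M - (\<Sum>l\<in>?R. A l k * c l)"
      using expand[of k] k by (simp add: upt_conv_Cons)
    also have "\<dots> = ?M * (A k k - (\<Sum>l\<in>?R. A l k * (c l / ?M)))"
      using ne unfolding div by (simp add: right_diff_distrib)
    finally show "minor A [k..<n] [k..<n] = \<dots>" .
  qed
qed

text \<open>Completing the square in the variable \<open>v k\<close>; the remaining coefficient is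
  the Schur complement.\<close>

lemma trailing_form_Suc:
  assumes k: "k < n" and sym: "\<And>i j. A i j = A j i"
    and w: "\<And>j. j \<in> {Suc k..<n} \<Longrightarrow> (\<Sum>l\<in>{Suc k..<n}. A l j * w l) = A k j"
  shows "trailing_form A n k v = trailing_form A n (Suc k) (\<lambda>i. v i + v k * w i) +
    (v k)\<^sup>2 * (A k k - (\<Sum>l\<in>{Suc k..<n}. A l k * w l))"
proof -
  let ?R = "{Suc k..<n}"
  let ?t = "v k"
  have ins: "{k..<n} = insert k ?R" using k by auto
  have "trailing_form A n k v = A k k * ?t\<^sup>2 + 2 * ?t * (\<Sum>i\<in>?R. A k i * v i) + trailing_form A n (Suc k) v"
  proof -
    have "trailing_form A n k v = A k k * ?t * ?t + (\<Sum>j\<in>?R. A k j * ?t * v j) +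
        ((\<Sum>i\<in>?R. A i k * v i * ?t) + trailing_form A n (Suc k) v)"
      unfolding trailing_form_def ins by (simp add: sum.distrib)
    moreover have "(\<Sum>j\<in>?R. A k j * ?t * v j) = ?t * (\<Sum>i\<in>?R. A k i * v i)"
      by (simp add: sum_distrib_left ac_simps)
    moreover have "(\<Sum>i\<in>?R. A i k * v i * ?t) = ?t * (\<Sum>i\<in>?R. A k i * v i)"
      by (simp add: sum_distrib_left ac_simps sym[of _ k])
    ultimately show ?thesis by (simp add: power2_eq_square)
  qed
  moreover have "trailing_form A n (Suc k) (\<lambda>i. v i + ?t * w i) =
      trailing_form A n (Suc k) v + 2 * ?t * (\<Sum>i\<in>?R. A k i * v i) + ?t\<^sup>2 * (\<Sum>i\<in>?R. A i k * w i)"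
  proof -
    have cross: "(\<Sum>i\<in>?R. \<Sum>j\<in>?R. A i j * u i * w j) = (\<Sum>i\<in>?R. A k i * u i)" for u
    proof -
      have "(\<Sum>j\<in>?R. A i j * u i * w j) = A k i * u i" if "i \<in> ?R" for i
        using w[OF that, symmetric] by (simp add: sum_distrib_left ac_simps sym[of i])
      then show ?thesis by simp
    qed
    have cross': "(\<Sum>i\<in>?R. \<Sum>j\<in>?R. A i j * w i * u j) = (\<Sum>i\<in>?R. A k i * u i)" for u
      unfolding cross[symmetric] by (subst sum.swap) (simp add: ac_simps sym)
    have "A i j * (v i + ?t * w i) * (v j + ?t * w j) =
        A i j * v i * v j + ?t * (A i j * v i * w j) + ?t * (A i j * w i * v j) + ?t\<^sup>2 * (A i j * w i * w j)" for i j
      by (simp add: algebra_simps power2_eq_square)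
    then have "trailing_form A n (Suc k) (\<lambda>i. v i + ?t * w i) = trailing_form A n (Suc k) v +
        ?t * (\<Sum>i\<in>?R. \<Sum>j\<in>?R. A i j * v i * w j) + ?t * (\<Sum>i\<in>?R. \<Sum>j\<in>?R. A i j * w i * v j) +
        ?t\<^sup>2 * (\<Sum>i\<in>?R. \<Sum>j\<in>?R. A i j * w i * w j)"
      unfolding trailing_form_def by (simp only: sum.distrib sum_distrib_left[symmetric])
    then show ?thesis unfolding cross cross' by (simp add: sym[of _ k])
  qed
  ultimately show ?thesis by (simp add: algebra_simps)
qed

text \<open>Mere positivity would have to be sharpened by compactness before it could beat a cubic
  error. Instead a constant is carried through the successive completions of the square.\<close>

lemma sylvester_coercive:
  assumes sym: "\<And>i j. A i j = A j i"
    and pos: "\<And>k. k < n \<Longrightarrow> 0 < minor A [k..<n] [k..<n]"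
  shows "\<exists>c>0. \<forall>v. c * (\<Sum>i\<in>{0..<n}. (v i)\<^sup>2) \<le> trailing_form A n 0 v"
proof -
  have "\<exists>c>0. \<forall>v. c * (\<Sum>i\<in>{k..<n}. (v i)\<^sup>2) \<le> trailing_form A n k v" if "k \<le> n" for k
    using that
  proof (induction rule: inc_induct)
    case base
    show ?case by (auto simp: trailing_form_def intro: exI[of _ 1])
  next
    case (step k)
    let ?R = "{Suc k..<n}"
    obtain c where c: "c > 0" "\<And>v. c * (\<Sum>i\<in>?R. (v i)\<^sup>2) \<le> trailing_form A n (Suc k) v"
      using step.IH by auto
    have M: "0 < minor A [Suc k..<n] [Suc k..<n]"
      using pos[of "Suc k"] by (cases "Suc k < n") auto
    obtain w where w: "\<And>j. j \<in> ?R \<Longrightarrow> (\<Sum>l\<in>?R. A l j * w l) = A k j"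
      and det: "minor A [k..<n] [k..<n] = minor A [Suc k..<n] [Suc k..<n] * (A k k - (\<Sum>l\<in>?R. A l k * w l))"
      using schur_complement[OF step.hyps(2), of A] M by (metis less_irrefl)
    define s where "s = A k k - (\<Sum>l\<in>?R. A l k * w l)"
    have s: "0 < s"
      using pos[OF step.hyps(2)] M unfolding det s_def by (simp add: zero_less_mult_iff)
    define W where "W = (\<Sum>i\<in>?R. (w i)\<^sup>2)"
    have W: "0 \<le> W" unfolding W_def by (rule sum_nonneg) simp
    \<comment> \<open>Undoing the substitution costs
      \<open>(v i)^2 \<le> 2 * (u i)^2 + 2 * (v k)^2 * (w i)^2\<close>, where
      \<open>u i = v i + v k * w i\<close>. Summation then requires \<open>2 * \<mu> \<le> c\<close>
      and \<open>\<mu> * (1 + 2 * W) \<le> s\<close>.\<close>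
    define \<mu> where "\<mu> = min (c / 2) (s / (1 + 2 * W))"
    have \<mu>: "0 < \<mu>" "2 * \<mu> \<le> c" "\<mu> * (1 + 2 * W) \<le> s"
    proof -
      have "\<mu> \<le> s / (1 + 2 * W)" by (simp add: \<mu>_def)
      then show "\<mu> * (1 + 2 * W) \<le> s" using W by (simp add: pos_le_divide_eq)
    qed (use c(1) s W in \<open>auto simp: \<mu>_def\<close>)
    have "\<mu> * (\<Sum>i\<in>{k..<n}. (v i)\<^sup>2) \<le> trailing_form A n k v" for v
    proof -
      let ?u = "\<lambda>i. v i + v k * w i"
      have "(v i)\<^sup>2 \<le> 2 * (?u i)\<^sup>2 + 2 * (v k)\<^sup>2 * (w i)\<^sup>2" for i
      proof -
        have "2 * (?u i)\<^sup>2 + 2 * (v k)\<^sup>2 * (w i)\<^sup>2 - (v i)\<^sup>2 = (v i + 2 * v k * w i)\<^sup>2"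
          by (simp add: power2_eq_square algebra_simps)
        then show ?thesis by (smt (verit) zero_le_power2)
      qed
      then have "(\<Sum>i\<in>?R. (v i)\<^sup>2) \<le> (\<Sum>i\<in>?R. 2 * (?u i)\<^sup>2 + 2 * (v k)\<^sup>2 * (w i)\<^sup>2)"
        by (rule sum_mono)
      also have "\<dots> = 2 * (\<Sum>i\<in>?R. (?u i)\<^sup>2) + 2 * (v k)\<^sup>2 * W"
        by (simp only: sum.distrib sum_distrib_left[symmetric] W_def)
      finally have *: "(\<Sum>i\<in>?R. (v i)\<^sup>2) \<le> 2 * (\<Sum>i\<in>?R. (?u i)\<^sup>2) + 2 * (v k)\<^sup>2 * W" .
      have "{k..<n} = insert k ?R" using step.hyps(2) by auto
      then have "\<mu> * (\<Sum>i\<in>{k..<n}. (v i)\<^sup>2) = \<mu> * ((v k)\<^sup>2 + (\<Sum>i\<in>?R. (v i)\<^sup>2))" by simp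
      also have "\<dots> \<le> \<mu> * ((v k)\<^sup>2 + (2 * (\<Sum>i\<in>?R. (?u i)\<^sup>2) + 2 * (v k)\<^sup>2 * W))"
        using * \<mu>(1) by (intro mult_left_mono add_left_mono) auto
      also have "\<dots> = (2 * \<mu>) * (\<Sum>i\<in>?R. (?u i)\<^sup>2) + (v k)\<^sup>2 * (\<mu> * (1 + 2 * W))"
        by (simp add: algebra_simps)
      also have "\<dots> \<le> c * (\<Sum>i\<in>?R. (?u i)\<^sup>2) + (v k)\<^sup>2 * s"
        using \<mu> by (intro add_mono mult_right_mono mult_left_mono sum_nonneg) auto
      also have "\<dots> \<le> trailing_form A n (Suc k) ?u + (v k)\<^sup>2 * s"
        using c(2)[of ?u] by simp
      also have "\<dots> = trailing_form A n k v"
        unfolding s_def by (rule trailing_form_Suc[OF step.hyps(2) sym w, symmetric])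
      finally show ?thesis .
    qed
    then show ?case using \<mu>(1) by blast
  qed
  from this[of 0] show ?thesis by simp
qed

lemma sylvester_necessary:
  assumes sym: "\<And>i j. A i j = A j i"
    and pd: "\<And>v. \<exists>i<n. v i \<noteq> 0 \<Longrightarrow> 0 < trailing_form A n 0 v"
    and k: "k \<le> n"
  shows "0 < minor A [k..<n] [k..<n]"
  using k
proof (induction rule: inc_induct)
  case (step k)
  let ?R = "{Suc k..<n}"
  obtain w where w: "\<And>j. j \<in> ?R \<Longrightarrow> (\<Sum>l\<in>?R. A l j * w l) = A k j"
    and det: "minor A [k..<n] [k..<n] = minor A [Suc k..<n] [Suc k..<n] * (A k k - (\<Sum>l\<in>?R. A l k * w l))"
    using schur_complement[OF step.hyps(2), of A] step.IH by (metis less_irrefl)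
  \<comment> \<open>This vector makes the completed square vanish, so the form takes the Schur
    complement as its value.\<close>
  define v where "v i = (if i < k then 0 else if i = k then 1 else - w i)" for i
  have "trailing_form A n k v = (v k)\<^sup>2 * (A k k - (\<Sum>l\<in>?R. A l k * w l))"
  proof -
    have "trailing_form A n (Suc k) (\<lambda>i. v i + v k * w i) = 0"
      by (simp add: trailing_form_def v_def)
    then show ?thesis using trailing_form_Suc[OF step.hyps(2) sym w, of v] by simp
  qed
  moreover have "trailing_form A n 0 v = trailing_form A n k v"
    unfolding trailing_form_def
    by (intro sum.mono_neutral_cong_right) (auto simp: v_def intro!: sum.mono_neutral_right)
  moreover have "0 < trailing_form A n 0 v"
    using step.hyps(2) by (intro pd exI[of _ k]) (simp add: v_def)
  ultimately have "0 < A k k - (\<Sum>l\<in>?R. A l k * w l)" by (simp add: v_def)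
  then show ?case using step.IH unfolding det by simp
qed simp

subsection \<open>Correctness of the determinant iteration\<close>

lemma sum_list_filter_upt:
  "sum_list (map f (filter (\<lambda>l. i < l) [0..<n])) = (\<Sum>l\<in>{Suc i..<n}. f l)"
proof -
  have "set (filter (\<lambda>l. i < l) [0..<n]) = {Suc i..<n}" by auto
  then show ?thesis
    using sum_list_distinct_conv_sum_set[of "filter (\<lambda>l. i < l) [0..<n]" f] by simp
qed

lemma entry_bird_step:
  assumes A: "\<And>i j. i < n \<Longrightarrow> j < n \<Longrightarrow> entry A i j = h i j"
    and Y: "\<And>i j. i < n \<Longrightarrow> j < n \<Longrightarrow> entry Y i j = bird_sum h n m i j"
    and ij: "i < n" "j < n"
  shows "entry (bird_step [0..<n] A Y) i j = bird_sum h n (Suc m) i j"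
proof -
  have "entry (bird_step [0..<n] A Y) i j =
      entry A i j * (\<Sum>l\<in>{Suc i..<n}. entry Y l l) - (\<Sum>l\<in>{Suc i..<n}. entry Y i l * entry A l j)"
    using ij by (simp add: bird_step_def entry_map sum_list_filter_upt)
  also have "\<dots> = bird_sum h n (Suc m) i j"
    using ij by (simp add: bird_sum_Suc A Y)
  finally show ?thesis .
qed

lemma trailing_minors_positive_iff:
  "trailing_minors_positive [0..<n] (map (\<lambda>a. map (h a) [0..<n]) [0..<n]) \<longleftrightarrow>
     (\<forall>i<n. 0 < minor h [i..<n] [i..<n])"
proof -
  define A where "A = map (\<lambda>a. map (h a) [0..<n]) [0..<n]"
  have A: "entry A i j = h i j" if "i < n" "j < n" for i j
    using that by (simp add: A_def entry_map)
  let ?step = "\<lambda>s i. (bird_step [0..<n] A (fst s), snd s \<and> 0 < entry (fst s) i i)"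
  \<comment> \<open>Here \<open>k\<close> counts the indices still to be visited, largest first.
    With \<open>n - k\<close> rounds made, the diagonal entry at \<open>k - 1\<close>, inspected
    next, is already the trailing minor.\<close>
  have "snd (foldl ?step (Y, ok) (rev [0..<k])) \<longleftrightarrow> ok \<and> (\<forall>i<k. 0 < minor h [i..<n] [i..<n])"
    if "k \<le> n" "\<And>i j. i < n \<Longrightarrow> j < n \<Longrightarrow> entry Y i j = bird_sum h n (n - k) i j" for k Y ok
    using that
  proof (induction k arbitrary: Y ok)
    case (Suc k)
    have m: "Suc (n - Suc k) = n - k" "Suc (k + (n - Suc k)) = n" using Suc.prems(1) by auto
    have "entry Y k k = minor h [k..<n] [k..<n]"
      using Suc.prems bird_sum_last[OF m(2)] by simp
    moreover have "snd (foldl ?step (bird_step [0..<n] A Y, ok \<and> 0 < entry Y k k) (rev [0..<k])) \<longleftrightarrow>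
        (ok \<and> 0 < entry Y k k) \<and> (\<forall>i<k. 0 < minor h [i..<n] [i..<n])"
    proof (rule Suc.IH)
      show "entry (bird_step [0..<n] A Y) i j = bird_sum h n (n - k) i j" if "i < n" "j < n" for i j
        using entry_bird_step[OF A Suc.prems(2) that] m(1) by simp
    qed (use Suc.prems in simp)
    ultimately show ?case by (auto simp: less_Suc_eq)
  qed simp
  from this[of n A True] show ?thesis
    by (simp add: trailing_minors_positive_def A_def[symmetric] A bird_sum_0)
qed

lemma minor_real_of_int:
  "real_of_int (minor h R C) = minor (\<lambda>i j. real_of_int (h i j)) R C"
proof -
  have "map_mat real_of_int (mat (length R) (length R) (\<lambda>(a, b). h (R ! a) (C ! b))) =
      mat (length R) (length R) (\<lambda>(a, b). real_of_int (h (R ! a) (C ! b)))"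
    by (rule eq_matI) auto
  then show ?thesis unfolding minor_def by (metis of_int_hom.hom_det)
qed


subsection \<open>Strict local minima of cubic polynomials\<close>

lemma nonneg_if_pos_near_0:
  fixes a b c :: real
  assumes "0 < \<delta>" and pos: "\<And>t. 0 < t \<Longrightarrow> t \<le> \<delta> \<Longrightarrow> 0 < a + b * t + c * t\<^sup>2"
  shows "0 \<le> a"
proof (rule ccontr)
  assume "\<not> 0 \<le> a"
  \<comment> \<open>As \<open>t \<le> 1\<close>, the square is at most \<open>t\<close>, and the
    third bound gives \<open>a + b * t + c * t^2 \<le> - t\<close>. The summand 1 keeps the
    denominator positive and supplies this \<open>- t\<close>.\<close>
  define t where "t = min \<delta> (min 1 (- a / (\<bar>b\<bar> + \<bar>c\<bar> + 1)))"
  have "0 < - a / (\<bar>b\<bar> + \<bar>c\<bar> + 1)"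
    using \<open>\<not> 0 \<le> a\<close> by (intro divide_pos_pos) auto
  then have t: "0 < t" "t \<le> \<delta>" "t \<le> 1"
    using assms(1) by (auto simp: t_def)
  have "t \<le> - a / (\<bar>b\<bar> + \<bar>c\<bar> + 1)" by (simp add: t_def)
  then have bound: "(\<bar>b\<bar> + \<bar>c\<bar> + 1) * t \<le> - a" by (simp add: field_simps)
  have "t\<^sup>2 \<le> t" using t by (simp add: power2_eq_square mult_left_le)
  then have "c * t\<^sup>2 \<le> \<bar>c\<bar> * t"
    by (meson abs_ge_self abs_ge_zero mult_mono zero_le_power2)
  moreover have "b * t \<le> \<bar>b\<bar> * t" using t by (intro mult_right_mono) auto
  ultimately have "a + b * t + c * t\<^sup>2 \<le> - t"
    using bound by (simp add: algebra_simps)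
  then show False using pos[OF t(1,2)] t(1) by linarith
qed

lemma sum_squares_vec_norm2: "(\<Sum>i\<in>{0..<dim_vec v}. (v $ i)\<^sup>2) = (vec_norm2 v)\<^sup>2"
  by (simp add: vec_norm2_def L2_set_def sum_nonneg atLeast0LessThan)

text \<open>
  Along a line through \<open>x\<close> with direction \<open>v\<close> the function is
  \<open>f x + \<alpha> t (g v) + \<beta> t\<^sup>2 (v H v) + t\<^sup>3 T v\<close>. Both signs of \<open>t\<close> are admissible, so the
  linear term vanishes, and the cubic term cannot compensate for a vanishing quadratic term.
\<close>

lemma strict_local_min_cubic_iff:
  fixes f :: "real vec \<Rightarrow> real"
  assumes x: "x \<in> carrier_vec n" and pos: "0 < \<alpha>" "0 < \<beta>" and K: "0 \<le> K"
    and sym: "\<And>i j. h i j = h j i"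
    and f: "\<And>d. d \<in> carrier_vec n \<Longrightarrow>
      f (x + d) = f x + \<alpha> * (\<Sum>a\<in>{0..<n}. g a * d $ a) + \<beta> * trailing_form h n 0 (\<lambda>i. d $ i) + T d"
    and T_scale: "\<And>d t. d \<in> carrier_vec n \<Longrightarrow> T (t \<cdot>\<^sub>v d) = t ^ 3 * T d"
    and T_bound: "\<And>d r. d \<in> carrier_vec n \<Longrightarrow> (\<And>i. i < n \<Longrightarrow> \<bar>d $ i\<bar> \<le> r) \<Longrightarrow> 0 \<le> r \<Longrightarrow> \<bar>T d\<bar> \<le> K * r ^ 3"
  shows "strict_local_min n f x \<longleftrightarrow>
    (\<forall>a<n. g a = 0) \<and> (\<forall>k<n. 0 < minor h [k..<n] [k..<n])"
proof
  assume "strict_local_min n f x"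
  then obtain \<epsilon> where \<epsilon>: "0 < \<epsilon>"
    and less: "\<And>y. y \<in> carrier_vec n \<Longrightarrow> y \<noteq> x \<Longrightarrow> vec_norm2 (y - x) \<le> \<epsilon> \<Longrightarrow> f x < f y"
    unfolding strict_local_min_def by blast
  have main: "(\<Sum>a\<in>{0..<n}. g a * v a) = 0 \<and> 0 < trailing_form h n 0 v" if v: "\<exists>i<n. v i \<noteq> 0" for v
  proof -
    define d where "d = vec n v"
    have d: "d \<in> carrier_vec n" by (simp add: d_def)
    define L where "L = (\<Sum>a\<in>{0..<n}. g a * v a)"
    define Q where "Q = trailing_form h n 0 v"
    define C where "C = T d"
    \<comment> \<open>The 1-norm dominates the Euclidean norm, so
      \<open>\<bar>t\<bar> \<le> \<epsilon> / N\<close> keeps the point in the ball.\<close>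
    define N where "N = (\<Sum>i<n. \<bar>v i\<bar>)"
    obtain i where i: "i < n" "v i \<noteq> 0" using v by blast
    have "\<bar>v i\<bar> \<le> N" unfolding N_def by (rule member_le_sum) (use i in auto)
    then have N: "0 < N" using i(2) by linarith
    have line: "0 < \<alpha> * (t * L) + \<beta> * (t\<^sup>2 * Q) + t ^ 3 * C" if t: "t \<noteq> 0" "\<bar>t\<bar> \<le> \<epsilon> / N" for t
    proof -
      have td: "t \<cdot>\<^sub>v d \<in> carrier_vec n" using d by simp
      have diff: "x + t \<cdot>\<^sub>v d - x = t \<cdot>\<^sub>v d"
        using x d by (intro eq_vecI) auto
      have "vec_norm2 (t \<cdot>\<^sub>v d) \<le> (\<Sum>i<n. \<bar>(t \<cdot>\<^sub>v d) $ i\<bar>)"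
        unfolding vec_norm2_def using L2_set_le_sum_abs[of "\<lambda>i. (t \<cdot>\<^sub>v d) $ i" "{..<n}"] by (simp add: d_def)
      also have "\<dots> = \<bar>t\<bar> * N"
        by (simp add: N_def d_def abs_mult sum_distrib_left)
      also have "\<dots> \<le> \<epsilon>" using t(2) N by (simp add: field_simps)
      finally have "vec_norm2 (x + t \<cdot>\<^sub>v d - x) \<le> \<epsilon>" unfolding diff .
      moreover have "(x + t \<cdot>\<^sub>v d) $ i \<noteq> x $ i"
        using i t(1) x by (simp add: d_def)
      then have "x + t \<cdot>\<^sub>v d \<noteq> x" by auto
      ultimately have "f x < f (x + t \<cdot>\<^sub>v d)"
        using less x td by simp
      moreover have "(\<Sum>a\<in>{0..<n}. g a * (t \<cdot>\<^sub>v d) $ a) = t * L"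
        by (simp add: L_def d_def sum_distrib_left ac_simps)
      moreover have "trailing_form h n 0 (\<lambda>i. (t \<cdot>\<^sub>v d) $ i) = t\<^sup>2 * Q"
        by (simp add: Q_def d_def trailing_form_def sum_distrib_left ac_simps power2_eq_square)
      ultimately show ?thesis
        using f[OF td] T_scale[OF d, of t] by (simp add: C_def)
    qed
    have \<delta>: "0 < \<epsilon> / N" using \<epsilon> N by simp
    have "0 < \<alpha> * L + (\<beta> * Q) * t + C * t\<^sup>2" if "0 < t" "t \<le> \<epsilon> / N" for t
    proof -
      have "0 < t * (\<alpha> * L + (\<beta> * Q) * t + C * t\<^sup>2)"
        using line[of t] that by (simp add: algebra_simps power2_eq_square power3_eq_cube)
      then show ?thesis using that by (simp add: zero_less_mult_iff)
    qed
    from nonneg_if_pos_near_0[OF \<delta> this] have "0 \<le> L"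
      using pos(1) by (simp add: zero_le_mult_iff)
    have "0 < - (\<alpha> * L) + (\<beta> * Q) * t + (- C) * t\<^sup>2" if "0 < t" "t \<le> \<epsilon> / N" for t
    proof -
      have "0 < t * (- (\<alpha> * L) + (\<beta> * Q) * t + (- C) * t\<^sup>2)"
        using line[of "- t"] that by (simp add: algebra_simps power2_eq_square power3_eq_cube)
      then show ?thesis using that by (simp add: zero_less_mult_iff)
    qed
    from nonneg_if_pos_near_0[OF \<delta> this] have "L \<le> 0"
      using pos(1) by (simp add: mult_le_0_iff)
    with \<open>0 \<le> L\<close> have L: "L = 0" by simp
    define \<tau> where "\<tau> = \<epsilon> / N"
    have \<tau>: "0 < \<tau>" "\<tau> \<noteq> 0" "- \<tau> \<noteq> 0" "\<bar>\<tau>\<bar> \<le> \<epsilon> / N" "\<bar>- \<tau>\<bar> \<le> \<epsilon> / N"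
      using \<delta> unfolding \<tau>_def[symmetric] by auto
    \<comment> \<open>Adding the inequalities for \<open>\<tau>\<close> and \<open>- \<tau>\<close>
      cancels the cubic term. This excludes negative directions and kernel vectors of the Hessian at
      the same time.\<close>
    have "0 < \<beta> * (\<tau>\<^sup>2 * Q)"
      using line[OF \<tau>(2,4)] line[OF \<tau>(3,5)] L by simp
    then have "0 < Q" using pos(2) \<tau>(1) by (simp add: zero_less_mult_iff)
    with L show ?thesis by (simp add: L_def Q_def)
  qed
  have "g a = 0" if "a < n" for a
  proof -
    have "(\<Sum>b\<in>{0..<n}. g b * (if b = a then 1 else 0)) = 0"
      using main[of "\<lambda>b. if b = a then 1 else 0"] that by auto
    then show ?thesis using that by (simp add: if_distrib cong: if_cong)
  qed
  moreover have "0 < minor h [k..<n] [k..<n]" if "k < n" for k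
    using sylvester_necessary[of h n k, OF sym] main that by auto
  ultimately show "(\<forall>a<n. g a = 0) \<and> (\<forall>k<n. 0 < minor h [k..<n] [k..<n])" by blast
next
  assume *: "(\<forall>a<n. g a = 0) \<and> (\<forall>k<n. 0 < minor h [k..<n] [k..<n])"
  then obtain c where c: "0 < c" "\<And>v. c * (\<Sum>i\<in>{0..<n}. (v i)\<^sup>2) \<le> trailing_form h n 0 v"
    using sylvester_coercive[of h n, OF sym] by blast
  \<comment> \<open>Chosen so that \<open>K * r < \<beta> * c\<close> for
    \<open>r \<le> \<epsilon>\<close>; then the quadratic term beats the cubic one. Adding 1 covers
    \<open>K = 0\<close> and makes the inequality strict.\<close>
  define \<epsilon> where "\<epsilon> = \<beta> * c / (K + 1)"
  have \<epsilon>: "0 < \<epsilon>" using pos c K by (simp add: \<epsilon>_def)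
  have "f x < f y" if y: "y \<in> carrier_vec n" "y \<noteq> x" "vec_norm2 (y - x) \<le> \<epsilon>" for y
  proof -
    define d where "d = y - x"
    have d: "d \<in> carrier_vec n" using x y by (simp add: d_def)
    have yx: "y = x + d" using x y by (intro eq_vecI) (auto simp: d_def)
    define r where "r = vec_norm2 d"
    have r0: "0 \<le> r" by (simp add: r_def vec_norm2_def L2_set_nonneg)
    have sq: "(\<Sum>i\<in>{0..<n}. (d $ i)\<^sup>2) = r\<^sup>2"
      using sum_squares_vec_norm2[of d] d by (simp add: r_def)
    have comp: "\<bar>d $ i\<bar> \<le> r" if "i < n" for i
    proof -
      have "(d $ i)\<^sup>2 \<le> r\<^sup>2"
        unfolding sq[symmetric] by (rule member_le_sum) (use that in auto)
      then show ?thesis using r0 abs_le_square_iff[of "d $ i" r] by simp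
    qed
    have "r \<noteq> 0"
    proof
      assume "r = 0"
      then have "d $ i = 0" if "i < n" for i using comp[OF that] by simp
      then have "x = y" using x y d by (intro eq_vecI) (auto simp: d_def)
      then show False using y(2) by simp
    qed
    then have r: "0 < r" using r0 by simp
    have "r \<le> \<epsilon>" using y(3) by (simp add: r_def d_def)
    then have "K * r \<le> K * \<epsilon>" using K by (rule mult_left_mono)
    also have "\<dots> < \<beta> * c" using pos c K by (simp add: \<epsilon>_def field_simps)
    finally have "r\<^sup>2 * (K * r) < r\<^sup>2 * (\<beta> * c)" using r by (intro mult_strict_left_mono) auto
    then have "K * r ^ 3 < \<beta> * (c * r\<^sup>2)"
      by (simp add: power2_eq_square power3_eq_cube ac_simps)
    also have "\<dots> \<le> \<beta> * trailing_form h n 0 (\<lambda>i. d $ i)"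
      using c(2)[of "\<lambda>i. d $ i"] pos(2) unfolding sq by simp
    finally have "K * r ^ 3 < \<beta> * trailing_form h n 0 (\<lambda>i. d $ i)" .
    moreover have "\<bar>T d\<bar> \<le> K * r ^ 3"
      by (rule T_bound[OF d comp r0])
    moreover have "(\<Sum>a\<in>{0..<n}. g a * d $ a) = 0"
      using * by simp
    ultimately show ?thesis using f[OF d] unfolding yx by simp
  qed
  then show "strict_local_min n f x"
    unfolding strict_local_min_def using \<epsilon> by blast
qed


subsection \<open>Homogeneous cubic forms\<close>

definition form_value :: "cubic_form \<Rightarrow> (nat \<Rightarrow> real) \<Rightarrow> real" where
  "form_value F u = sum_list (map (\<lambda>(c, i, j, k). real_of_int c * u i * u j * u k) F)"

lemma form_value_scale: "form_value F (\<lambda>i. t * u i) = t ^ 3 * form_value F u"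
  unfolding form_value_def
  by (induction F) (auto simp: algebra_simps power3_eq_cube)

lemma form_value_bound:
  assumes "\<And>i. \<bar>u i\<bar> \<le> r" "0 \<le> r"
  shows "\<bar>form_value F u\<bar> \<le> sum_list (map (\<lambda>(c, i, j, k). \<bar>real_of_int c\<bar>) F) * r ^ 3"
  unfolding form_value_def
proof (induction F)
  case (Cons t F)
  obtain c i j k where t: "t = (c, i, j, k)" by (metis prod_cases4)
  have "\<bar>u i\<bar> * \<bar>u j\<bar> * \<bar>u k\<bar> \<le> r * r * r"
    using assms by (intro mult_mono) auto
  then have "\<bar>real_of_int c\<bar> * (\<bar>u i\<bar> * \<bar>u j\<bar> * \<bar>u k\<bar>) \<le> \<bar>real_of_int c\<bar> * r ^ 3"
    by (intro mult_left_mono) (auto simp: power3_eq_cube)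
  then have "\<bar>real_of_int c * u i * u j * u k\<bar> \<le> \<bar>real_of_int c\<bar> * r ^ 3"
    by (simp add: abs_mult ac_simps)
  then show ?case using Cons by (simp add: t algebra_simps)
qed simp

lemma form_hessian_sym: "form_hessian F v a b = form_hessian F v b a"
  unfolding form_hessian_def
  by (simp only: conj_commute add.commute add.left_commute)

text \<open>The expansion is exact, and homogeneity makes the cubic remainder the form itself at
  \<open>e\<close>. The premise on \<open>e\<close> leaves the homogenizing coordinate fixed and
  confines all derivatives to indices below \<open>n\<close>.\<close>

lemma form_taylor:
  fixes e :: "nat \<Rightarrow> real"
  assumes e: "\<And>i. n \<le> i \<Longrightarrow> e i = 0"
  shows "form_value F (\<lambda>i. real_of_int (nth_default 0 v i) + t * e i) =
    form_value F (\<lambda>i. real_of_int (nth_default 0 v i)) +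
    t * (\<Sum>a\<in>{0..<n}. real_of_int (form_gradient F v a) * e a) +
    t\<^sup>2 / 2 * trailing_form (\<lambda>a b. real_of_int (form_hessian F v a b)) n 0 e +
    t ^ 3 * form_value F e"
proof (induction F)
  case Nil
  show ?case by (simp add: form_value_def form_gradient_def form_hessian_def trailing_form_def)
next
  case (Cons p F)
  obtain c i j k where p: "p = (c, i, j, k)" by (metis prod_cases4)
  define V where "V i = real_of_int (nth_default 0 v i)" for i
  \<comment> \<open>Also valid for an index \<open>i\<close> outside the range of summation, where
    the sum is empty of matches and \<open>e i = 0\<close>.\<close>
  have d1: "(\<Sum>a\<in>{0..<n}. (if i = a then X else 0) * e a) = X * e i" for i X
  proof -
    have "(\<Sum>a\<in>{0..<n}. (if i = a then X else 0) * e a) = (\<Sum>a\<in>{0..<n}. if i = a then X * e a else 0)"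
      by (intro sum.cong) auto
    then show ?thesis using e[of i] by (auto simp: sum.delta)
  qed
  have d2: "(\<Sum>a\<in>{0..<n}. \<Sum>b\<in>{0..<n}. (if i = a \<and> j = b then X else 0) * e a * e b) = X * e i * e j" for i j X
  proof -
    have "(\<Sum>b\<in>{0..<n}. (if i = a \<and> j = b then X else 0) * e a * e b) = (if i = a then X * e j else 0) * e a" for a
    proof -
      have "(\<Sum>b\<in>{0..<n}. (if i = a \<and> j = b then X else 0) * e a * e b) =
          (\<Sum>b\<in>{0..<n}. (if j = b then (if i = a then X * e a else 0) else 0) * e b)"
        by (intro sum.cong) auto
      then show ?thesis unfolding d1 by simp
    qed
    then show ?thesis using d1[of i "X * e j"] by (simp add: ac_simps)
  qed
  have grad: "(\<Sum>a\<in>{0..<n}. real_of_int (form_gradient (p # F) v a) * e a) =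
      c * (V j * V k * e i + V i * V k * e j + V i * V j * e k) +
      (\<Sum>a\<in>{0..<n}. real_of_int (form_gradient F v a) * e a)"
  proof -
    have "real_of_int (form_gradient (p # F) v a) * e a =
        c * ((if i = a then V j * V k else 0) * e a + (if j = a then V i * V k else 0) * e a +
          (if k = a then V i * V j else 0) * e a) + real_of_int (form_gradient F v a) * e a" for a
      by (simp add: form_gradient_def p V_def algebra_simps)
    then show ?thesis by (simp only: sum.distrib sum_distrib_left[symmetric] d1)
  qed
  have hess: "trailing_form (\<lambda>a b. real_of_int (form_hessian (p # F) v a b)) n 0 e =
      c * (2 * (V k * e i * e j) + 2 * (V j * e i * e k) + 2 * (V i * e j * e k)) +
      trailing_form (\<lambda>a b. real_of_int (form_hessian F v a b)) n 0 e"
  proof -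
    have "real_of_int (form_hessian (p # F) v a b) * e a * e b =
        c * ((if i = a \<and> j = b then V k else 0) * e a * e b + (if j = a \<and> i = b then V k else 0) * e a * e b +
          (if i = a \<and> k = b then V j else 0) * e a * e b + (if k = a \<and> i = b then V j else 0) * e a * e b +
          (if j = a \<and> k = b then V i else 0) * e a * e b + (if k = a \<and> j = b then V i else 0) * e a * e b) +
        real_of_int (form_hessian F v a b) * e a * e b" for a b
    proof -
      have "real_of_int (form_hessian (p # F) v a b) =
          c * ((if i = a \<and> j = b then V k else 0) + (if j = a \<and> i = b then V k else 0) +
            (if i = a \<and> k = b then V j else 0) + (if k = a \<and> i = b then V j else 0) +
            (if j = a \<and> k = b then V i else 0) + (if k = a \<and> j = b then V i else 0)) +
          real_of_int (form_hessian F v a b)"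
        by (simp add: form_hessian_def p V_def if_distrib[of real_of_int] cong: if_cong split del: if_split)
      then show ?thesis by (simp only: distrib_left distrib_right mult.assoc add.assoc)
    qed
    then have "trailing_form (\<lambda>a b. real_of_int (form_hessian (p # F) v a b)) n 0 e =
        c * (V k * e i * e j + V k * e j * e i + V j * e i * e k + V j * e k * e i +
          V i * e j * e k + V i * e k * e j) +
        trailing_form (\<lambda>a b. real_of_int (form_hessian F v a b)) n 0 e"
      unfolding trailing_form_def by (simp only: sum.distrib sum_distrib_left[symmetric] d2)
    then show ?thesis by (simp add: algebra_simps)
  qed
  have form_Cons: "form_value (p # F) u = real_of_int c * u i * u j * u k + form_value F u" for u
    by (simp add: form_value_def p)
  have "c * (V i + t * e i) * (V j + t * e j) * (V k + t * e k) = c * V i * V j * V k +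
      t * (c * (V j * V k * e i + V i * V k * e j + V i * V j * e k)) +
      t\<^sup>2 / 2 * (c * (2 * (V k * e i * e j) + 2 * (V j * e i * e k) + 2 * (V i * e j * e k))) +
      t ^ 3 * (c * e i * e j * e k)"
    by (simp add: field_simps power2_eq_square power3_eq_cube)
  then show ?case
    using Cons.IH unfolding form_Cons grad hess V_def[symmetric] distrib_left[of "t"]
      distrib_left[of "t\<^sup>2 / 2"] distrib_left[of "t ^ 3"]
    by linarith
qed

subsection \<open>Decoding the input word\<close>

lemma bits_eq: "bits m = map Bit (nbits m)"
  by (induction m rule: nbits.induct) (subst bits.simps, subst nbits.simps, simp)

lemma foldl_read_symbol_bits:
  "foldl read_symbol (neg, ds, num, qs, ps) (map letter_code (map Bit bs)) = (neg, rev bs @ ds, num, qs, ps)"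
proof (induction bs arbitrary: ds)
  case (Cons b bs)
  then show ?case by (cases b) (simp_all add: read_symbol_def)
qed simp

lemma foldl_read_symbol_rat:
  assumes "quotient_of r = (a, b)"
  shows "foldl read_symbol (False, [], num, qs, ps) (map letter_code (encode_rat r @ [Comma])) =
    (False, [], 0, qs @ [(a, b)], ps)"
proof -
  have b: "0 < b" using assms quotient_of_denom_pos by blast
  have "foldl read_symbol (False, [], num, qs, ps) (map letter_code (if a < 0 then [Minus] else [])) =
      (a < 0, [], num, qs, ps)"
    by (simp add: read_symbol_def)
  then show ?thesis
    using b bits_value_rev_nbits
    by (simp add: encode_rat_def assms bits_eq foldl_read_symbol_bits del: map_map)
      (simp add: read_symbol_def foldl_read_symbol_bits bits_value_rev_nbits del: map_map)
qed

lemma foldl_read_symbol_rats: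
  "foldl read_symbol (False, [], 0, qs, ps) (map letter_code (encode_rats rs)) =
    (False, [], 0, qs @ map quotient_of rs, ps)"
proof (induction rs arbitrary: qs)
  case (Cons r rs)
  obtain a b where q: "quotient_of r = (a, b)" by fastforce
  have "encode_rats (r # rs) = (encode_rat r @ [Comma]) @ encode_rats rs"
    by (simp add: encode_rats_def)
  then show ?case
    using Cons[of "qs @ [(a, b)]"] foldl_read_symbol_rat[OF q, of 0 qs ps]
    by (simp only: map_append foldl_append) (simp add: q)
qed (simp add: encode_rats_def)

lemma read_word_input_word:
  "read_word (input_word n p x) =
    (map quotient_of (list_of_vec x), map quotient_of (map (Poly_Mapping.lookup p) (cubic_monomials n)))"
proof -
  have "foldl read_symbol (False, [], 0, [], []) (input_word n p x) =
      (False, [], 0, map quotient_of (map (Poly_Mapping.lookup p) (cubic_monomials n)),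
        map quotient_of (list_of_vec x))"
    unfolding input_word_def encode_instance_def map_append foldl_append foldl_read_symbol_rats
    by (simp add: read_symbol_def foldl_read_symbol_rats del: map_map)
  then show ?thesis by (simp add: read_word_def)
qed

lemma set_input_word: "set (input_word n p x) \<subseteq> {..<blank_sym}"
proof -
  have "letter_code a < blank_sym" for a by (cases a rule: letter_code.cases) auto
  then show ?thesis by (auto simp: input_word_def)
qed

lemma denominator_pos: "0 < denominator (map quotient_of rs)"
  by (induction rs) (auto simp: denominator_def quotient_of_denom_pos' intro!: mult_pos_pos)

lemma length_numerators [simp]: "length (numerators qs) = length qs"
  by (simp add: numerators_def Let_def)

lemma numerators_nth:
  assumes "i < length rs"
  shows "real_of_int (numerators (map quotient_of rs) ! i) =
    real_of_rat (rs ! i) * real_of_int (denominator (map quotient_of rs))"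
proof -
  let ?qs = "map quotient_of rs" and ?I = "{0..<length rs}"
  let ?b = "\<lambda>k. snd (nth_default (0, 1) ?qs k)"
  obtain a b where q: "quotient_of (rs ! i) = (a, b)" by fastforce
  have b: "0 < b" using q quotient_of_denom_pos by blast
  have "prod_list (map (\<lambda>k. if k = i then 1 else ?b k) [0..<length rs]) =
      (\<Prod>k\<in>?I. if k = i then 1 else ?b k)"
    using prod.distinct_set_conv_list[of "[0..<length rs]" "\<lambda>k. if k = i then 1 else ?b k"] by simp
  also have "\<dots> = (\<Prod>k\<in>?I - {i}. ?b k)"
    using assms by (simp add: prod.remove[of ?I i])
  finally have num: "numerators ?qs ! i = a * (\<Prod>k\<in>?I - {i}. ?b k)"
    using assms q by (simp add: numerators_def nth_default_def[of _ _ i] Let_def)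
  have "map ?b [0..<length rs] = map snd ?qs"
    by (rule nth_equalityI) (auto simp: nth_default_def)
  then have "denominator ?qs = (\<Prod>k\<in>?I. ?b k)"
    using prod.distinct_set_conv_list[of "[0..<length rs]" ?b] by (simp add: denominator_def)
  also have "\<dots> = b * (\<Prod>k\<in>?I - {i}. ?b k)"
    using assms q by (subst prod.remove[of _ i]) (auto simp: nth_default_def)
  finally have den: "denominator ?qs = b * (\<Prod>k\<in>?I - {i}. ?b k)" .
  have "real_of_rat (rs ! i) = real_of_int a / real_of_int b"
    using quotient_of_div[OF q] by (simp add: of_rat_divide)
  then show ?thesis using b by (simp add: num den)
qed

section \<open>The integer cubic form of an instance and its relation to the polynomial\<close>

definition index_lists :: "nat \<Rightarrow> nat list list" where
  "index_lists n = [[]] @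
      [[i]. i \<leftarrow> [0..<n]] @
      [[i, j]. i \<leftarrow> [0..<n], j \<leftarrow> [i..<n]] @
      [[i, j, k]. i \<leftarrow> [0..<n], j \<leftarrow> [i..<n], k \<leftarrow> [j..<n]]"

lemma cubic_monomials_eq: "cubic_monomials n = map monom_of (index_lists n)"
  by (simp add: cubic_monomials_def index_lists_def)

definition pad :: "nat \<Rightarrow> nat list \<Rightarrow> nat \<times> nat \<times> nat" where
  "pad n is = (nth_default n is 0, nth_default n is 1, nth_default n is 2)"

lemma filter_le_upt: "filter (\<lambda>j. i \<le> j) [0..<n] = [i..<n]"
  by (induction n) auto

lemma index_triples_eq: "index_triples [0..<n] n = map (pad n) (index_lists n)"
  by (simp add: index_triples_def index_lists_def filter_le_upt map_concat pad_def comp_def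
      nth_default_def concat_map_singleton)

lemma index_listsD:
  assumes "is \<in> set (index_lists n)"
  shows "set is \<subseteq> {..<n}" "length is \<le> 3"
  using assms by (auto simp: index_lists_def)

lemma prod_list_count:
  "prod_list (map f xs) = (\<Prod>x\<in>set xs. f x ^ count_list xs x :: 'a::comm_monoid_mult)"
proof (induction xs)
  case (Cons a xs)
  show ?case
  proof (cases "a \<in> set xs")
    case True
    then have "(\<Prod>x\<in>set xs. f x ^ count_list (a # xs) x) = (\<Prod>x\<in>set xs. (if x = a then f a else 1) * f x ^ count_list xs x)"
      by (intro prod.cong) auto
    then show ?thesis using Cons True by (simp add: insert_absorb prod.distrib)
  next
    case False
    then have "(\<Prod>x\<in>set xs. f x ^ count_list (a # xs) x) = (\<Prod>x\<in>set xs. f x ^ count_list xs x)"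
      by (intro prod.cong) auto
    then show ?thesis using Cons False by (simp add: count_notin)
  qed
qed simp

lemma eval_mpoly_cubic:
  assumes "cubic n p"
  shows "eval_mpoly p y = sum_list (map (\<lambda>is.
    real_of_rat (Poly_Mapping.lookup p (monom_of is)) * prod_list (map (\<lambda>i. y $ i) is)) (index_lists n))"
proof -
  let ?g = "\<lambda>m. real_of_rat (Poly_Mapping.lookup p m) *
    (\<Prod>i\<in>Poly_Mapping.keys m. (y $ i) ^ Poly_Mapping.lookup m i)"
  have "Poly_Mapping.keys p \<subseteq> set (cubic_monomials n)"
    using assms by (auto simp: cubic_def set_cubic_monomials)
  then have "eval_mpoly p y = (\<Sum>m\<in>set (cubic_monomials n). ?g m)"
    unfolding eval_mpoly_def by (rule sum.mono_neutral_left[OF finite_set]) (simp add: in_keys_iff)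
  also have "\<dots> = sum_list (map ?g (cubic_monomials n))"
    by (rule sum.distinct_set_conv_list[OF distinct_cubic_monomials])
  also have "\<dots> = sum_list (map (\<lambda>is. real_of_rat (Poly_Mapping.lookup p (monom_of is)) *
      prod_list (map (\<lambda>i. y $ i) is)) (index_lists n))"
    by (simp add: cubic_monomials_eq comp_def keys_monom_of lookup_monom_of prod_list_count)
  finally show ?thesis .
qed

lemma prod_list_pad:
  assumes "length is \<le> 3" "u n = 1"
  shows "(case pad n is of (i, j, k) \<Rightarrow> u i * u j * u k) = prod_list (map u is :: real list)"
proof -
  consider "is = []" | i where "is = [i]" | i j where "is = [i, j]" | i j k where "is = [i, j, k]"
    using assms(1) by (auto simp: numeral_3_eq_3 le_Suc_eq length_Suc_conv)
  then show ?thesis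
    by cases (use assms(2) in \<open>auto simp: pad_def nth_default_def\<close>)
qed

lemma form_terms_eq_zip:
  "length cs = length ts \<Longrightarrow> form_terms cs ts = zip cs ts"
  by (rule nth_equalityI) (auto simp: form_terms_def nth_default_def)

definition instance_form :: "nat \<Rightarrow> rat_mpoly \<Rightarrow> cubic_form" where
  "instance_form n p = form_terms
     (numerators (map quotient_of (map (Poly_Mapping.lookup p) (cubic_monomials n))))
     (index_triples [0..<n] n)"

lemma form_value_instance_form:
  assumes p: "cubic n p" and u: "u n = 1" "\<And>i. i < n \<Longrightarrow> u i = y $ i"
  shows "form_value (instance_form n p) u =
    real_of_int (denominator (map quotient_of (map (Poly_Mapping.lookup p) (cubic_monomials n)))) * eval_mpoly p y"
proof -
  let ?rs = "map (Poly_Mapping.lookup p) (cubic_monomials n)"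
  let ?E = "real_of_int (denominator (map quotient_of ?rs))"
  let ?cs = "numerators (map quotient_of ?rs)"
  let ?L = "index_lists n"
  have len: "length ?cs = length ?L" by (simp add: cubic_monomials_eq)
  have cs: "map real_of_int ?cs = map (\<lambda>is. real_of_rat (Poly_Mapping.lookup p (monom_of is)) * ?E) ?L"
  proof (rule nth_equalityI)
    fix i assume "i < length (map real_of_int ?cs)"
    then show "map real_of_int ?cs ! i = map (\<lambda>is. real_of_rat (Poly_Mapping.lookup p (monom_of is)) * ?E) ?L ! i"
      using numerators_nth[of i ?rs] by (simp add: cubic_monomials_eq)
  qed (simp add: cubic_monomials_eq)
  have "form_value (instance_form n p) u =
      sum_list (map (\<lambda>(c, t). c * (case t of (i, j, k) \<Rightarrow> u i * u j * u k)) (zip (map real_of_int ?cs) (map (pad n) ?L)))"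
    unfolding form_value_def instance_form_def index_triples_eq
    by (subst form_terms_eq_zip)
      (use len in \<open>auto simp: zip_map1 comp_def split_def mult.assoc\<close>)
  also have "\<dots> = sum_list (map (\<lambda>is. real_of_rat (Poly_Mapping.lookup p (monom_of is)) * ?E *
      (case pad n is of (i, j, k) \<Rightarrow> u i * u j * u k)) ?L)"
    unfolding cs by (simp add: zip_map_map zip_same_conv_map comp_def)
  also have "\<dots> = sum_list (map (\<lambda>is. ?E * (real_of_rat (Poly_Mapping.lookup p (monom_of is)) *
      prod_list (map (\<lambda>i. y $ i) is))) ?L)"
  proof (intro arg_cong[of _ _ sum_list] map_cong refl)
    fix "is" assume "is": "is \<in> set ?L"
    have eq: "map u is = map (\<lambda>i. y $ i) is"
      using index_listsD(1)[OF "is"] u(2) by (intro map_cong) auto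
    have "(case pad n is of (i, j, k) \<Rightarrow> u i * u j * u k) = prod_list (map (\<lambda>i. y $ i) is)"
      unfolding eq[symmetric] by (rule prod_list_pad[OF index_listsD(2)[OF "is"]]) (rule u(1))
    then show "real_of_rat (Poly_Mapping.lookup p (monom_of is)) * ?E * (case pad n is of (i, j, k) \<Rightarrow> u i * u j * u k) =
        ?E * (real_of_rat (Poly_Mapping.lookup p (monom_of is)) * prod_list (map (\<lambda>i. y $ i) is))"
      by simp
  qed
  also have "\<dots> = ?E * eval_mpoly p y"
    by (simp add: eval_mpoly_cubic[OF p] sum_list_const_mult)
  finally show ?thesis .
qed

lemma decide_correct:
  assumes p: "cubic n p" and x: "x \<in> carrier_vec n"
  shows "decide (input_word n p x) \<longleftrightarrow> strict_local_min n (eval_mpoly p) (map_vec real_of_rat x)"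
proof -
  let ?ps = "map quotient_of (list_of_vec x)"
  define F where "F = instance_form n p"
  define D where "D = denominator ?ps"
  define E where "E = denominator (map quotient_of (map (Poly_Mapping.lookup p) (cubic_monomials n)))"
  define v where "v = numerators ?ps @ [D]"
  define V where "V i = real_of_int (nth_default 0 v i)" for i
  define X where "X = map_vec real_of_rat x"
  define f where "f = eval_mpoly p"
  have D: "0 < real_of_int D" and E: "0 < real_of_int E"
    unfolding D_def E_def by (simp_all add: denominator_pos del: map_map)
  have len: "length ?ps = n" using x by simp
  have X: "X \<in> carrier_vec n" using x by (simp add: X_def)
  have Vi: "V i = D * X $ i" if "i < n" for i
    using numerators_nth[of i "list_of_vec x"] that x len
    by (simp add: V_def v_def D_def X_def nth_default_def nth_append list_of_vec_index mult.commute)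
  have Vn: "V n = D"
    using len by (simp add: V_def v_def nth_default_def nth_append)
  \<comment> \<open>Beyond the dimension \<open>d $ i\<close> is unspecified, while the form also
    reads coordinate \<open>n\<close>, which a displacement must not change.\<close>
  define ext where "ext d i = (if i < n then d $ i else 0)" for d :: "real vec" and i
  \<comment> \<open>The displacement is scaled along with the point: all coordinates, the
    homogenizing one included, are \<open>D\<close> times those of \<open>(X + d, 1)\<close>, and
    homogeneity extracts \<open>D ^ 3\<close>.\<close>
  have value_f: "form_value F (\<lambda>i. V i + D * ext d i) = D ^ 3 * (E * f (X + d))" if d: "d \<in> carrier_vec n" for d
  proof -
    define u where "u i = (V i + D * ext d i) / D" for i
    have "form_value F u = E * f (X + d)"
      unfolding F_def E_def f_def
      by (rule form_value_instance_form[OF p])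
        (use D d X in \<open>auto simp: u_def ext_def Vn Vi field_simps\<close>)
    moreover have "(\<lambda>i. V i + D * ext d i) = (\<lambda>i. D * u i)"
      using D by (auto simp: u_def)
    ultimately show ?thesis by (simp add: form_value_scale)
  qed
  define h where "h a b = real_of_int (form_hessian F v a b)" for a b
  define T where "T d = form_value F (ext d) / E" for d
  define K where "K = sum_list (map (\<lambda>(c, i, j, k). \<bar>real_of_int c\<bar>) F)"
  have K: "0 \<le> K" unfolding K_def by (rule sum_list_nonneg) auto
  have main: "strict_local_min n f X \<longleftrightarrow>
      (\<forall>a<n. real_of_int (form_gradient F v a) = 0) \<and> (\<forall>k<n. 0 < minor h [k..<n] [k..<n])"
  \<comment> \<open>Both factors come from \<open>form_taylor\<close> at \<open>t = D\<close>,
    divided by the factor \<open>D ^ 3 * E\<close> between the form and \<open>f\<close>.\<close>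
  proof (rule strict_local_min_cubic_iff[OF X, where \<alpha> = "D / (D ^ 3 * E)" and \<beta> = "D\<^sup>2 / 2 / (D ^ 3 * E)"
        and T = T and K = "K / E"])
    show "0 < D / (D ^ 3 * E)" "0 < D\<^sup>2 / 2 / (D ^ 3 * E)" "0 \<le> K / E"
      using D E K by simp_all
    show "h i j = h j i" for i j
      by (simp add: h_def form_hessian_sym)
  next
    fix d :: "real vec" assume d: "d \<in> carrier_vec n"
    have "D ^ 3 * (E * f (X + d)) = form_value F V +
        D * (\<Sum>a\<in>{0..<n}. real_of_int (form_gradient F v a) * ext d a) +
        D\<^sup>2 / 2 * trailing_form h n 0 (ext d) + D ^ 3 * form_value F (ext d)"
      using form_taylor[of n "ext d" F v "real_of_int D"] value_f[OF d]
      by (simp add: V_def[symmetric] h_def[symmetric] ext_def)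
    \<comment> \<open>The displacement 0 identifies the constant term.\<close>
    moreover have "form_value F V = D ^ 3 * (E * f X)"
      using value_f[of "0\<^sub>v n"] X by (simp add: ext_def cong: if_cong)
    moreover have "(\<Sum>a\<in>{0..<n}. real_of_int (form_gradient F v a) * ext d a) =
        (\<Sum>a\<in>{0..<n}. real_of_int (form_gradient F v a) * d $ a)"
      by (simp add: ext_def)
    moreover have "trailing_form h n 0 (ext d) = trailing_form h n 0 (\<lambda>i. d $ i)"
      by (simp add: trailing_form_def ext_def)
    moreover define P where "P = real_of_int (D ^ 3 * E)"
    ultimately have "P * f (X + d) = P * f X +
        D * (\<Sum>a\<in>{0..<n}. real_of_int (form_gradient F v a) * d $ a) +
        D\<^sup>2 / 2 * trailing_form h n 0 (\<lambda>i. d $ i) + P * T d"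
      using E by (simp add: T_def)
    moreover have "0 < P" using D E by (simp add: P_def)
    ultimately show "f (X + d) = f X + D / (D ^ 3 * E) * (\<Sum>a\<in>{0..<n}. real_of_int (form_gradient F v a) * d $ a) +
        D\<^sup>2 / 2 / (D ^ 3 * E) * trailing_form h n 0 (\<lambda>i. d $ i) + T d"
      unfolding P_def[symmetric] by (simp add: field_simps)
    show "T (t \<cdot>\<^sub>v d) = t ^ 3 * T d" for t
    proof -
      have "ext (t \<cdot>\<^sub>v d) = (\<lambda>i. t * ext d i)" using d by (auto simp: ext_def)
      then show ?thesis by (simp add: T_def form_value_scale)
    qed
    fix r assume r: "\<And>i. i < n \<Longrightarrow> \<bar>d $ i\<bar> \<le> r" "0 \<le> r"
    have "\<bar>form_value F (ext d)\<bar> \<le> K * r ^ 3"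
      unfolding K_def by (rule form_value_bound) (use r in \<open>auto simp: ext_def\<close>)
    then show "\<bar>T d\<bar> \<le> K / E * r ^ 3"
      using E by (simp add: T_def divide_right_mono)
  qed
  have "decide (input_word n p x) \<longleftrightarrow> list_all (\<lambda>a. form_gradient F v a = 0) [0..<n] \<and>
      trailing_minors_positive [0..<n] (map (\<lambda>a. map (\<lambda>b. form_hessian F v a b) [0..<n]) [0..<n])"
    using len by (simp add: decide_def read_word_input_word Let_def F_def instance_form_def v_def D_def)
  also have "\<dots> \<longleftrightarrow> (\<forall>a<n. form_gradient F v a = 0) \<and> (\<forall>i<n. 0 < minor (form_hessian F v) [i..<n] [i..<n])"
    by (simp add: trailing_minors_positive_iff list_all_iff Ball_def)
  also have "\<dots> \<longleftrightarrow> (\<forall>a<n. real_of_int (form_gradient F v a) = 0) \<and> (\<forall>k<n. 0 < minor h [k..<n] [k..<n])"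
    unfolding h_def minor_real_of_int[symmetric] by simp
  finally show ?thesis using main by (simp add: X_def f_def)
qed

theorem corollary3p5:
  shows "\<exists>(M :: (nat, nat) tm) (T :: nat poly). wf_tm M \<and>
    (\<forall>n (p :: rat_mpoly) (x :: rat vec). cubic n p \<and> x \<in> carrier_vec n \<longrightarrow>
       valid_input M (input_word n p x) \<and>
       answers_within M (input_word n p x) (poly T (length (input_word n p x)))
         (strict_local_min n (eval_mpoly p) (map_vec real_of_rat x)))"
proof -
  obtain M :: "(nat, nat) tm" and T :: "nat poly" where M: "wf_tm M" "symbols M = {..blank_sym}" "blank M = blank_sym"
    and answers: "\<And>w. set w \<subseteq> {..<blank_sym} \<Longrightarrow> answers_within M w (poly T (length w)) (decide w)"
    using FP_decides_in_polynomial_time[OF FP_decide] by blast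
  have "valid_input M (input_word n p x)" for n p x
    using set_input_word[of n p x] by (auto simp: valid_input_def M)
  moreover have "answers_within M (input_word n p x) (poly T (length (input_word n p x)))
      (strict_local_min n (eval_mpoly p) (map_vec real_of_rat x))"
    if "cubic n p" "x \<in> carrier_vec n" for n p x
    unfolding decide_correct[OF that, symmetric] by (rule answers[OF set_input_word])
  ultimately show ?thesis using M(1) by blast
qed

end
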